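(* Let $\alpha\in(0,\frac12)$ and $T\in\mathbb{R}$. There exist constants $\widetilde{c_\theta}>0$, $\widetilde{c_\ell}>0$ with $\widetilde{c_\theta}-2\alpha\widetilde{c_\ell}=-1$, and a function $f_*:\mathbb{R}\to(0,\infty)$ such that: (1) $f_*$ is positive, even, and monotone non-increasing on $[0,\infty)$; (2) $x\mapsto f_*(\sqrt{x})$ is convex on $[0,\infty)$; (3) $f_*\in C^\infty(\mathbb{R})$; and the function $\theta(x,t)=(T-t)^{\widetilde{c_\theta}-\widetilde{c_\ell}}\,x\,f_*\!\left(\frac{x}{(T-t)^{\widetilde{c_\ell}}}\right)$, $t<T$, is a solution of the one-dimensional reduced problem $$\partial_t\theta(x,t)+u(x,t)\,\partial_x\theta(x,t)=0,\qquad u(x,t)=-\frac{c_{0,\alpha}}{\alpha}\int_0^\infty\theta(\xi,t)\left(|x-\xi|^{-2\alpha}-|x+\xi|^{-2\alpha}\right)d\xi,$$ where the last integral converges for each $x,t$.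
   Context: $c_{0,\alpha}=\frac{2^{2\alpha-1}\Gamma(1+\alpha)}{\pi\,\Gamma(1-\alpha)}$. For odd $\theta(\cdot,t)$ the velocity above is the symmetrized form of $u(x,t)=-\frac{c_{0,\alpha}}{\alpha}\int_{\mathbb{R}}\theta(\xi,t)|x-\xi|^{-2\alpha}\,d\xi$, which is the restriction to the boundary $y=0$ of the horizontal velocity of gSQG on the half-plane (with odd reflection) for $y$-independent $\theta$. *)

theory Defs
  imports "HOL-Analysis.Analysis"
begin

definition c0 :: "real \<Rightarrow> real" where
  "c0 \<alpha> = 2 powr (2*\<alpha> - 1) * Gamma (1 + \<alpha>) / (pi * Gamma (1 - \<alpha>))"

definition vel_integrand :: "real \<Rightarrow> (real \<Rightarrow> real \<Rightarrow> real) \<Rightarrow> real \<Rightarrow> real \<Rightarrow> real \<Rightarrow> real" where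
  "vel_integrand \<alpha> \<theta> x t \<xi> =
     \<theta> \<xi> t * (\<bar>x - \<xi>\<bar> powr (-2*\<alpha>) - \<bar>x + \<xi>\<bar> powr (-2*\<alpha>))"

definition vel :: "real \<Rightarrow> (real \<Rightarrow> real \<Rightarrow> real) \<Rightarrow> real \<Rightarrow> real \<Rightarrow> real" where
  "vel \<alpha> \<theta> x t = - (c0 \<alpha> / \<alpha>) * integral {0<..} (vel_integrand \<alpha> \<theta> x t)"

definition smooth_real :: "(real \<Rightarrow> real) \<Rightarrow> bool" where
  "smooth_real f \<longleftrightarrow> (\<exists>D :: nat \<Rightarrow> real \<Rightarrow> real. D 0 = f \<and>
      (\<forall>n x. (D n has_real_derivative D (Suc n) x) (at x)))"

end

(* With s = x^2 and theta(x) = x g(x^2), the velocity is a constant times x V(x^2), where, with a = 2 alpha and sigma = (1 - a)/2,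
     V(s) = int_0^1 tau^(a/2) (1 - tau)^(sigma - 1) int_0^oo lambda^(sigma - 1) g(tau s + lambda) dlambda dtau.
   This is the Riesz potential on radial functions in dimension three, and the formula shows that it preserves complete
   monotonicity in s.  For W = V(0) - V the self-similar equation becomes g'/g = - W / (2 s (kappa + W)) with a constant kappa > 0.
   The right-hand side again defines a completely monotone function, so g |-> exp(- int W / (2 s (kappa + W))) maps completely
   monotone functions to completely monotone functions.  Fixing the dilation by g'(0) = -1/2, i.e. kappa = W'(0), gives
   g''(0) <= 3 and g >= (1 + s)^(-1/2) as invariant bounds, and since V gains sigma derivatives, each higher derivative at 0 can be
   bounded in terms of the lower ones.  The resulting set is convex and compact for pointwise convergence, and a fixed point exists
   by Schauder's argument.  The lower bound for g forces W(oo) > kappa / a, which gives the decay needed for V(0) to be finite and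
   the sign needed for c_theta - 2 alpha c_l = -1 after scaling the amplitude. *)
theory Submission
  imports Defs
begin

text \<open>\<open>W\<close> is a Bernstein function: \<open>Z = W'\<close> is completely monotone.
  Hence so are the mean of \<open>Z\<close> over [0, s], which is W / s, the reciprocal 1 / (2
  (kappa + W)) and their product \<open>Q\<close>, and the solution of u' = - \<open>Q\<close> u
  inherits this. Complete monotonicity is treated through sequences of sign-adjusted derivatives,
  never through Laplace transforms. The obstacle is that the normalisation and the bounds on g admit
  functions with a positive limit at infinity, for which V is infinite. So \<open>W\<close> is built
  from g' alone, whose integral is at most 1 in absolute value; V appears only for the fixed point,
  once its decay is known. That decay comes in two rounds: a weak rate gives g -> 0, which makes
  truncated potentials comparable with \<open>W\<close>; the lower bound for g then gives W(oo) >
  kappa / a and a rate for which V(0) is finite. The function (1 + s)^(-1/2) has two roles: it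
  solves the extremal equation u' = - u / (2 (1 + s)), extremal because W / s <= kappa, and it shows
  that the invariant set is nonempty.\<close>

section \<open>Fixed points under pointwise convergence\<close>

text \<open>Tychonoff's theorem; a countable product is first countable, so compactness yields one
  subsequence that works for all coordinates at once.\<close>

lemma unit_cube_subseq:
  fixes X :: "nat \<Rightarrow> nat \<Rightarrow> real"
  assumes "\<And>k i. X k i \<in> {0..1}"
  obtains r l where "strict_mono r" "\<And>i. l i \<in> {0..1}" "\<And>i. (\<lambda>k. X (r k) i) \<longlonglongrightarrow> l i"
proof -
  have "compactin (product_topology (\<lambda>_::nat. euclidean) UNIV) (PiE UNIV (\<lambda>_. {0..1::real}))"
    unfolding compactin_PiE by simp
  then have "compact (PiE (UNIV::nat set) (\<lambda>_. {0..1::real}))"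
    unfolding euclidean_product_topology compactin_euclidean_iff .
  then have "seq_compact (PiE (UNIV::nat set) (\<lambda>_. {0..1::real}))"
    by (rule compact_imp_seq_compact)
  moreover have "\<forall>k. X k \<in> PiE UNIV (\<lambda>_. {0..1})"
    using assms by (simp add: PiE_iff)
  ultimately obtain l r where l: "l \<in> PiE UNIV (\<lambda>_. {0..1::real})" "strict_mono r" "(X \<circ> r) \<longlonglongrightarrow> l"
    by (rule seq_compactE)
  have "(\<lambda>k. X (r k) i) \<longlonglongrightarrow> l i" for i
  proof -
    have "isCont (\<lambda>f::nat \<Rightarrow> real. f i) l"
      using continuous_on_product_coordinates[of i, where ?'b=real] continuous_on_eq_continuous_at[OF open_UNIV] by blast
    then show ?thesis
      using isCont_tendsto_compose[OF _ l(3)] by (auto simp: o_def)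
  qed
  moreover have "l i \<in> {0..1}" for i
    using PiE_mem[OF l(1)] by simp
  ultimately show thesis using that l(2) by blast
qed

text \<open>Brouwer's theorem with the dimension as a variable; the library version has it as a type.\<close>

lemma brouwer_cube_nat:
  fixes \<phi> :: "(nat \<Rightarrow> real) \<Rightarrow> nat \<Rightarrow> real"
  assumes maps: "\<And>x i. (\<And>j. j < m \<Longrightarrow> x j \<in> {0..1}) \<Longrightarrow> i < m \<Longrightarrow> \<phi> x i \<in> {0..1}"
    and cont: "\<And>X x i. (\<And>k j. j < m \<Longrightarrow> X k j \<in> {0..1}) \<Longrightarrow> (\<And>j. j < m \<Longrightarrow> x j \<in> {0..1}) \<Longrightarrow>
        (\<And>j. j < m \<Longrightarrow> (\<lambda>k. X k j) \<longlonglongrightarrow> x j) \<Longrightarrow> i < m \<Longrightarrow> (\<lambda>k. \<phi> (X k) i) \<longlonglongrightarrow> \<phi> x i"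
  shows "\<exists>x. (\<forall>i<m. x i \<in> {0..1}) \<and> (\<forall>i<m. \<phi> x i = x i)"
proof -
  define C where "C k q i r s \<longleftrightarrow> (\<forall>j<m. q j \<le> r j \<and> r j \<le> q j + 1) \<and> (\<forall>j<m. q j \<le> s j \<and> s j \<le> q j + 1) \<and>
       \<phi> (\<lambda>j. r j / Suc k) i \<ge> r i / Suc k \<and> \<phi> (\<lambda>j. s j / Suc k) i \<le> s i / Suc k"
    for k i :: nat and q r s :: "nat \<Rightarrow> nat"
  have "\<exists>q. \<forall>i<m. q i < Suc k \<and> (\<exists>r s. C k q i r s)" for k
  proof -
    define p where "p = Suc k"
    \<comment> \<open>Label 1 records that \<open>\<phi>\<close> moves coordinate \<open>i\<close>
      down. Kuhn's lemma asks for label 0 where the coordinate is 0 and label 1 where it is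
      \<open>p\<close>; at these ends the inequalities \<open>lb0\<close> and \<open>lb1\<close>
      hold because \<open>\<phi>\<close> maps into the cube.\<close>
    define lb where "lb x i = (if x i = p \<or> (x i \<noteq> 0 \<and> \<phi> (\<lambda>j. real (x j) / p) i < real (x i) / p) then 1 else 0::nat)"
      for x :: "nat \<Rightarrow> nat" and i
    have p: "0 < p" by (simp add: p_def)
    obtain q where q: "\<forall>i<m. q i < p"
      "\<forall>i<m. \<exists>r s :: nat \<Rightarrow> nat. (\<forall>j<m. q j \<le> r j \<and> r j \<le> q j + 1) \<and> (\<forall>j<m. q j \<le> s j \<and> s j \<le> q j + 1) \<and> lb r i \<noteq> lb s i"
      by (rule kuhn_lemma[OF p, of m lb]) (use p in \<open>auto simp: lb_def\<close>)
    have unit: "real (x j) / p \<in> {0..1}" if "\<forall>j<m. q j \<le> x j \<and> x j \<le> q j + 1" "j < m" for x j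
    proof -
      have "x j \<le> p" using that q(1) by (metis Suc_eq_plus1 Suc_leI order_trans)
      then show ?thesis using p by (simp add: divide_le_eq_1)
    qed
    have lb0: "\<phi> (\<lambda>j. x j / p) i \<ge> x i / p"
      if "\<forall>j<m. q j \<le> x j \<and> x j \<le> q j + 1" "i < m" "lb x i = 0" for x i
      using maps[of "\<lambda>j. x j / p" i] unit[OF that(1)] that p by (auto simp: lb_def split: if_splits)
    have lb1: "\<phi> (\<lambda>j. x j / p) i \<le> x i / p"
      if "\<forall>j<m. q j \<le> x j \<and> x j \<le> q j + 1" "i < m" "lb x i = 1" for x i
      using maps[of "\<lambda>j. x j / p" i] unit[OF that(1)] that p by (auto simp: lb_def split: if_splits)
    show ?thesis
    proof (rule exI[of _ q], intro allI impI, rule conjI)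
      fix i assume i: "i < m"
      show "q i < Suc k" using q(1) i by (simp add: p_def)
      obtain r s where rs: "\<forall>j<m. q j \<le> r j \<and> r j \<le> q j + 1" "\<forall>j<m. q j \<le> s j \<and> s j \<le> q j + 1" "lb r i \<noteq> lb s i"
        using q(2) i by blast
      consider "lb r i = 0" "lb s i = 1" | "lb s i = 0" "lb r i = 1"
        using rs(3) by (auto simp: lb_def split: if_splits)
      then show "\<exists>r s. C k q i r s"
      proof cases
        case 1
        with rs(1,2) lb0[OF rs(1) i] lb1[OF rs(2) i] have "C k q i r s"
          unfolding p_def C_def by blast
        then show ?thesis by blast
      next
        case 2
        with rs(1,2) lb0[OF rs(2) i] lb1[OF rs(1) i] have "C k q i s r"
          unfolding p_def C_def by blast
        then show ?thesis by blast
      qed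
    qed
  qed
  then obtain q where q: "\<And>k i. i < m \<Longrightarrow> q k i < Suc k" "\<And>k i. i < m \<Longrightarrow> \<exists>r s. C k (q k) i r s"
    by metis
  \<comment> \<open>Coordinates from \<open>m\<close> on are set to 0, so that the sequence lies in
    the infinite cube.\<close>
  define X where "X k i = (if i < m then real (q k i) / Suc k else 0)" for k i
  have X01: "X k i \<in> {0..1}" for k i
    using q(1)[of i k] by (auto simp: X_def divide_le_eq_1)
  obtain g x where g: "strict_mono g" and x01: "\<And>i. x i \<in> {0..1}" and lim: "\<And>i. (\<lambda>k. X (g k) i) \<longlonglongrightarrow> x i"
    using unit_cube_subseq[of X] X01 by metis
  have inv0: "(\<lambda>k. 1 / real (Suc (g k))) \<longlonglongrightarrow> 0"
    using LIMSEQ_subseq_LIMSEQ[OF LIMSEQ_inverse_real_of_nat g] by (simp add: o_def inverse_eq_divide)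
  \<comment> \<open>Every corner of the Kuhn cell is within 1 / (g k + 1) of the base vertex in each
    coordinate, so the witnesses of both labels share the limit \<open>x\<close>.\<close>
  have close: "(\<lambda>k. real (r k j) / Suc (g k)) \<longlonglongrightarrow> x j"
    if "\<And>k j. j < m \<Longrightarrow> q (g k) j \<le> r k j \<and> r k j \<le> q (g k) j + 1" "j < m" for r j
  proof (rule tendsto_sandwich[OF _ _ lim[of j]])
    show "\<forall>\<^sub>F k in sequentially. X (g k) j \<le> real (r k j) / Suc (g k)"
      using that by (intro always_eventually) (auto simp: X_def divide_right_mono)
    show "\<forall>\<^sub>F k in sequentially. real (r k j) / Suc (g k) \<le> X (g k) j + 1 / Suc (g k)"
    proof (intro always_eventually allI)
      fix k
      have "real (r k j) \<le> real (q (g k) j) + 1" using that(1)[of j k] that(2) by linarith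
      then show "real (r k j) / Suc (g k) \<le> X (g k) j + 1 / Suc (g k)"
        using that(2) by (auto simp: X_def add_divide_distrib[symmetric] divide_right_mono)
    qed
    show "(\<lambda>k. X (g k) j + 1 / real (Suc (g k))) \<longlonglongrightarrow> x j"
      using tendsto_add[OF lim inv0] by simp
  qed
  have "\<phi> x i = x i" if i: "i < m" for i
  proof -
    define r where "r k = (SOME r. \<exists>s. C (g k) (q (g k)) i r s)" for k
    define s where "s k = (SOME s. C (g k) (q (g k)) i (r k) s)" for k
    have "\<exists>s. C (g k) (q (g k)) i (r k) s" for k
      using someI_ex[OF q(2)[OF i, of "g k"]] unfolding r_def .
    from someI_ex[OF this] have "C (g k) (q (g k)) i (r k) (s k)" for k
      unfolding s_def .
    then have r: "\<And>k j. j < m \<Longrightarrow> q (g k) j \<le> r k j \<and> r k j \<le> q (g k) j + 1"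
      and s: "\<And>k j. j < m \<Longrightarrow> q (g k) j \<le> s k j \<and> s k j \<le> q (g k) j + 1"
      and \<phi>: "\<And>k. \<phi> (\<lambda>j. real (r k j) / Suc (g k)) i \<ge> real (r k i) / Suc (g k)"
         "\<And>k. \<phi> (\<lambda>j. real (s k j) / Suc (g k)) i \<le> real (s k i) / Suc (g k)"
      unfolding C_def by blast+
    have in01: "real (r k j) / Suc (g k) \<in> {0..1}"
      if "\<And>k j. j < m \<Longrightarrow> q (g k) j \<le> r k j \<and> r k j \<le> q (g k) j + 1" "j < m" for r k j
    proof -
      have "r k j \<le> Suc (g k)" using that(1)[of j k] that(2) q(1)[of j "g k"] by linarith
      then show ?thesis by (auto simp: divide_le_eq_1)
    qed
    have \<phi>lim: "(\<lambda>k. \<phi> (\<lambda>j. real (r k j) / Suc (g k)) i) \<longlonglongrightarrow> \<phi> x i"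
      if "\<And>k j. j < m \<Longrightarrow> q (g k) j \<le> r k j \<and> r k j \<le> q (g k) j + 1" for r
      by (rule cont[of "\<lambda>k j. real (r k j) / Suc (g k)"]) (use in01[OF that] x01 close[OF that] i in blast)+
    have "x i \<le> \<phi> x i"
      by (rule LIMSEQ_le[OF close[OF r i] \<phi>lim[OF r]]) (use \<phi>(1) in blast)+
    moreover have "\<phi> x i \<le> x i"
      by (rule LIMSEQ_le[OF \<phi>lim[OF s] close[OF s i]]) (use \<phi>(2) in blast)+
    ultimately show ?thesis by simp
  qed
  with x01 show ?thesis by blast
qed

section \<open>Finite nets and approximate fixed points\<close>

lemma convex_combination_closed:
  fixes D :: "('a \<Rightarrow> real) set" and F :: "'b \<Rightarrow> 'a \<Rightarrow> real"
  assumes conv: "\<And>f g t. f \<in> D \<Longrightarrow> g \<in> D \<Longrightarrow> 0 \<le> t \<Longrightarrow> t \<le> 1 \<Longrightarrow> (\<lambda>x. t * f x + (1 - t) * g x) \<in> D"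
    and "finite J" "\<And>j. j \<in> J \<Longrightarrow> F j \<in> D" "\<And>j. j \<in> J \<Longrightarrow> 0 \<le> w j" "sum w J = 1"
  shows "(\<lambda>x. \<Sum>j\<in>J. w j * F j x) \<in> D"
  using assms(2-)
proof (induction J arbitrary: w rule: finite_induct)
  case empty
  then show ?case by simp
next
  case (insert a J)
  have s: "w a + sum w J = 1" using insert by simp
  show ?case
  proof (cases "sum w J = 0")
    case True
    then have "\<And>j. j \<in> J \<Longrightarrow> w j = 0"
      using insert by (simp add: sum_nonneg_eq_0_iff)
    then have "(\<lambda>x. \<Sum>j\<in>insert a J. w j * F j x) = F a"
      using insert True s by (auto simp: fun_eq_iff)
    then show ?thesis using insert by simp
  next
    case False
    define S where "S = sum w J"
    have S: "S > 0" "S \<le> 1"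
    proof -
      have "0 \<le> sum w J" "0 \<le> w a" using insert.prems(2) by (auto intro: sum_nonneg)
      then show "S > 0" "S \<le> 1" using False s by (auto simp: S_def)
    qed
    have "(\<lambda>x. \<Sum>j\<in>J. (w j / S) * F j x) \<in> D"
      using insert S by (intro insert.IH) (auto simp: S_def sum_divide_distrib[symmetric])
    then have "(\<lambda>x. w a * F a x + (1 - w a) * (\<Sum>j\<in>J. (w j / S) * F j x)) \<in> D"
      using insert S s by (intro conv) (auto simp: S_def)
    moreover have "(1 - w a) * (\<Sum>j\<in>J. (w j / S) * F j x) = (\<Sum>j\<in>J. w j * F j x)" for x
      using s S by (simp add: S_def[symmetric] sum_distrib_left flip: s)
    ultimately show ?thesis using insert by simp
  qed
qed

lemma nat_floor_eq_imp_close: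
  fixes x y :: real
  assumes "0 \<le> x" "0 \<le> y" "0 < n" "nat \<lfloor>x * n\<rfloor> = nat \<lfloor>y * n\<rfloor>"
  shows "\<bar>x - y\<bar> < 1 / n"
proof -
  have "\<lfloor>x * n\<rfloor> = \<lfloor>y * n\<rfloor>"
    using assms by (simp add: nat_eq_iff)
  then have "\<bar>x * n - y * n\<bar> < 1" by linarith
  then have "\<bar>x - y\<bar> * n < 1" using assms by (simp add: abs_mult left_diff_distrib[symmetric])
  then show ?thesis using assms by (simp add: field_simps)
qed

text \<open>Schauder's argument: project \<open>R\<close> onto a finite net of \<open>D\<close>, of which only the values at the first \<open>n\<close>
  evaluation points matter, and apply Brouwer's theorem to the barycentric weights.\<close>

lemma pointwise_approximate_fixed_point:
  fixes D :: "('a \<Rightarrow> real) set" and q :: "nat \<Rightarrow> 'a" and n :: nat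
  assumes ne: "D \<noteq> {}" and n: "0 < n"
    and conv: "\<And>f g t. f \<in> D \<Longrightarrow> g \<in> D \<Longrightarrow> 0 \<le> t \<Longrightarrow> t \<le> 1 \<Longrightarrow> (\<lambda>x. t * f x + (1 - t) * g x) \<in> D"
    and unit: "\<And>g i. g \<in> D \<Longrightarrow> g (q i) \<in> {0..1}"
    and maps: "\<And>g. g \<in> D \<Longrightarrow> R g \<in> D"
    and cont: "\<And>X l i. (\<And>k. X k \<in> D) \<Longrightarrow> l \<in> D \<Longrightarrow> (\<And>x. (\<lambda>k. X k x) \<longlonglongrightarrow> l x) \<Longrightarrow> (\<lambda>k. R (X k) (q i)) \<longlonglongrightarrow> R l (q i)"
  shows "\<exists>g\<in>D. \<forall>i<n. \<bar>R g (q i) - g (q i)\<bar> \<le> 1 / n"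
proof -
  \<comment> \<open>Rounds the first \<open>n\<close> values down to multiples of 1 / n. Only
    finitely many keys occur on \<open>D\<close>, and one member per key gives the net.\<close>
  define key where "key g = (\<lambda>i\<in>{..<n}. nat \<lfloor>g (q i) * n\<rfloor>)" for g :: "'a \<Rightarrow> real"
  have "key ` D \<subseteq> PiE {..<n} (\<lambda>_. {..n})"
  proof (clarsimp simp: key_def)
    fix g i assume "g \<in> D"
    then have "0 \<le> g (q i)" "g (q i) \<le> 1"
      using unit[of g i] by auto
    then have "g (q i) * n \<le> 1 * real n"
      by (intro mult_right_mono) auto
    then show "nat \<lfloor>g (q i) * n\<rfloor> \<le> n"
      by (simp add: nat_le_iff floor_le_iff)
  qed
  then have fin: "finite (key ` D)"
    by (rule finite_subset) (auto intro: finite_PiE)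
  obtain ks :: "(nat \<Rightarrow> nat) list" where ks: "set ks = key ` D" using finite_list[OF fin] by auto
  define m where "m = length ks"
  have m: "m > 0" using ne ks by (auto simp: m_def)
  have "\<exists>g. g \<in> D \<and> key g = ks ! j" if "j < m" for j
    using ks that nth_mem[of j ks] by (auto simp: m_def)
  then obtain F where F: "\<And>j. j < m \<Longrightarrow> F j \<in> D" "\<And>j. j < m \<Longrightarrow> key (F j) = ks ! j" by metis
  have net: "\<exists>j<m. \<forall>i<n. \<bar>g (q i) - F j (q i)\<bar> < 1 / n" if g: "g \<in> D" for g
  proof -
    obtain j where j: "j < m" "ks ! j = key g"
      using g ks by (metis (no_types, lifting) image_eqI in_set_conv_nth m_def)
    have "\<bar>g (q i) - F j (q i)\<bar> < 1 / n" if i: "i < n" for i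
    proof (rule nat_floor_eq_imp_close)
      show "nat \<lfloor>g (q i) * real n\<rfloor> = nat \<lfloor>F j (q i) * real n\<rfloor>"
        using F(2)[OF j(1)] j(2) i by (auto simp: key_def fun_eq_iff restrict_def split: if_splits)
    qed (use unit[OF g, of i] unit[OF F(1)[OF j(1)], of i] n in auto)
    with j(1) show ?thesis by blast
  qed
  \<comment> \<open>Tent weights: positive only if \<open>F j\<close> is closer than 1 / n to
    \<open>g\<close> at all of the first \<open>n\<close> points.\<close>
  define lam where "lam j g = (\<Prod>i<n. max 0 (1 / n - \<bar>g (q i) - F j (q i)\<bar>))" for j and g :: "'a \<Rightarrow> real"
  define L where "L g = (\<Sum>j<m. lam j g)" for g
  have lam0: "lam j g \<ge> 0" for j g unfolding lam_def by (intro prod_nonneg) auto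
  have Lpos: "L g > 0" if g: "g \<in> D" for g
  proof -
    obtain j where j: "j < m" "\<forall>i<n. \<bar>g (q i) - F j (q i)\<bar> < 1 / n" using net[OF g] by blast
    then have "lam j g > 0" unfolding lam_def by (intro prod_pos) auto
    then show ?thesis unfolding L_def using j(1) lam0 by (intro sum_pos2[of _ j]) auto
  qed
  \<comment> \<open>Retraction of the cube to the simplex: a deficit of the sum is added at index 0,
    an excess is divided out. Vectors of sum 1 are left unchanged, and \<open>\<phi>\<close>
    produces only such vectors, so at a Brouwer fixed point \<open>w\<close> disappears.\<close>
  define w where "w y j = (y j + (if j = 0 then max 0 (1 - (\<Sum>i<m. y i)) else 0)) / max 1 (\<Sum>i<m. y i)"
    for y :: "nat \<Rightarrow> real" and j
  have w0: "w y j \<ge> 0" if "\<And>j. j < m \<Longrightarrow> y j \<in> {0..1}" "j < m" for y j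
    using that(1)[OF that(2)] by (auto simp: w_def)
  have w1: "(\<Sum>j<m. w y j) = 1" for y
  proof -
    have "(\<Sum>j<m. y j + (if j = 0 then max 0 (1 - (\<Sum>i<m. y i)) else 0)) = max 1 (\<Sum>i<m. y i)"
      using m by (simp add: sum.distrib)
    then show ?thesis by (simp add: w_def sum_divide_distrib[symmetric])
  qed
  define f where "f y = (\<lambda>x. \<Sum>j<m. w y j * F j x)" for y
  have fD: "f y \<in> D" if "\<And>j. j < m \<Longrightarrow> y j \<in> {0..1}" for y
    unfolding f_def by (rule convex_combination_closed[OF conv]) (use F w0[OF that] w1 in auto)
  define \<phi> where "\<phi> y j = lam j (R (f y)) / L (R (f y))" for y j
  have "\<exists>y. (\<forall>i<m. y i \<in> {0..1}) \<and> (\<forall>i<m. \<phi> y i = y i)"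
  proof (rule brouwer_cube_nat)
    fix y :: "nat \<Rightarrow> real" and i assume y: "\<And>j. j < m \<Longrightarrow> y j \<in> {0..1}" and i: "i < m"
    have "lam i (R (f y)) \<le> L (R (f y))"
      unfolding L_def using i lam0 by (intro member_le_sum) auto
    then show "\<phi> y i \<in> {0..1}"
      using less_imp_le[OF Lpos[OF maps[OF fD]], of y] y lam0[of i "R (f y)"] by (auto simp: \<phi>_def divide_le_eq_1 zero_le_divide_iff)
  next
    fix Y y i assume Y: "\<And>k j. j < m \<Longrightarrow> Y k j \<in> {0..1}" and y: "\<And>j. j < m \<Longrightarrow> y j \<in> {0..1::real}"
      and lim: "\<And>j. j < m \<Longrightarrow> (\<lambda>k. Y k j) \<longlonglongrightarrow> y j" and i: "i < m"
    have sum: "(\<lambda>k. \<Sum>j<m. Y k j) \<longlonglongrightarrow> (\<Sum>j<m. y j)"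
      by (intro tendsto_sum lim) auto
    have "(\<lambda>k. w (Y k) j) \<longlonglongrightarrow> w y j" if "j < m" for j
      unfolding w_def using that
      by (cases "j = 0") (auto intro!: tendsto_intros lim sum tendsto_max)
    then have "(\<lambda>k. f (Y k) x) \<longlonglongrightarrow> f y x" for x
      unfolding f_def by (intro tendsto_intros) auto
    then have R: "(\<lambda>k. R (f (Y k)) (q i)) \<longlonglongrightarrow> R (f y) (q i)" for i
      using cont[of "\<lambda>k. f (Y k)" "f y"] fD Y y by blast
    have L: "(\<lambda>k. lam j (R (f (Y k)))) \<longlonglongrightarrow> lam j (R (f y))" for j
      unfolding lam_def by (intro tendsto_intros tendsto_max R)
    then show "(\<lambda>k. \<phi> (Y k) i) \<longlonglongrightarrow> \<phi> y i"
      unfolding \<phi>_def L_def using less_imp_neq[OF Lpos[OF maps[OF fD]], of y] y by (intro tendsto_intros L) (auto simp: L_def)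
  qed
  then obtain y where y: "\<And>i. i < m \<Longrightarrow> y i \<in> {0..1}" "\<And>i. i < m \<Longrightarrow> \<phi> y i = y i" by blast
  have RD: "R (f y) \<in> D" using maps fD y(1) by blast
  have "(\<Sum>j<m. \<phi> y j) = 1"
    using Lpos[OF RD] by (simp add: \<phi>_def sum_divide_distrib[symmetric] flip: L_def)
  then have ysum: "(\<Sum>j<m. y j) = 1" using y(2) by simp
  then have wy: "w y j = y j" for j by (simp add: w_def)
  show ?thesis
  proof (intro bexI[of _ "f y"] allI impI)
    show "f y \<in> D" using fD y(1) by blast
    fix i assume i: "i < n"
    have "R (f y) (q i) - f y (q i) = (\<Sum>j<m. y j * (R (f y) (q i) - F j (q i)))"
      by (simp add: f_def wy right_diff_distrib sum_subtractf ysum flip: sum_distrib_right)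
    also have "\<bar>\<dots>\<bar> \<le> (\<Sum>j<m. y j * (1 / n))"
    proof (rule order_trans[OF sum_abs sum_mono])
      fix j assume "j \<in> {..<m}"
      then have j: "j < m" by simp
      show "\<bar>y j * (R (f y) (q i) - F j (q i))\<bar> \<le> y j * (1 / n)"
      proof (cases "y j = 0")
        case False
        then have "lam j (R (f y)) \<noteq> 0" using y(2)[OF j] by (auto simp: \<phi>_def)
        then have "max 0 (1 / n - \<bar>R (f y) (q i) - F j (q i)\<bar>) \<noteq> 0"
          unfolding lam_def using i by (auto simp: prod_zero_iff)
        then have "\<bar>R (f y) (q i) - F j (q i)\<bar> \<le> 1 / n" by auto
        then show ?thesis using y(1)[OF j] mult_left_mono[of _ "1 / n" "y j"] by (auto simp: abs_mult)
      qed auto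
    qed
    also have "\<dots> = 1 / n" by (simp add: ysum flip: sum_divide_distrib)
    finally show "\<bar>R (f y) (q i) - f y (q i)\<bar> \<le> 1 / n" .
  qed
qed

text \<open>Approximate fixed points have a convergent subsequence, and each index \<open>i\<close>
  is eventually among those that are controlled. The set \<open>S\<close> restricts convergence to
  the half-line in the application, where values at negative arguments are arbitrary; equality is
  obtained only at the points \<open>q i\<close>, which will be dense.\<close>

theorem pointwise_fixed_point:
  fixes D :: "('a \<Rightarrow> real) set" and q :: "nat \<Rightarrow> 'a"
  assumes ne: "D \<noteq> {}"
    and conv: "\<And>f g t. f \<in> D \<Longrightarrow> g \<in> D \<Longrightarrow> 0 \<le> t \<Longrightarrow> t \<le> 1 \<Longrightarrow> (\<lambda>x. t * f x + (1 - t) * g x) \<in> D"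
    and unit: "\<And>g i. g \<in> D \<Longrightarrow> g (q i) \<in> {0..1}"
    and maps: "\<And>g. g \<in> D \<Longrightarrow> R g \<in> D"
    and q: "\<And>i. q i \<in> S"
    and comp: "\<And>X. (\<And>k. X k \<in> D) \<Longrightarrow> \<exists>l\<in>D. \<exists>r::nat \<Rightarrow> nat. strict_mono r \<and> (\<forall>x\<in>S. (\<lambda>k. X (r k) x) \<longlonglongrightarrow> l x)"
    and cont: "\<And>X l. (\<And>k. X k \<in> D) \<Longrightarrow> l \<in> D \<Longrightarrow> (\<And>x. x \<in> S \<Longrightarrow> (\<lambda>k. X k x) \<longlonglongrightarrow> l x) \<Longrightarrow> 
        (\<And>x. x \<in> S \<Longrightarrow> (\<lambda>k. R (X k) x) \<longlonglongrightarrow> R l x)"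
  shows "\<exists>g\<in>D. \<forall>i. R g (q i) = g (q i)"
proof -
  have "\<exists>g\<in>D. \<forall>i<Suc n. \<bar>R g (q i) - g (q i)\<bar> \<le> 1 / Suc n" for n
    by (rule pointwise_approximate_fixed_point[OF ne _ conv unit maps]) (use cont q in auto)
  then obtain X where X: "\<And>n. X n \<in> D" "\<And>n i. i < Suc n \<Longrightarrow> \<bar>R (X n) (q i) - X n (q i)\<bar> \<le> 1 / Suc n"
    by metis
  obtain l r where l: "l \<in> D" "strict_mono r" "\<And>x. x \<in> S \<Longrightarrow> (\<lambda>k. X (r k) x) \<longlonglongrightarrow> l x"
    using comp[of X] X(1) by blast
  have "R l (q i) = l (q i)" for i
  proof -
    have 1: "(\<lambda>k. R (X (r k)) (q i) - X (r k) (q i)) \<longlonglongrightarrow> R l (q i) - l (q i)"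
      by (intro tendsto_diff cont[of "\<lambda>k. X (r k)"] l X q)
    have 2: "(\<lambda>k. 1 / real (Suc (r k))) \<longlonglongrightarrow> 0"
      using LIMSEQ_subseq_LIMSEQ[OF LIMSEQ_inverse_real_of_nat l(2)] by (simp add: o_def inverse_eq_divide)
    have "(\<lambda>k. R (X (r k)) (q i) - X (r k) (q i)) \<longlonglongrightarrow> 0"
    proof (rule Lim_null_comparison[OF _ 2])
      show "\<forall>\<^sub>F k in sequentially. norm (R (X (r k)) (q i) - X (r k) (q i)) \<le> 1 / real (Suc (r k))"
      proof (rule eventually_sequentiallyI[of i])
        fix k assume "i \<le> k"
        then have "i < Suc (r k)" using seq_suble[OF l(2), of k] by simp
        then show "norm (R (X (r k)) (q i) - X (r k) (q i)) \<le> 1 / real (Suc (r k))" using X(2) by simp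
      qed
    qed
    with 1 show ?thesis using LIMSEQ_unique by fastforce
  qed
  with l(1) show ?thesis by blast
qed

section \<open>Completely monotone functions on the half-line\<close>

text \<open>Differentiation within the half-line, one-sided at 0, so that values at negative
  arguments never matter.\<close>

definition deriv_nonneg :: "(real \<Rightarrow> real) \<Rightarrow> (real \<Rightarrow> real) \<Rightarrow> bool" where
  "deriv_nonneg f f' \<longleftrightarrow> (\<forall>s\<ge>0. (f has_real_derivative f' s) (at s within {0..}))"

lemma deriv_nonnegD: "deriv_nonneg f f' \<Longrightarrow> 0 \<le> s \<Longrightarrow> (f has_real_derivative f' s) (at s within {0..})"
  by (simp add: deriv_nonneg_def)

lemma deriv_nonneg_continuous: "deriv_nonneg f f' \<Longrightarrow> continuous_on {0..} f"
  unfolding deriv_nonneg_def by (rule DERIV_continuous_on) auto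

lemma deriv_nonneg_at: "deriv_nonneg f f' \<Longrightarrow> 0 < s \<Longrightarrow> (f has_real_derivative f' s) (at s)"
  using deriv_nonnegD[of f f' s] at_within_interior[of s "{0..}"] by (simp add: interior_Ici[of "-1"])

lemma deriv_nonneg_mvt:
  assumes "deriv_nonneg f f'" "0 \<le> x" "x < y"
  obtains z where "x < z" "z < y" "f y - f x = (y - x) * f' z"
proof -
  have "\<exists>z\<in>{x<..<y}. f y - f x = (\<lambda>h. f' z * h) (y - x)"
  proof (rule mvt_simple)
    fix z assume "x \<le> z" "z \<le> y"
    with assms show "(f has_derivative (\<lambda>h. f' z * h)) (at z within {x..y})"
      by (intro has_derivative_subset[OF deriv_nonnegD[OF assms(1), unfolded has_field_derivative_def]]) auto
  qed fact
  then show thesis using that by (auto simp: mult.commute)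
qed

lemma deriv_nonneg_unique:
  assumes "deriv_nonneg f f'" "deriv_nonneg f f''" "0 \<le> s"
  shows "f' s = f'' s"
proof -
  have "at_right s \<le> at s within {0..}"
    using assms(3) by (intro at_le) auto
  then have "at s within {0..} \<noteq> bot"
    using trivial_limit_at_right_real[of s] by (auto simp: bot_unique)
  then show ?thesis
    using assms tendsto_unique unfolding deriv_nonneg_def has_field_derivative_iff by blast
qed

lemma deriv_nonneg_cong:
  assumes "deriv_nonneg f f'" "\<And>s. 0 \<le> s \<Longrightarrow> f s = g s" "\<And>s. 0 \<le> s \<Longrightarrow> f' s = g' s"
  shows "deriv_nonneg g g'"
  unfolding deriv_nonneg_def
proof safe
  fix s :: real assume s: "0 \<le> s"
  show "(g has_real_derivative g' s) (at s within {0..})"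
    using has_field_derivative_transform_within[OF deriv_nonnegD[OF assms(1) s], of 1 g] assms(2,3) s by auto
qed

lemma deriv_nonneg_antimono:
  assumes "deriv_nonneg f f'" "\<And>s. 0 \<le> s \<Longrightarrow> f' s \<le> 0" "0 \<le> x" "x \<le> y"
  shows "f y \<le> f x"
proof (cases "x = y")
  case False
  with assms obtain z where z: "x < z" "z < y" "f y - f x = (y - x) * f' z"
    by (metis deriv_nonneg_mvt less_le)
  moreover have "(y - x) * f' z \<le> 0"
    using assms z by (intro mult_nonneg_nonpos) auto
  ultimately show ?thesis by simp
qed simp

text \<open>\<open>H n\<close> is \<open>(-1)\<^sup>n\<close> times the \<open>n\<close>-th derivative; with this sign all Leibniz sums below are sums of
  nonnegative terms.\<close>

definition tower :: "(nat \<Rightarrow> real \<Rightarrow> real) \<Rightarrow> bool" where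
  "tower H \<longleftrightarrow> (\<forall>n. deriv_nonneg (H n) (\<lambda>s. - H (Suc n) s) \<and> (\<forall>s\<ge>0. 0 \<le> H n s))"

lemma tower_deriv: "tower H \<Longrightarrow> deriv_nonneg (H n) (\<lambda>s. - H (Suc n) s)"
  by (simp add: tower_def)

lemma tower_nonneg: "tower H \<Longrightarrow> 0 \<le> s \<Longrightarrow> 0 \<le> H n s"
  by (simp add: tower_def)

lemma tower_shift: "tower H \<Longrightarrow> tower (\<lambda>n. H (Suc n))"
  by (simp add: tower_def)

lemma tower_continuous: "tower H \<Longrightarrow> continuous_on {0..} (H n)"
  using tower_deriv deriv_nonneg_continuous by blast

lemma tower_antimono: "tower H \<Longrightarrow> 0 \<le> x \<Longrightarrow> x \<le> y \<Longrightarrow> H n y \<le> H n x"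
  by (rule deriv_nonneg_antimono[OF tower_deriv]) (auto simp: tower_nonneg)

lemma tower_le0: "tower H \<Longrightarrow> 0 \<le> x \<Longrightarrow> H n x \<le> H n 0"
  by (rule tower_antimono) auto

lemma tower_diff_bounds:
  assumes "tower H" "0 \<le> x" "x \<le> y"
  shows "(y - x) * H (Suc n) y \<le> H n x - H n y" "H n x - H n y \<le> (y - x) * H (Suc n) x"
proof -
  have "(y - x) * H (Suc n) y \<le> H n x - H n y \<and> H n x - H n y \<le> (y - x) * H (Suc n) x"
  proof (cases "x = y")
    case False
    with assms have "x < y" by simp
    from deriv_nonneg_mvt[OF tower_deriv[OF assms(1)] assms(2) this, of n]
    obtain z where z: "x < z" "z < y" "H n y - H n x = (y - x) * - H (Suc n) z" by auto
    then have eq: "H n x - H n y = (y - x) * H (Suc n) z" by (simp add: algebra_simps)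
    show ?thesis
      unfolding eq using tower_antimono[OF assms(1), of z y "Suc n"] tower_antimono[OF assms(1), of x z "Suc n"] z assms
      by (auto intro!: mult_left_mono)
  qed simp
  then show "(y - x) * H (Suc n) y \<le> H n x - H n y" "H n x - H n y \<le> (y - x) * H (Suc n) x" by auto
qed

lemma tower_decay:
  assumes "tower H" "0 < s"
  shows "H (Suc n) s \<le> H n 0 / s"
  using tower_diff_bounds(1)[OF assms(1), of 0 s n] tower_nonneg[OF assms(1), of s n] assms
  by (simp add: field_simps)

text \<open>The second derivative is largest at the left, hence bounded by its value at any
  \<open>b\<close> left of both points. A free \<open>b\<close> is needed for averages, where the
  choice \<open>b w\<close> gives a remainder that is integrable uniformly in \<open>s\<close> and
  \<open>t\<close>.\<close>

lemma tower_taylor: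
  assumes H: "tower H" and b: "0 \<le> b" "b \<le> s" "b \<le> t"
  shows "\<bar>H n t - H n s - (t - s) * - H (Suc n) s\<bar> \<le> H (Suc (Suc n)) b * (t - s)\<^sup>2"
proof -
  have main: "0 \<le> (y - x) * (H (Suc n) x - H (Suc n) y)"
     "(y - x) * (H (Suc n) x - H (Suc n) y) \<le> H (Suc (Suc n)) b * (y - x)\<^sup>2" if "b \<le> x" "x \<le> y" for x y
  proof -
    have x: "0 \<le> x" using that b by simp
    have "H (Suc n) x - H (Suc n) y \<le> (y - x) * H (Suc (Suc n)) x"
      using tower_diff_bounds(2)[OF H x that(2)] .
    also have "\<dots> \<le> (y - x) * H (Suc (Suc n)) b"
      using tower_antimono[OF H b(1) that(1)] that by (intro mult_left_mono) auto
    finally have "(y - x) * (H (Suc n) x - H (Suc n) y) \<le> (y - x) * ((y - x) * H (Suc (Suc n)) b)"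
      using that by (intro mult_left_mono) auto
    then show "(y - x) * (H (Suc n) x - H (Suc n) y) \<le> H (Suc (Suc n)) b * (y - x)\<^sup>2"
      by (simp add: power2_eq_square mult_ac)
    show "0 \<le> (y - x) * (H (Suc n) x - H (Suc n) y)"
      using tower_antimono[OF H x that(2)] that by simp
  qed
  show ?thesis
  proof (cases "s \<le> t")
    case True
    with tower_diff_bounds[OF H order_trans[OF b(1,2)] True, of n] main[OF b(2) True] show ?thesis
      by (simp add: algebra_simps abs_le_iff)
  next
    case False
    with tower_diff_bounds[OF H order_trans[OF b(1,3)], of s n] main[OF b(3), of s] show ?thesis
      by (simp add: algebra_simps abs_le_iff power2_commute)
  qed
qed

text \<open>A uniform quadratic remainder survives both limits and integration; this is how
  differentiation is exchanged with them.\<close>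

lemma deriv_nonneg_quadratic:
  assumes "\<And>s t. 0 \<le> s \<Longrightarrow> 0 \<le> t \<Longrightarrow> \<bar>f t - f s - (t - s) * f' s\<bar> \<le> C * (t - s)\<^sup>2"
  shows "deriv_nonneg f f'"
  unfolding deriv_nonneg_def has_field_derivative_iff
proof (intro allI impI, rule Lim_transform)
  fix s :: real assume s: "0 \<le> s"
  have "((\<lambda>t. C * \<bar>t - s\<bar>) \<longlongrightarrow> C * \<bar>s - s\<bar>) (at s within {0..})"
    by (intro tendsto_intros)
  then have z: "((\<lambda>t. C * \<bar>t - s\<bar>) \<longlongrightarrow> 0) (at s within {0..})" by simp
  show "((\<lambda>t. (f t - f s) / (t - s) - f' s) \<longlongrightarrow> 0) (at s within {0..})"
  proof (rule Lim_null_comparison[OF _ z])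
    have "norm ((f t - f s) / (t - s) - f' s) \<le> C * \<bar>t - s\<bar>" if "t \<noteq> s" "0 \<le> t" for t
    proof -
      have "\<bar>(f t - f s) / (t - s) - f' s\<bar> * \<bar>t - s\<bar> = \<bar>f t - f s - (t - s) * f' s\<bar>"
        using that by (simp add: abs_mult[symmetric] field_simps)
      also have "\<dots> \<le> (C * \<bar>t - s\<bar>) * \<bar>t - s\<bar>"
        using assms[OF s that(2)] by (simp add: power2_eq_square mult.assoc flip: abs_mult)
      finally show ?thesis using that by simp
    qed
    then show "\<forall>\<^sub>F t in at s within {0..}. norm ((f t - f s) / (t - s) - f' s) \<le> C * \<bar>t - s\<bar>"
      by (auto simp: eventually_at_filter)
  qed
qed simp

lemma tower_lipschitz:
  assumes "tower H" "0 \<le> x" "0 \<le> y"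
  shows "\<bar>H n x - H n y\<bar> \<le> H (Suc n) 0 * \<bar>x - y\<bar>"
proof -
  have *: "0 \<le> H n x - H n y \<and> H n x - H n y \<le> H (Suc n) 0 * (y - x)" if "0 \<le> x" "x \<le> y" for x y
  proof -
    have "(y - x) * H (Suc n) x \<le> (y - x) * H (Suc n) 0"
      using that tower_le0[OF assms(1)] by (intro mult_left_mono) auto
    then show ?thesis
      using tower_diff_bounds(2)[OF assms(1) that, of n] tower_antimono[OF assms(1) that, of n] by (simp add: mult.commute)
  qed
  show ?thesis using *[of x y] *[of y x] assms by (cases "x \<le> y") auto
qed

text \<open>A difference quotient of order \<open>n\<close> differs from order \<open>n + 1\<close>
  by at most a multiple of the step, uniformly in \<open>k\<close>. By induction, pointwise
  convergence of the functions alone makes all derivatives converge.\<close>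

lemma tower_limit:
  assumes tow: "\<And>k. tower (H k)" and bnd: "\<And>k n. H k n 0 \<le> C n"
    and lim: "\<And>s. 0 \<le> s \<Longrightarrow> (\<lambda>k. H k 0 s) \<longlonglongrightarrow> l s"
  shows "\<exists>L. tower L \<and> L 0 = l \<and> (\<forall>n s. 0 \<le> s \<longrightarrow> (\<lambda>k. H k n s) \<longlonglongrightarrow> L n s)"
proof -
  have C0: "0 \<le> C n" for n
    using bnd[of 0 n] tower_nonneg[OF tow, of 0 0 n] by simp
  have tay: "\<bar>H k n t - H k n s - (t - s) * - H k (Suc n) s\<bar> \<le> C (Suc (Suc n)) * (t - s)\<^sup>2"
    if "0 \<le> s" "0 \<le> t" for k n s t
    by (rule order_trans[OF tower_taylor[OF tow order_refl that]]) (intro mult_right_mono bnd zero_le_power2)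
  have conv: "convergent (\<lambda>k. H k n s)" if "0 \<le> s" for n s
    using that
  proof (induction n arbitrary: s)
    case 0
    then show ?case using lim convergentI by blast
  next
    case (Suc n)
    show ?case
      unfolding Cauchy_convergent_iff[symmetric]
    proof (rule CauchyI)
      fix e :: real assume e: "0 < e"
      define h where "h = e / (4 * (C (Suc (Suc n)) + 1))"
      have h: "0 < h" "C (Suc (Suc n)) * h \<le> e / 4"
        using e C0[of "Suc (Suc n)"] by (auto simp: h_def field_simps)
      define u where "u k = (H k n s - H k n (s + h)) / h" for k
      have uH: "\<bar>H k (Suc n) s - u k\<bar> \<le> e / 4" for k
      proof -
        have "\<bar>H k n (s + h) - H k n s + h * H k (Suc n) s\<bar> \<le> C (Suc (Suc n)) * h\<^sup>2"
          using tay[of s "s + h" k n] Suc.prems h by simp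
        also have "\<dots> \<le> e / 4 * h" using h by (simp add: power2_eq_square)
        finally have "\<bar>H k n (s + h) - H k n s + h * H k (Suc n) s\<bar> \<le> e / 4 * h" .
        moreover have "H k n (s + h) - H k n s + h * H k (Suc n) s = (H k (Suc n) s - u k) * h"
          using h by (simp add: u_def field_simps)
        ultimately have "\<bar>(H k (Suc n) s - u k) * h\<bar> \<le> e / 4 * h" by simp
        then show ?thesis using h by (simp add: abs_mult)
      qed
      have "convergent u"
        unfolding u_def convergent_def
        using tendsto_divide[OF tendsto_diff[OF Suc.IH[OF Suc.prems, unfolded convergent_LIMSEQ_iff] Suc.IH[of "s + h", unfolded convergent_LIMSEQ_iff]] tendsto_const[of h]] Suc.prems h
        by auto
      then have "Cauchy u" by (rule convergent_Cauchy)
      then obtain M where M: "\<And>m n. m \<ge> M \<Longrightarrow> n \<ge> M \<Longrightarrow> norm (u m - u n) < e / 2"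
        using CauchyD[of u "e / 2"] e by auto
      show "\<exists>M. \<forall>m\<ge>M. \<forall>k\<ge>M. norm (H m (Suc n) s - H k (Suc n) s) < e"
      proof (intro exI[of _ M] allI impI)
        fix m k assume "M \<le> m" "M \<le> k"
        then show "norm (H m (Suc n) s - H k (Suc n) s) < e"
          using M[of m k] uH[of m] uH[of k] by (auto simp: abs_if split: if_splits)
      qed
    qed
  qed
  define L where "L n s = (if n = 0 then l s else lim (\<lambda>k. H k n s))" for n s
  have L: "(\<lambda>k. H k n s) \<longlonglongrightarrow> L n s" if "0 \<le> s" for n s
    using lim[OF that] conv[OF that, of n] by (auto simp: L_def convergent_LIMSEQ_iff)
  have "deriv_nonneg (L n) (\<lambda>s. - L (Suc n) s)" for n
  proof (rule deriv_nonneg_quadratic)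
    fix s t :: real assume st: "0 \<le> s" "0 \<le> t"
    show "\<bar>L n t - L n s - (t - s) * - L (Suc n) s\<bar> \<le> C (Suc (Suc n)) * (t - s)\<^sup>2"
      by (rule LIMSEQ_le_const2[of "\<lambda>k. \<bar>H k n t - H k n s - (t - s) * - H k (Suc n) s\<bar>"])
         (use L st tay in \<open>auto intro!: tendsto_intros\<close>)
  qed
  moreover have "0 \<le> L n s" if "0 \<le> s" for n s
    by (rule LIMSEQ_le_const[OF L[OF that]]) (use tower_nonneg[OF tow that] in auto)
  ultimately have "tower L" by (simp add: tower_def)
  moreover have "L 0 = l" by (auto simp: L_def)
  ultimately show ?thesis using L by blast
qed

text \<open>Nonnegativity and bounds for \<open>(-1)\<^sup>k u\<^sup>(\<^sup>k\<^sup>)\<close> with \<open>k \<le> n\<close>: the bound is \<open>c\<close> below order \<open>n\<close> and \<open>d\<close> at order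
  \<open>n\<close>. The top order is kept apart since all estimates are affine in it.\<close>

primrec cmb :: "nat \<Rightarrow> real \<Rightarrow> real \<Rightarrow> (real \<Rightarrow> real) \<Rightarrow> bool" where
  "cmb 0 c d u \<longleftrightarrow> (\<forall>s\<ge>0. 0 \<le> u s \<and> u s \<le> d)"
| "cmb (Suc n) c d u \<longleftrightarrow> (\<forall>s\<ge>0. 0 \<le> u s \<and> u s \<le> c) \<and> (\<exists>v. deriv_nonneg u (\<lambda>s. - v s) \<and> cmb n c d v)"

lemma cmb_SucI:
  assumes "\<And>s. 0 \<le> s \<Longrightarrow> 0 \<le> u s" "\<And>s. 0 \<le> s \<Longrightarrow> u s \<le> c" "deriv_nonneg u (\<lambda>s. - v s)" "cmb n c d v"
  shows "cmb (Suc n) c d u"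
  using assms by auto

lemma cmb_weaken: "cmb n c d u \<Longrightarrow> c \<le> c' \<Longrightarrow> d \<le> d' \<Longrightarrow> cmb n c' d' u"
proof (induction n arbitrary: u)
  case (Suc n)
  then show ?case by simp (meson order_trans)
qed (auto intro: order_trans)

lemma cmb_drop: "cmb (Suc n) c d u \<Longrightarrow> cmb n c c u"
  by (induction n arbitrary: u) auto

lemma cmb_nonneg: "cmb n c d u \<Longrightarrow> 0 \<le> s \<Longrightarrow> 0 \<le> u s"
  by (cases n) auto

lemma cmb_cong:
  assumes "cmb n c d u" "\<And>s. 0 \<le> s \<Longrightarrow> u s = v s"
  shows "cmb n c d v"
proof (cases n)
  case 0
  then show ?thesis using assms by simp
next
  case (Suc m)
  with assms obtain w where "deriv_nonneg u (\<lambda>s. - w s)" "cmb m c d w" by auto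
  moreover have "deriv_nonneg v (\<lambda>s. - w s)"
    by (rule deriv_nonneg_cong[OF calculation(1) assms(2)]) auto
  ultimately show ?thesis using assms Suc by auto
qed

lemma cmb_add: "cmb n c d u \<Longrightarrow> cmb n c' d' v \<Longrightarrow> cmb n (c + c') (d + d') (\<lambda>s. u s + v s)"
proof (induction n arbitrary: u v)
  case 0
  then show ?case by (simp add: add_mono)
next
  case (Suc n)
  then obtain u' v' where *: "deriv_nonneg u (\<lambda>s. - u' s)" "cmb n c d u'" "deriv_nonneg v (\<lambda>s. - v' s)" "cmb n c' d' v'"
    by auto
  have "deriv_nonneg (\<lambda>s. u s + v s) (\<lambda>s. - (u' s + v' s))"
    using *(1,3) unfolding deriv_nonneg_def by (auto intro!: derivative_eq_intros)
  moreover have "cmb n (c + c') (d + d') (\<lambda>s. u' s + v' s)" using Suc.IH * by blast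
  ultimately show ?case using Suc.prems by (intro cmb_SucI) (auto intro!: add_mono)
qed

text \<open>The power of two counts Leibniz terms. The bound \<open>d\<close> enters linearly, since
  the top derivative of \<open>u\<close> occurs only in the term where \<open>v\<close> is not
  differentiated.\<close>

lemma cmb_mult:
  assumes "cmb n c d u" "cmb n b b v" "0 \<le> c" "c \<le> d" "0 \<le> b"
  shows "cmb n (2^n * (c * b)) (2^n * (d * b)) (\<lambda>s. u s * v s)"
  using assms
proof (induction n arbitrary: u v d)
  case 0
  have "u s * v s \<le> d * b" if "0 \<le> s" for s
    by (rule mult_mono) (use 0 that in auto)
  then show ?case using 0 by simp
next
  case (Suc n)
  then obtain u' v' where *: "deriv_nonneg u (\<lambda>s. - u' s)" "cmb n c d u'" "deriv_nonneg v (\<lambda>s. - v' s)" "cmb n b b v'"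
    by auto
  have d: "deriv_nonneg (\<lambda>s. u s * v s) (\<lambda>s. - (u' s * v s + u s * v' s))"
    using *(1,3) unfolding deriv_nonneg_def by (auto intro!: derivative_eq_intros)
  have "cmb n (2^n * (c * b)) (2^n * (d * b)) (\<lambda>s. u' s * v s)"
    using Suc.IH[OF *(2) cmb_drop[OF Suc.prems(2)]] Suc.prems by simp
  moreover have "cmb n (2^n * (c * b)) (2^n * (c * b)) (\<lambda>s. u s * v' s)"
    using Suc.IH[OF cmb_drop[OF Suc.prems(1)] *(4)] Suc.prems by simp
  then have "cmb n (2^n * (c * b)) (2^n * (d * b)) (\<lambda>s. u s * v' s)"
    using Suc.prems by (elim cmb_weaken) (auto intro: mult_right_mono)
  ultimately have "cmb n (2^n * (c * b) + 2^n * (c * b)) (2^n * (d * b) + 2^n * (d * b)) (\<lambda>s. u' s * v s + u s * v' s)"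
    by (rule cmb_add)
  moreover have "u s * v s \<le> 2^Suc n * (c * b)" if "0 \<le> s" for s
  proof -
    have "u s * v s \<le> c * b"
      by (rule mult_mono) (use Suc.prems that in auto)
    then have "u s * v s \<le> 1 * (c * b)" by simp
    also have "1 * (c * b) \<le> 2^Suc n * (c * b)"
      by (rule mult_right_mono[OF one_le_power]) (use Suc.prems(3,5) in auto)
    finally show ?thesis .
  qed
  moreover have "2^n * (c * b) + 2^n * (c * b) = 2^Suc n * (c * b)" "2^n * (d * b) + 2^n * (d * b) = 2^Suc n * (d * b)"
    by simp_all
  moreover have "0 \<le> u s * v s" if "0 \<le> s" for s
    using cmb_nonneg[OF Suc.prems(1) that] cmb_nonneg[OF Suc.prems(2) that] by simp
  ultimately show ?case
    using d by (intro cmb_SucI) simp_all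
qed

lemma tower_imp_cmb:
  assumes "tower H" "\<And>k. k < n \<Longrightarrow> H k 0 \<le> c" "H n 0 \<le> d"
  shows "cmb n c d (H 0)"
  using assms
proof (induction n arbitrary: H)
  case 0
  then show ?case using tower_nonneg[of H] tower_le0[of H _ 0] by (auto intro: order_trans)
next
  case (Suc n)
  have "cmb n c d (H (Suc 0))"
    using Suc.IH[OF tower_shift[OF Suc.prems(1)]] Suc.prems by auto
  moreover have "H 0 s \<le> c" if "0 \<le> s" for s
    using tower_le0[OF Suc.prems(1) that, of 0] Suc.prems(2)[of 0] by simp
  ultimately show ?case
    using tower_deriv[OF Suc.prems(1), of 0] tower_nonneg[OF Suc.prems(1)] by auto
qed

lemma cmb_tower_bound:
  assumes "tower H" "cmb n c d (H 0)" "0 \<le> s"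
  shows "H n s \<le> d"
  using assms
proof (induction n arbitrary: H)
  case (Suc n)
  then obtain v where v: "deriv_nonneg (H 0) (\<lambda>s. - v s)" "cmb n c d v" by auto
  have "v t = H (Suc 0) t" if "0 \<le> t" for t
    using deriv_nonneg_unique[OF v(1) tower_deriv[OF Suc.prems(1)] that] by simp
  then have "cmb n c d (H (Suc 0))" using v(2) cmb_cong by blast
  then show ?case using Suc.IH[OF tower_shift[OF Suc.prems(1)]] Suc.prems(3) by simp
qed auto

text \<open>The derivatives witnessing different \<open>n\<close> are chosen independently;
  uniqueness of derivatives merges them into one sequence in \<open>cm_deriv\<close>.\<close>

definition cm :: "(real \<Rightarrow> real) \<Rightarrow> bool" where
  "cm u \<longleftrightarrow> (\<forall>n. \<exists>c. cmb n c c u)"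

lemma cm_deriv:
  assumes "cm u" shows "\<exists>v. deriv_nonneg u (\<lambda>s. - v s) \<and> cm v"
proof -
  have "\<exists>c v. deriv_nonneg u (\<lambda>s. - v s) \<and> cmb n c c v" for n
    using assms unfolding cm_def by (metis cmb.simps(2))
  then obtain v c where v: "\<And>n. deriv_nonneg u (\<lambda>s. - v n s)" "\<And>n. cmb n (c n) (c n) (v n)" by metis
  have "cmb n (c n) (c n) (v 0)" for n
    by (rule cmb_cong[OF v(2)]) (use deriv_nonneg_unique[OF v(1) v(1)] in force)
  with v(1) show ?thesis unfolding cm_def by blast
qed

lemma cm_imp_tower:
  assumes "cm u" shows "\<exists>H. tower H \<and> H 0 = u"
proof -
  have "\<exists>H. \<forall>n. (cm (H n) \<and> (n = 0 \<longrightarrow> H n = u)) \<and> deriv_nonneg (H n) (\<lambda>s. - H (Suc n) s)"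
    by (rule dependent_nat_choice) (use assms cm_deriv in auto)
  then obtain H where H: "\<And>n. cm (H n)" "H 0 = u" "\<And>n. deriv_nonneg (H n) (\<lambda>s. - H (Suc n) s)" by blast
  have "0 \<le> H n s" if "0 \<le> s" for n s
    using H(1)[of n] cmb_nonneg that unfolding cm_def by blast
  with H show ?thesis unfolding tower_def by (intro exI[of _ H]) auto
qed

lemma tower_imp_cm:
  assumes "tower H" shows "cm (H 0)"
  unfolding cm_def
proof
  fix n
  have "H k 0 \<le> (\<Sum>k\<le>n. H k 0)" if "k \<le> n" for k
    by (rule member_le_sum[of k "{..n}" "\<lambda>k. H k 0"]) (use that tower_nonneg[OF assms] in auto)
  then show "\<exists>c. cmb n c c (H 0)"
    by (intro exI[of _ "\<Sum>k\<le>n. H k 0"] tower_imp_cmb[OF assms]) simp_all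
qed

text \<open>The reciprocal E satisfies E' = - 2 Z E^2, so order \<open>n\<close> of
  \<open>Z = W'\<close> controls order \<open>n + 1\<close> of E. This gained order later keeps the
  highest derivative out of the bound for E. The constant depends only on \<open>k0\<close>,
  \<open>z\<close> and \<open>n\<close>.\<close>

lemma cmb_reciprocal:
  assumes k0: "0 < k0" and z: "0 \<le> z"
  shows "\<exists>e\<ge>0. \<forall>\<kappa> W Z. k0 \<le> \<kappa> \<longrightarrow> (\<forall>s\<ge>0. 0 \<le> W s) \<longrightarrow> deriv_nonneg W Z \<longrightarrow> cmb n z z Z \<longrightarrow>
     cmb (Suc n) e e (\<lambda>s. 1 / (2 * (\<kappa> + W s)))"
proof (induction n)
  case 0
  have bnd: "1 / (2 * (\<kappa> + w)) \<le> 1 / (2 * k0)" if "k0 \<le> \<kappa>" "0 \<le> w" for \<kappa> w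
    using that k0 by (intro divide_left_mono) auto
  show ?case
  proof (intro exI[of _ "max (1 / (2 * k0)) (2 * z * (1 / (2 * k0))\<^sup>2)"] conjI allI impI)
    fix \<kappa> W Z assume *: "k0 \<le> \<kappa>" "\<forall>s\<ge>0. 0 \<le> W s" "deriv_nonneg W Z" "cmb 0 z z Z"
    have pos: "0 < \<kappa> + W s" if "0 \<le> s" for s using *(1) *(2)[rule_format, OF that] k0 by linarith
    let ?E = "\<lambda>s. 1 / (2 * (\<kappa> + W s))"
    have "deriv_nonneg ?E (\<lambda>s. - (2 * Z s * (?E s)\<^sup>2))"
      unfolding deriv_nonneg_def
    proof safe
      fix s :: real assume s: "0 \<le> s"
      show "(?E has_real_derivative - (2 * Z s * (?E s)\<^sup>2)) (at s within {0..})"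
        using pos[OF s] deriv_nonnegD[OF *(3) s]
        by (auto intro!: derivative_eq_intros simp: power2_eq_square field_simps)
    qed
    moreover have "2 * Z s * (?E s)\<^sup>2 \<le> 2 * z * (1 / (2 * k0))\<^sup>2" if "0 \<le> s" for s
      using *(4) that bnd[OF *(1), of "W s"] *(2) pos[OF that] z
      by (intro mult_mono power_mono) auto
    ultimately show "cmb (Suc 0) (max (1 / (2 * k0)) (2 * z * (1 / (2 * k0))\<^sup>2)) (max (1 / (2 * k0)) (2 * z * (1 / (2 * k0))\<^sup>2)) ?E"
      using *(2,4) less_imp_le[OF pos] mult_left_mono[OF less_imp_le[OF pos], of _ 2] bnd[OF *(1)]
      by (intro cmb_SucI[where v="\<lambda>s. 2 * Z s * (?E s)\<^sup>2"]) (simp_all add: le_max_iff_disj)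
  qed (use k0 in \<open>auto simp: le_max_iff_disj\<close>)
next
  case (Suc n)
  then obtain e where e: "0 \<le> e" "\<And>\<kappa> W Z. k0 \<le> \<kappa> \<Longrightarrow> (\<forall>s\<ge>0. 0 \<le> W s) \<Longrightarrow> deriv_nonneg W Z \<Longrightarrow> cmb n z z Z \<Longrightarrow>
     cmb (Suc n) e e (\<lambda>s. 1 / (2 * (\<kappa> + W s)))" by blast
  define m where "m = Suc n"
  define e' where "e' = 2^m * ((2^m * ((2 * z) * e)) * e)"
  have e': "e' \<ge> 0" using z e by (simp add: e'_def)
  show ?case
  proof (intro exI[of _ "max e e'"] conjI allI impI)
    fix \<kappa> W Z assume *: "k0 \<le> \<kappa>" "\<forall>s\<ge>0. 0 \<le> W s" "deriv_nonneg W Z" "cmb (Suc n) z z Z"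
    have pos: "0 < \<kappa> + W s" if "0 \<le> s" for s using *(1) *(2)[rule_format, OF that] k0 by linarith
    let ?E = "\<lambda>s. 1 / (2 * (\<kappa> + W s))"
    have E: "cmb m e e ?E" using e(2)[OF *(1-3) cmb_drop[OF *(4)]] by (simp add: m_def)
    have "cmb m (z + z) (z + z) (\<lambda>s. Z s + Z s)" using cmb_add[OF *(4) *(4)] unfolding m_def .
    then have "cmb m (2^m * ((2 * z) * e)) (2^m * ((2 * z) * e)) (\<lambda>s. (Z s + Z s) * ?E s)"
      unfolding mult_2[symmetric, of z] by (rule cmb_mult[OF _ E]) (use z e in auto)
    then have "cmb m (2^m * ((2^m * ((2 * z) * e)) * e)) (2^m * ((2^m * ((2 * z) * e)) * e)) (\<lambda>s. ((Z s + Z s) * ?E s) * ?E s)"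
      by (rule cmb_mult[OF _ E]) (use z e in auto)
    then have P: "cmb m e' e' (\<lambda>s. ((Z s + Z s) * ?E s) * ?E s)"
      unfolding e'_def .
    have D: "deriv_nonneg ?E (\<lambda>s. - (((Z s + Z s) * ?E s) * ?E s))"
      unfolding deriv_nonneg_def
    proof safe
      fix s :: real assume s: "0 \<le> s"
      show "(?E has_real_derivative - (((Z s + Z s) * ?E s) * ?E s)) (at s within {0..})"
        using pos[OF s] deriv_nonnegD[OF *(3) s]
        by (auto intro!: derivative_eq_intros simp: power2_eq_square field_simps)
    qed
    have B: "0 \<le> ?E s" "?E s \<le> max e e'" if "0 \<le> s" for s
      using E that unfolding m_def by (auto simp: le_max_iff_disj)
    have M: "cmb m (max e e') (max e e') (\<lambda>s. ((Z s + Z s) * ?E s) * ?E s)"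
      by (rule cmb_weaken[OF P]) auto
    show "cmb (Suc (Suc n)) (max e e') (max e e') ?E"
      by (rule cmb_SucI[OF B D M[unfolded m_def]])
  qed (use e in auto)
qed

section \<open>Averaging operators\<close>

lemma set_integrable_of_has_integral:
  fixes f :: "real \<Rightarrow> real"
  assumes S: "S \<in> sets borel" and cont: "continuous_on S f" and nn: "\<And>x. x \<in> S \<Longrightarrow> 0 \<le> f x" and I: "(f has_integral I) S"
  shows "set_integrable lborel S f" "(LINT x:S|lborel. f x) = I"
proof -
  have "I \<ge> 0" using I nn by (rule has_integral_nonneg)
  have "integrable lborel (\<lambda>x. indicator S x * f x)"
  proof (rule integrableI_nn_integral_finite)
    show "(\<lambda>x. indicator S x * f x) \<in> borel_measurable lborel"
      using borel_measurable_continuous_on_indicator[OF S cont] by simp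
    show "(\<integral>\<^sup>+ x. ennreal (indicator S x * f x) \<partial>lborel) = ennreal I"
      by (rule nn_integral_has_integral_lebesgue[OF nn I])
    show "AE x in lborel. 0 \<le> indicator S x * f x"
      using nn by (auto simp: indicator_def)
  qed
  then show *: "set_integrable lborel S f" by (simp add: set_integrable_def)
  show "(LINT x:S|lborel. f x) = I"
    using set_borel_integral_eq_integral(2)[OF *] integral_unique[OF I] by simp
qed

lemma set_measurable_continuous:
  fixes f :: "real \<Rightarrow> real"
  shows "S \<in> sets borel \<Longrightarrow> continuous_on S f \<Longrightarrow> set_borel_measurable lborel S f"
  using borel_measurable_continuous_on_indicator[of S f] by (simp add: set_borel_measurable_def)

lemma set_integrable_dominated:
  fixes f g :: "real \<Rightarrow> real"
  assumes "set_integrable lborel S f" "S \<in> sets borel" "continuous_on S g" "\<And>x. x \<in> S \<Longrightarrow> \<bar>g x\<bar> \<le> f x"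
  shows "set_integrable lborel S g"
proof (rule set_integrable_bound[OF assms(1) set_measurable_continuous[OF assms(2,3)]])
  have "norm (g x) \<le> norm (f x)" if "x \<in> S" for x using assms(4)[OF that] by simp
  then show "AE x in lborel. x \<in> S \<longrightarrow> norm (g x) \<le> norm (f x)" by simp
qed

lemma set_integral_tendsto:
  fixes f :: "nat \<Rightarrow> real \<Rightarrow> real"
  assumes S: "S \<in> sets borel" and f: "\<And>k. continuous_on S (f k)" "continuous_on S g" and w: "set_integrable lborel S w"
    and lim: "\<And>x. x \<in> S \<Longrightarrow> (\<lambda>k. f k x) \<longlonglongrightarrow> g x" and le: "\<And>k x. x \<in> S \<Longrightarrow> \<bar>f k x\<bar> \<le> w x"
  shows "(\<lambda>k. LINT x:S|lborel. f k x) \<longlonglongrightarrow> (LINT x:S|lborel. g x)"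
  unfolding set_lebesgue_integral_def
proof (rule integral_dominated_convergence[where w="\<lambda>x. indicator S x *\<^sub>R w x"])
  show "(\<lambda>x. indicator S x *\<^sub>R g x) \<in> borel_measurable lborel" "\<And>k. (\<lambda>x. indicator S x *\<^sub>R f k x) \<in> borel_measurable lborel"
    using set_measurable_continuous[OF S] f unfolding set_borel_measurable_def by auto
  show "integrable lborel (\<lambda>x. indicator S x *\<^sub>R w x)" using w by (simp add: set_integrable_def)
  show "AE x in lborel. (\<lambda>k. indicator S x *\<^sub>R f k x) \<longlonglongrightarrow> indicator S x *\<^sub>R g x"
    using lim by (auto simp: indicator_def)
  show "AE x in lborel. norm (indicator S x *\<^sub>R f k x) \<le> indicator S x *\<^sub>R w x" for k
    using le by (auto simp: indicator_def)
qed

definition avg :: "real set \<Rightarrow> (real \<Rightarrow> real) \<Rightarrow> (real \<Rightarrow> real) \<Rightarrow> (real \<Rightarrow> real) \<Rightarrow> (real \<Rightarrow> real) \<Rightarrow> real \<Rightarrow> real" where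
  "avg \<Omega> k a b u s = (LINT w:\<Omega>|lborel. k w * u (a w * s + b w))"

text \<open>The two instances are dilations \<open>u (t * s)\<close> and translations
  \<open>u (s + l)\<close>. Because of \<open>a w \<le> 1\<close>, the single function
  \<open>k w * H n (b w)\<close> dominates the integrand for all \<open>s\<close>, including the
  powers of \<open>a w\<close>.\<close>

locale averaging =
  fixes \<Omega> :: "real set" and k a b :: "real \<Rightarrow> real"
  assumes \<Omega>: "\<Omega> \<in> sets borel" and cont: "continuous_on \<Omega> k" "continuous_on \<Omega> a" "continuous_on \<Omega> b"
    and nonneg: "\<And>w. w \<in> \<Omega> \<Longrightarrow> 0 \<le> k w" "\<And>w. w \<in> \<Omega> \<Longrightarrow> 0 \<le> a w" "\<And>w. w \<in> \<Omega> \<Longrightarrow> a w \<le> 1" "\<And>w. w \<in> \<Omega> \<Longrightarrow> 0 \<le> b w"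
begin

lemma avg_integrable:
  assumes H: "tower H" and I: "set_integrable lborel \<Omega> (\<lambda>w. k w * H n (b w))" and s: "0 \<le> s"
  shows "set_integrable lborel \<Omega> (\<lambda>w. k w * a w ^ j * H n (a w * s + b w))"
proof (rule set_integrable_dominated[OF I \<Omega>])
  show "continuous_on \<Omega> (\<lambda>w. k w * a w ^ j * H n (a w * s + b w))"
    using nonneg s by (intro continuous_intros cont continuous_on_compose2[OF tower_continuous[OF H]]) auto
  fix w assume w: "w \<in> \<Omega>"
  note nn = nonneg[OF w]
  have 1: "H n (a w * s + b w) \<le> H n (b w)" "0 \<le> H n (a w * s + b w)"
    using nn s by (auto intro!: tower_antimono[OF H] tower_nonneg[OF H])
  have "k w * a w ^ j \<le> k w" using nn power_le_one[of "a w" j] by (simp add: mult_left_le)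
  then have "k w * a w ^ j * H n (a w * s + b w) \<le> k w * H n (b w)"
    using 1 nn by (intro mult_mono) auto
  then show "\<bar>k w * a w ^ j * H n (a w * s + b w)\<bar> \<le> k w * H n (b w)" using 1 nn by simp
qed

lemma avg_nonneg:
  assumes "\<And>x. 0 \<le> x \<Longrightarrow> 0 \<le> u x" "0 \<le> s"
  shows "0 \<le> avg \<Omega> (\<lambda>w. k w * a w ^ j) a b u s"
  unfolding avg_def set_lebesgue_integral_def
  using nonneg assms by (intro integral_nonneg_AE) (auto simp: indicator_def)

text \<open>Each differentiation brings out one factor \<open>a w\<close>; the Taylor remainder
  based at \<open>b w\<close> integrates to a quadratic remainder.\<close>

lemma tower_avg:
  assumes H: "tower H" and I: "\<And>n. set_integrable lborel \<Omega> (\<lambda>w. k w * H n (b w))"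
  shows "tower (\<lambda>n. avg \<Omega> (\<lambda>w. k w * a w ^ n) a b (H n))"
  unfolding tower_def
proof (intro allI conjI impI)
  fix n
  let ?A = "\<lambda>n. avg \<Omega> (\<lambda>w. k w * a w ^ n) a b (H n)"
  show "0 \<le> ?A n s" if "0 \<le> s" for s
    using avg_nonneg that tower_nonneg[OF H] by blast
  let ?C = "LINT w:\<Omega>|lborel. k w * H (Suc (Suc n)) (b w)"
  show "deriv_nonneg (?A n) (\<lambda>s. - ?A (Suc n) s)"
  proof (rule deriv_nonneg_quadratic[where C="?C"])
    fix s t :: real assume st: "0 \<le> s" "0 \<le> t"
    let ?f = "\<lambda>w. k w * a w ^ n * H n (a w * t + b w) - k w * a w ^ n * H n (a w * s + b w)
       + (t - s) * (k w * a w ^ Suc n * H (Suc n) (a w * s + b w))"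
    note i1 = avg_integrable[OF H I st(2), of n n] and i2 = avg_integrable[OF H I st(1), of n n]
      and i3 = set_integrable_mult_right[OF avg_integrable[OF H I st(1), of "Suc n" "Suc n"], of "t - s"]
    have int: "set_integrable lborel \<Omega> ?f"
      by (rule set_integral_add(1)[OF set_integral_diff(1)[OF i1 i2] i3])
    have "(LINT w:\<Omega>|lborel. ?f w) = ?A n t - ?A n s + (t - s) * ?A (Suc n) s"
      unfolding avg_def set_integral_add(2)[OF set_integral_diff(1)[OF i1 i2] i3] set_integral_diff(2)[OF i1 i2]
        set_integral_mult_right ..
    then have eq: "?A n t - ?A n s - (t - s) * - ?A (Suc n) s = (LINT w:\<Omega>|lborel. ?f w)" by simp
    have "\<bar>LINT w:\<Omega>|lborel. ?f w\<bar> \<le> (LINT w:\<Omega>|lborel. \<bar>?f w\<bar>)"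
      using set_integral_norm_bound[OF int] by simp
    also have "\<dots> \<le> (LINT w:\<Omega>|lborel. k w * H (Suc (Suc n)) (b w) * (t - s)\<^sup>2)"
    proof (rule set_integral_mono)
      show "set_integrable lborel \<Omega> (\<lambda>w. \<bar>?f w\<bar>)" using set_integrable_abs[OF int] .
      show "set_integrable lborel \<Omega> (\<lambda>w. k w * H (Suc (Suc n)) (b w) * (t - s)\<^sup>2)" using I by simp
      fix w assume w: "w \<in> \<Omega>"
      note nn = nonneg[OF w]
      let ?s = "a w * s + b w" and ?t = "a w * t + b w"
      have "?f w = (k w * a w ^ n) * (H n ?t - H n ?s - (?t - ?s) * - H (Suc n) ?s)"
        by (simp add: algebra_simps)
      then have "\<bar>?f w\<bar> = (k w * a w ^ n) * \<bar>H n ?t - H n ?s - (?t - ?s) * - H (Suc n) ?s\<bar>"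
        using nn by (simp only: abs_mult) simp
      also have "\<dots> \<le> k w * (H (Suc (Suc n)) (b w) * (?t - ?s)\<^sup>2)"
      proof (rule mult_mono)
        show "k w * a w ^ n \<le> k w" using nn power_le_one[of "a w" n] by (simp add: mult_left_le)
        show "\<bar>H n ?t - H n ?s - (?t - ?s) * - H (Suc n) ?s\<bar> \<le> H (Suc (Suc n)) (b w) * (?t - ?s)\<^sup>2"
          using nn st by (intro tower_taylor[OF H]) auto
      qed (use nn in auto)
      also have "(?t - ?s)\<^sup>2 = (a w)\<^sup>2 * (t - s)\<^sup>2"
        by (simp add: power2_eq_square algebra_simps)
      also have "k w * (H (Suc (Suc n)) (b w) * ((a w)\<^sup>2 * (t - s)\<^sup>2)) \<le> k w * (H (Suc (Suc n)) (b w) * (1 * (t - s)\<^sup>2))"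
        using nn tower_nonneg[OF H, of "b w"] by (intro mult_left_mono mult_right_mono power_le_one) auto
      finally show "\<bar>?f w\<bar> \<le> k w * H (Suc (Suc n)) (b w) * (t - s)\<^sup>2" by (simp add: mult.assoc)
    qed
    also have "\<dots> = ?C * (t - s)\<^sup>2" by simp
    finally show "\<bar>?A n t - ?A n s - (t - s) * - ?A (Suc n) s\<bar> \<le> ?C * (t - s)\<^sup>2"
      unfolding eq .
  qed
qed

end

text \<open>The fundamental theorem on [0, N] and monotone convergence. The value at
  \<open>N\<close> is dropped by its sign, hence an inequality: \<open>H n\<close> may have a
  positive limit.\<close>

lemma tower_integral:
  assumes H: "tower H"
  shows "set_integrable lborel {0<..} (H (Suc n))" "(LINT x:{0<..}|lborel. H (Suc n) x) \<le> H n 0"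
proof -
  have cont: "continuous_on {0<..} (H (Suc n))"
    by (rule continuous_on_subset[OF tower_continuous[OF H]]) auto
  let ?h = "\<lambda>x. indicator {0<..} x * H (Suc n) x"
  let ?k = "\<lambda>N x. ennreal (indicator {..real N} x * ?h x)"
  have meas: "?h \<in> borel_measurable borel"
    using borel_measurable_continuous_on_indicator[OF _ cont] by simp
  have nn: "0 \<le> ?h x" for x using tower_nonneg[OF H] by (auto simp: indicator_def)
  have fin: "(\<integral>\<^sup>+x. ?k N x \<partial>lborel) \<le> ennreal (H n 0)" for N
  proof -
    have I: "(H (Suc n) has_integral (- H n (real N) - - H n 0)) {0..real N}"
    proof (rule fundamental_theorem_of_calculus)
      fix x assume x: "x \<in> {0..real N}"
      have "((\<lambda>x. - H n x) has_real_derivative H (Suc n) x) (at x within {0..})"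
        using DERIV_minus[OF deriv_nonnegD[OF tower_deriv[OF H, of n], of x]] x by simp
      then have "((\<lambda>x. - H n x) has_real_derivative H (Suc n) x) (at x within {0..real N})"
        by (rule DERIV_subset) auto
      then show "((\<lambda>x. - H n x) has_vector_derivative H (Suc n) x) (at x within {0..real N})"
        by (simp add: has_real_derivative_iff_has_vector_derivative)
    qed simp
    have "(\<integral>\<^sup>+x. ?k N x \<partial>lborel) \<le> (\<integral>\<^sup>+x. ennreal (indicator {0..real N} x * H (Suc n) x) \<partial>lborel)"
      using tower_nonneg[OF H] by (intro nn_integral_mono ennreal_leI) (auto simp: indicator_def)
    also have "\<dots> = ennreal (- H n (real N) - - H n 0)"
      by (rule nn_integral_has_integral_lebesgue[OF _ I]) (use tower_nonneg[OF H] in auto)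
    also have "\<dots> \<le> ennreal (H n 0)"
      using tower_nonneg[OF H, of "real N" n] by (intro ennreal_leI) auto
    finally show ?thesis .
  qed
  have "(\<integral>\<^sup>+x. ennreal (?h x) \<partial>lborel) = (\<integral>\<^sup>+x. (SUP N. ?k N x) \<partial>lborel)"
  proof (rule nn_integral_cong)
    fix x
    obtain N where N: "x \<le> real N" using real_arch_simple by blast
    show "ennreal (?h x) = (SUP N. ?k N x)"
    proof (rule antisym)
      show "ennreal (?h x) \<le> (SUP N. ?k N x)"
        using N by (intro SUP_upper2[of N]) auto
      show "(SUP N. ?k N x) \<le> ennreal (?h x)"
        using nn[of x] by (intro SUP_least ennreal_leI) (auto simp: indicator_def)
    qed
  qed
  also have "\<dots> = (SUP N. (\<integral>\<^sup>+x. ?k N x \<partial>lborel))"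
  proof (rule nn_integral_monotone_convergence_SUP)
    show "incseq ?k"
      using nn by (intro incseq_SucI le_funI ennreal_leI mult_right_mono) (auto simp: indicator_def)
  qed (use meas in measurable)
  also have "\<dots> \<le> ennreal (H n 0)" by (intro SUP_least fin)
  finally have le: "(\<integral>\<^sup>+x. ennreal (?h x) \<partial>lborel) \<le> ennreal (H n 0)" .
  have int: "integrable lborel ?h"
    by (rule integrableI_nonneg) (use meas nn le_less_trans[OF le ennreal_less_top] in auto)
  then show "set_integrable lborel {0<..} (H (Suc n))" by (simp add: set_integrable_def)
  have "ennreal (integral\<^sup>L lborel ?h) = (\<integral>\<^sup>+x. ennreal (?h x) \<partial>lborel)"
    using nn_integral_eq_integral[OF int] nn by simp
  then show "(LINT x:{0<..}|lborel. H (Suc n) x) \<le> H n 0"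
    using le tower_nonneg[OF H, of 0 n] ennreal_le_iff[of "H n 0" "integral\<^sup>L lborel ?h"]
    by (simp add: set_lebesgue_integral_def)
qed

lemma powr_integral_0:
  assumes "0 < p" "0 \<le> c"
  shows "set_integrable lborel {0<..<c} (\<lambda>x::real. x powr (p - 1))" "(LINT x:{0<..<c}|lborel. x powr (p - 1)) = c powr p / p"
proof -
  have "((\<lambda>x. x powr (p - 1)) has_integral (c powr p / p)) {0<..<c}"
    using has_integral_powr_from_0[of "p - 1" c] assms by (simp add: has_integral_Icc_iff_Ioo)
  then show "set_integrable lborel {0<..<c} (\<lambda>x::real. x powr (p - 1))" "(LINT x:{0<..<c}|lborel. x powr (p - 1)) = c powr p / p"
    by (intro set_integrable_of_has_integral; auto intro!: continuous_intros)+
qed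

text \<open>Bathtub estimate for a function h of integral at most \<open>c\<close> and height at
  most \<open>d\<close> against a decreasing weight: pointwise, x^(p-1) h \<le> e^(p-1) h + d max(0,
  x^(p-1) - e^(p-1)). The cut \<open>e\<close> is free. The optimal one is c / d, the extremal h
  being \<open>d\<close> on (0, c / d); a small \<open>e\<close> makes the coefficient of
  \<open>d\<close> small.\<close>

lemma tower_powr_integral:
  assumes H: "tower H" and p: "0 < p" "p < 1" and e: "0 < e" and cd: "H n 0 \<le> c" "H (Suc n) 0 \<le> d"
  shows "set_integrable lborel {0<..} (\<lambda>x. x powr (p - 1) * H (Suc n) x)"
    "(LINT x:{0<..}|lborel. x powr (p - 1) * H (Suc n) x) \<le> e powr (p - 1) * c + d * (e powr p / p - e powr p)"
proof -
  let ?q = "\<lambda>x. x powr (p - 1)" and ?e = "e powr (p - 1)" and ?H = "H (Suc n)"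
  let ?g = "\<lambda>x. ?e * ?H x + d * (indicator {0<..<e} x * (?q x - ?e))"
  have i1: "set_integrable lborel {0<..} (\<lambda>x. ?e * ?H x)"
    using tower_integral(1)[OF H, of n] by simp
  have i0: "set_integrable lborel {0<..<e} (\<lambda>x. ?q x - ?e)"
    using powr_integral_0[OF p(1), of e] e by (intro set_integral_diff) (auto simp: set_integrable_def)
  have ind: "(\<lambda>x. indicator {0<..} x *\<^sub>R (indicator {0<..<e} x * f x)) = (\<lambda>x. indicator {0<..<e} x *\<^sub>R (f x :: real))" for f
    by (auto simp: indicator_def)
  have i2: "set_integrable lborel {0<..} (\<lambda>x. indicator {0<..<e} x * (?q x - ?e))"
    using i0 unfolding set_integrable_def ind .
  have v2: "(LINT x:{0<..}|lborel. indicator {0<..<e} x * (?q x - ?e)) = e powr p / p - e powr p"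
  proof -
    have "(LINT x:{0<..}|lborel. indicator {0<..<e} x * (?q x - ?e))
        = (LINT x:{0<..<e}|lborel. ?q x - ?e)"
      unfolding set_lebesgue_integral_def ind ..
    also have "\<dots> = (LINT x:{0<..<e}|lborel. ?q x) - (LINT x:{0<..<e}|lborel. ?e)"
      using powr_integral_0[OF p(1), of e] e by (intro set_integral_diff) (auto simp: set_integrable_def)
    also have "(LINT x:{0<..<e}|lborel. ?e) = e powr p"
      using e by (simp add: set_lebesgue_integral_def powr_diff)
    finally show ?thesis using powr_integral_0[OF p(1), of e] e by simp
  qed
  have ig: "set_integrable lborel {0<..} ?g" using i1 i2 by (intro set_integral_add) auto
  have le: "?q x * ?H x \<le> ?g x" if "x \<in> {0<..}" for x
  proof -
    have x: "0 < x" using that by simp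
    have h: "0 \<le> ?H x" "?H x \<le> d"
      using tower_nonneg[OF H, of x "Suc n"] tower_le0[OF H, of x "Suc n"] x cd by auto
    show ?thesis
    proof (cases "x < e")
      case True
      have "?e \<le> ?q x" using True x p by (intro powr_mono2') auto
      then have "(?q x - ?e) * ?H x \<le> (?q x - ?e) * d"
        using h by (intro mult_left_mono) auto
      then show ?thesis using True x by (simp add: algebra_simps)
    next
      case False
      have "?q x \<le> ?e" using False e p by (intro powr_mono2') auto
      then show ?thesis using False h by (auto intro: mult_right_mono)
    qed
  qed
  have nn: "0 \<le> ?q x * ?H x" if "x \<in> {0<..}" for x
    using tower_nonneg[OF H, of x "Suc n"] that by simp
  show int: "set_integrable lborel {0<..} (\<lambda>x. ?q x * ?H x)"
  proof (rule set_integrable_dominated[OF ig])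
    show "continuous_on {0<..} (\<lambda>x. ?q x * ?H x)"
      by (intro continuous_intros continuous_on_subset[OF tower_continuous[OF H]]) auto
    show "\<bar>?q x * ?H x\<bar> \<le> ?g x" if "x \<in> {0<..}" for x
      using le[OF that] nn[OF that] by linarith
  qed simp
  have "(LINT x:{0<..}|lborel. ?q x * ?H x) \<le> (LINT x:{0<..}|lborel. ?g x)"
    by (rule set_integral_mono[OF int ig le])
  also have "\<dots> = ?e * (LINT x:{0<..}|lborel. ?H x) + d * (e powr p / p - e powr p)"
    using i1 i2 by (simp add: set_integral_add v2)
  also have "\<dots> \<le> ?e * c + d * (e powr p / p - e powr p)"
    using tower_integral(2)[OF H, of n] cd by (intro add_right_mono mult_left_mono) auto
  finally show "(LINT x:{0<..}|lborel. ?q x * ?H x) \<le> ?e * c + d * (e powr p / p - e powr p)" .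
qed

section \<open>The radial Riesz potential and the fixed-point map\<close>

definition scal :: "(real \<Rightarrow> real) \<Rightarrow> (real \<Rightarrow> real) \<Rightarrow> real \<Rightarrow> real" where
  "scal w u s = (LINT t:{0<..<1}|lborel. w t * u (t * s))"

lemma tower_scal:
  assumes H: "tower H" and w: "continuous_on {0<..<1} w" "\<And>t. 0 < t \<Longrightarrow> t < 1 \<Longrightarrow> 0 \<le> w t"
    and I: "set_integrable lborel {0<..<1} w"
  shows "tower (\<lambda>n. scal (\<lambda>t. w t * t ^ n) (H n))"
proof -
  interpret averaging "{0<..<1}" w "\<lambda>t. t" "\<lambda>_. 0"
    by unfold_locales (use w in \<open>auto intro: continuous_intros\<close>)
  have "scal (\<lambda>t. w t * t ^ n) (H n) = avg {0<..<1} (\<lambda>t. w t * t ^ n) (\<lambda>t. t) (\<lambda>_. 0) (H n)" for n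
    by (simp add: scal_def avg_def fun_eq_iff)
  then show ?thesis using tower_avg[OF H] I by simp
qed

lemma scal_integrable:
  assumes H: "tower H" and w: "continuous_on {0<..<1} w" "\<And>t. 0 < t \<Longrightarrow> t < 1 \<Longrightarrow> 0 \<le> w t"
    and I: "set_integrable lborel {0<..<1} w" and s: "0 \<le> s"
  shows "set_integrable lborel {0<..<1} (\<lambda>t. w t * H n (t * s))"
proof -
  interpret averaging "{0<..<1}" w "\<lambda>t. t" "\<lambda>_. 0"
    by unfold_locales (use w in \<open>auto intro: continuous_intros\<close>)
  show ?thesis using avg_integrable[OF H _ s, of n 0] I by simp
qed

lemma scal_0: "scal w u 0 = (LINT t:{0<..<1}|lborel. w t) * u 0"
  by (simp add: scal_def)

locale riesz =
  fixes a :: real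
  assumes a: "0 < a" "a < 1"
begin

definition sg :: real where "sg = (1 - a) / 2"

lemma sg: "0 < sg" "sg < 1 / 2" "sg < 1" "a = 1 - 2 * sg"
  using a by (auto simp: sg_def field_simps)

text \<open>Up to the factor Gamma(\<open>sg\<close>), the Weyl fractional integral of order
  \<open>sg\<close>.\<close>

definition J :: "(real \<Rightarrow> real) \<Rightarrow> real \<Rightarrow> real" where
  "J u s = (LINT l:{0<..}|lborel. l powr (sg - 1) * u (s + l))"

sublocale Jav: averaging "{0<..}" "\<lambda>l. l powr (sg - 1)" "\<lambda>_. 1" "\<lambda>l. l"
  by unfold_locales (auto intro!: continuous_intros)

lemma J_avg: "J u = avg {0<..} (\<lambda>l. l powr (sg - 1)) (\<lambda>_. 1) (\<lambda>l. l) u"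
  by (simp add: J_def avg_def fun_eq_iff)

abbreviation J_able :: "(real \<Rightarrow> real) \<Rightarrow> bool" where
  "J_able u \<equiv> set_integrable lborel {0<..} (\<lambda>l. l powr (sg - 1) * u l)"

lemma tower_J:
  assumes "tower H" "\<And>n. set_integrable lborel {0<..} (\<lambda>l. l powr (sg - 1) * H n l)"
  shows "tower (\<lambda>n. J (H n))"
  using Jav.tower_avg[OF assms] by (simp add: J_avg)

lemma J_integrable:
  assumes "tower H" "J_able (H n)" "0 \<le> s"
  shows "set_integrable lborel {0<..} (\<lambda>l. l powr (sg - 1) * H n (s + l))"
  using Jav.avg_integrable[OF assms, of 0] by simp

lemma tower_J_Suc:
  assumes "tower H" shows "tower (\<lambda>n. J (H (Suc n)))"
  by (rule tower_J[OF tower_shift[OF assms]]) (rule tower_powr_integral(1)[OF assms sg(1,3) zero_less_one order_refl order_refl])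

lemma J_bound:
  assumes "tower H" "0 < e" "H n 0 \<le> c" "H (Suc n) 0 \<le> d"
  shows "J (H (Suc n)) 0 \<le> e powr (sg - 1) * c + d * (e powr sg / sg - e powr sg)"
  using tower_powr_integral(2)[OF assms(1) sg(1,3) assms(2-4)] by (simp add: J_def)

definition m :: "real \<Rightarrow> real" where "m t = t powr (a / 2) * (1 - t) powr (sg - 1)"

definition mu :: "nat \<Rightarrow> real" where "mu n = (LINT t:{0<..<1}|lborel. m t * t ^ n)"

lemma m_nonneg: "0 \<le> m t" by (simp add: m_def)

lemma m_cont: "continuous_on {0<..<1} m"
  unfolding m_def by (auto intro!: continuous_intros)

lemma m_power_integral:
  "set_integrable lborel {0<..<1} (\<lambda>t. m t * t ^ n)" "mu n = Beta (a / 2 + 1 + n) sg"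
proof -
  have "((\<lambda>t. t powr (a / 2 + 1 + n - 1) * (1 - t) powr (sg - 1)) has_integral Beta (a / 2 + 1 + n) sg) {0<..<1}"
    using has_integral_Beta_real[of "a / 2 + 1 + n" sg] sg a by (simp add: has_integral_Icc_iff_Ioo)
  then have I: "((\<lambda>t. m t * t ^ n) has_integral Beta (a / 2 + 1 + n) sg) {0<..<1}"
    by (rule has_integral_eq[rotated]) (auto simp: m_def powr_add powr_realpow)
  have c: "continuous_on {0<..<1} (\<lambda>t. m t * t ^ n)" by (intro continuous_intros m_cont)
  show "set_integrable lborel {0<..<1} (\<lambda>t. m t * t ^ n)" "mu n = Beta (a / 2 + 1 + n) sg"
    using set_integrable_of_has_integral[OF _ c _ I] m_nonneg by (auto simp: mu_def)
qed

lemma mu_pos: "0 < mu n"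
  unfolding m_power_integral(2) Beta_def using sg a by (auto intro!: divide_pos_pos mult_pos_pos Gamma_real_pos)

lemma mu_Suc_le: "mu (Suc n) \<le> mu n"
  unfolding mu_def
proof (rule set_integral_mono[OF m_power_integral(1) m_power_integral(1)])
  fix t :: real assume "t \<in> {0<..<1}"
  then show "m t * t ^ Suc n \<le> m t * t ^ n"
    using m_nonneg by (intro mult_left_mono power_decreasing) auto
qed

lemma mu_le: "k \<le> n \<Longrightarrow> mu n \<le> mu k"
  by (rule lift_Suc_antimono_le[of mu, OF mu_Suc_le])

text \<open>The sign-adjusted derivatives of W'. Only \<open>H (Suc n)\<close> enters, so they exist
  without any decay of \<open>H 0\<close>. The extra factor \<open>t\<close> comes from the one
  differentiation of the dilated function that leads from V to W'.\<close>

definition Z :: "(nat \<Rightarrow> real \<Rightarrow> real) \<Rightarrow> nat \<Rightarrow> real \<Rightarrow> real" where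
  "Z H n = scal (\<lambda>t. m t * t * t ^ n) (J (H (Suc n)))"

text \<open>\<open>P = W / s\<close> is written as the mean of \<open>W' = Z\<close> over \<open>[0, s]\<close>, so no division by \<open>s\<close> occurs.\<close>

definition P :: "(nat \<Rightarrow> real \<Rightarrow> real) \<Rightarrow> nat \<Rightarrow> real \<Rightarrow> real" where
  "P H n = scal (\<lambda>t. t ^ n) (Z H n)"

lemma tower_Z: "tower H \<Longrightarrow> tower (Z H)"
  unfolding Z_def
  by (rule tower_scal[OF tower_J_Suc]) (use m_nonneg m_power_integral(1)[of 1] in \<open>auto intro!: continuous_intros m_cont\<close>)

lemma one_integrable: "set_integrable lborel {0<..<1} (\<lambda>_ :: real. 1 :: real)"
  by (simp add: set_integrable_def integrable_indicator_iff)

lemma tower_P: "tower H \<Longrightarrow> tower (P H)"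
  using tower_scal[OF tower_Z continuous_on_const _ one_integrable, of H] by (simp add: P_def[abs_def])

lemma Z_0: "Z H n 0 = mu (Suc n) * J (H (Suc n)) 0"
  unfolding Z_def scal_0 mu_def by (simp add: mult_ac)

lemma P_0: "P H n 0 = Z H n 0 / (n + 1)"
proof -
  have "((\<lambda>x. x powr real n) has_integral (1 / (real n + 1))) {0<..<1}"
    using has_integral_powr_from_0[of n 1] by (simp add: has_integral_Icc_iff_Ioo)
  then have "((\<lambda>x::real. x ^ n) has_integral (1 / (real n + 1))) {0<..<1}"
    by (rule has_integral_eq[rotated]) (auto simp: powr_realpow)
  then have "(LINT x:{0<..<1}|lborel. x ^ n) = 1 / (real n + 1)"
    by (intro set_integrable_of_has_integral) (auto intro!: continuous_intros)
  then show ?thesis unfolding P_def scal_0 by simp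
qed

definition W :: "(nat \<Rightarrow> real \<Rightarrow> real) \<Rightarrow> real \<Rightarrow> real" where
  "W H s = s * P H 0 s"

text \<open>Integrate the derivative of \<open>\<theta> * Z H 0 (\<theta> * s)\<close> over [0, 1].
  The left-hand side is the derivative of s P, so this says W' = Z.\<close>

lemma P_Z_relation:
  assumes H: "tower H" and s: "0 \<le> s"
  shows "P H 0 s - s * P H 1 s = Z H 0 s"
proof -
  note T = tower_Z[OF H]
  have cont: "continuous_on {0..1} (\<lambda>\<theta>. Z H n (\<theta> * s))" for n
    by (rule continuous_on_compose2[OF tower_continuous[OF T]]) (use s in \<open>auto intro!: continuous_intros\<close>)
  have 1: "P H 0 s = integral {0..1} (\<lambda>\<theta>. Z H 0 (\<theta> * s))"
    unfolding P_def scal_def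
    using set_borel_integral_eq_integral(2)[OF scal_integrable[OF T continuous_on_const _ one_integrable s, of 0]]
    by (simp add: integral_open_interval_real)
  have 2: "P H 1 s = integral {0..1} (\<lambda>\<theta>. \<theta> * Z H 1 (\<theta> * s))"
  proof -
    have "set_integrable lborel {0<..<1} (\<lambda>t::real. t)"
      using powr_integral_0(1)[of 2 1]
      by (rule set_integrable_bound) (auto intro!: set_measurable_continuous continuous_intros)
    then have "set_integrable lborel {0<..<1} (\<lambda>t. t * Z H 1 (t * s))"
      by (intro scal_integrable[OF T _ _ _ s]) (auto intro!: continuous_intros)
    from set_borel_integral_eq_integral(2)[OF this] show ?thesis
      unfolding P_def scal_def by (simp add: integral_open_interval_real)
  qed
  have "((\<lambda>\<theta>. Z H 0 (\<theta> * s) - s * (\<theta> * Z H 1 (\<theta> * s))) has_integral (1 * Z H 0 (1 * s) - 0 * Z H 0 (0 * s))) {0..1}"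
  proof (rule fundamental_theorem_of_calculus)
    fix \<theta> :: real assume th: "\<theta> \<in> {0..1}"
    have "((\<lambda>\<theta>. Z H 0 (\<theta> * s)) has_real_derivative - Z H 1 (\<theta> * s) * s) (at \<theta> within {0..1})"
    proof (rule DERIV_image_chain[where f="Z H 0" and g="\<lambda>\<theta>. \<theta> * s", unfolded o_def])
      have "(Z H 0 has_real_derivative - Z H 1 (\<theta> * s)) (at (\<theta> * s) within {0..})"
        using deriv_nonnegD[OF tower_deriv[OF T, of 0], of "\<theta> * s"] s th by simp
      then show "(Z H 0 has_real_derivative - Z H 1 (\<theta> * s)) (at (\<theta> * s) within (\<lambda>\<theta>. \<theta> * s) ` {0..1})"
        by (rule DERIV_subset) (use s in auto)
    qed (auto intro!: derivative_eq_intros)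
    then have "((\<lambda>\<theta>. \<theta> * Z H 0 (\<theta> * s)) has_real_derivative Z H 0 (\<theta> * s) - s * (\<theta> * Z H 1 (\<theta> * s))) (at \<theta> within {0..1})"
      by (auto intro!: derivative_eq_intros)
    then show "((\<lambda>\<theta>. \<theta> * Z H 0 (\<theta> * s)) has_vector_derivative Z H 0 (\<theta> * s) - s * (\<theta> * Z H 1 (\<theta> * s))) (at \<theta> within {0..1})"
      by (simp add: has_real_derivative_iff_has_vector_derivative)
  qed simp
  moreover have "integral {0..1} (\<lambda>\<theta>. Z H 0 (\<theta> * s) - s * (\<theta> * Z H 1 (\<theta> * s))) = P H 0 s - s * P H 1 s"
    unfolding 1 2 using cont by (subst integral_diff) (auto intro!: integrable_continuous_interval continuous_intros)
  ultimately show ?thesis by (simp add: integral_unique)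
qed

lemma W_deriv:
  assumes H: "tower H" shows "deriv_nonneg (W H) (Z H 0)"
  unfolding deriv_nonneg_def
proof safe
  fix s :: real assume s: "0 \<le> s"
  have "((\<lambda>s. s * P H 0 s) has_real_derivative P H 0 s - s * P H 1 s) (at s within {0..})"
    using deriv_nonnegD[OF tower_deriv[OF tower_P[OF H], of 0] s] by (auto intro!: derivative_eq_intros)
  then show "(W H has_real_derivative Z H 0 s) (at s within {0..})"
    unfolding P_Z_relation[OF H s] W_def[abs_def] .
qed

lemma W_nonneg: "tower H \<Longrightarrow> 0 \<le> s \<Longrightarrow> 0 \<le> W H s"
  unfolding W_def using tower_nonneg[OF tower_P] by simp

lemma W_mono: "tower H \<Longrightarrow> 0 \<le> s \<Longrightarrow> s \<le> t \<Longrightarrow> W H s \<le> W H t"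
  using deriv_nonneg_antimono[of "\<lambda>s. - W H s" "\<lambda>s. - Z H 0 s" s t] W_deriv[of H] tower_nonneg[OF tower_Z, of H]
  unfolding deriv_nonneg_def by (auto intro!: derivative_eq_intros)

text \<open>Tying kappa to W'(0) makes \<open>Q H 0\<close> equal to 1 / 2, so that the
  normalisation of the slope at 0 reproduces itself.\<close>

abbreviation kap :: "(nat \<Rightarrow> real \<Rightarrow> real) \<Rightarrow> real" where "kap H \<equiv> Z H 0 0"

definition E :: "(nat \<Rightarrow> real \<Rightarrow> real) \<Rightarrow> real \<Rightarrow> real" where
  "E H s = 1 / (2 * (kap H + W H s))"

definition Q :: "(nat \<Rightarrow> real \<Rightarrow> real) \<Rightarrow> real \<Rightarrow> real" where
  "Q H s = P H 0 s * E H s"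

definition R :: "(nat \<Rightarrow> real \<Rightarrow> real) \<Rightarrow> real \<Rightarrow> real" where
  "R H s = exp (- integral {0..s} (Q H))"

definition kmin :: real where "kmin = mu 1 * ((1 / 6) powr sg / (2 * sg * (sg + 1)))"

lemma kmin_pos: "0 < kmin"
  unfolding kmin_def using mu_pos sg by simp

text \<open>The bound on the second derivative gives \<open>H 1 l \<ge> 1 / 2 - 3 * l\<close>, which
  is integrated up to the zero 1 / 6 of the right-hand side.\<close>

lemma J_lower:
  assumes H: "tower H" "H 1 0 = 1 / 2" "H 2 0 \<le> 3"
  shows "(1 / 6) powr sg / (2 * sg * (sg + 1)) \<le> J (H 1) 0"
proof -
  let ?e = "1 / 6 :: real"
  note i1 = powr_integral_0[of sg ?e] and i2 = powr_integral_0[of "sg + 1" ?e]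
  have int: "set_integrable lborel {0<..} (\<lambda>l. l powr (sg - 1) * H (Suc 0) l)"
    by (rule tower_powr_integral(1)[OF H(1) sg(1,3) zero_less_one order_refl order_refl])
  have "(LINT l:{0<..<?e}|lborel. (1 / 2) * l powr (sg - 1) - 3 * l powr (sg + 1 - 1)) \<le> (LINT l:{0<..<?e}|lborel. l powr (sg - 1) * H (Suc 0) l)"
  proof (rule set_integral_mono)
    show "set_integrable lborel {0<..<?e} (\<lambda>l. (1 / 2) * l powr (sg - 1) - 3 * l powr (sg + 1 - 1))"
      using i1(1) i2(1) sg by (intro set_integral_diff set_integrable_mult_right) auto
    show "set_integrable lborel {0<..<?e} (\<lambda>l. l powr (sg - 1) * H (Suc 0) l)"
      by (rule set_integrable_subset[OF int]) auto
    fix l :: real assume l: "l \<in> {0<..<?e}"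
    have "\<bar>H 1 0 - H 1 l\<bar> \<le> H 2 0 * l"
      using tower_lipschitz[OF H(1), of 0 l 1] l by (simp add: numeral_2_eq_2)
    moreover have "H 2 0 * l \<le> 3 * l"
      using H(3) l by (intro mult_right_mono) auto
    ultimately have "1 / 2 - H 1 l \<le> 3 * l" unfolding H(2) by linarith
    then have "(1 / 2 - 3 * l) * l powr (sg - 1) \<le> H 1 l * l powr (sg - 1)"
      by (intro mult_right_mono) auto
    then show "(1 / 2) * l powr (sg - 1) - 3 * l powr (sg + 1 - 1) \<le> l powr (sg - 1) * H (Suc 0) l"
      using l by (simp add: powr_diff algebra_simps)
  qed
  also have "\<dots> \<le> J (H 1) 0"
  proof -
    have "set_integrable lborel {0<..<?e} (\<lambda>l. l powr (sg - 1) * H (Suc 0) l)"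
      by (rule set_integrable_subset[OF int]) auto
    with int show ?thesis
      unfolding J_def set_lebesgue_integral_def set_integrable_def One_nat_def add_0
      using tower_nonneg[OF H(1)] by (intro integral_mono) (auto simp: indicator_def)
  qed
  also have "(LINT l:{0<..<?e}|lborel. (1 / 2) * l powr (sg - 1) - 3 * l powr (sg + 1 - 1)) = (1 / 2) * (?e powr sg / sg) - 3 * (?e powr (sg + 1) / (sg + 1))"
    using i1 i2 sg by (subst set_integral_diff(2)) auto
  also have "\<dots> = ?e powr sg / (2 * sg * (sg + 1))"
  proof -
    have "sg \<noteq> 0" "sg + 1 \<noteq> 0" using sg by auto
    then have "(1 / 2) * (A / sg) - 3 * (A * (1 / 6) / (sg + 1)) = A / (2 * sg * (sg + 1))" for A
      by (simp add: divide_simps) (simp add: algebra_simps)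
    then show ?thesis by (simp add: powr_add)
  qed
  finally show ?thesis .
qed

lemma kap_lower:
  assumes "tower H" "H 1 0 = 1 / 2" "H 2 0 \<le> 3"
  shows "kmin \<le> kap H"
  unfolding kmin_def Z_0 using mult_left_mono[OF J_lower[OF assms] less_imp_le[OF mu_pos[of 1]]] by simp

end

section \<open>Closure of complete monotonicity under products and linear equations\<close>

lemma cmb_bound_nonneg: "cmb n c c u \<Longrightarrow> 0 \<le> c"
  by (cases n) (auto intro: order_trans)

lemma cm_mult: "cm u \<Longrightarrow> cm v \<Longrightarrow> cm (\<lambda>s. u s * v s)"
  unfolding cm_def
proof
  fix n assume "\<forall>n. \<exists>c. cmb n c c u" "\<forall>n. \<exists>c. cmb n c c v"
  then obtain b c where bc: "cmb n c c u" "cmb n b b v" by blast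
  from cmb_mult[OF this cmb_bound_nonneg[OF bc(1)] order_refl cmb_bound_nonneg[OF bc(2)]]
  show "\<exists>c. cmb n c c (\<lambda>s. u s * v s)" by blast
qed

text \<open>By Leibniz, order \<open>n\<close> of \<open>u\<close> and \<open>q\<close> bounds order
  \<open>n + 1\<close> of \<open>u\<close>.\<close>

lemma cm_of_ode:
  assumes u: "deriv_nonneg u (\<lambda>s. - (q s * u s))" "\<And>s. 0 \<le> s \<Longrightarrow> 0 \<le> u s" "\<And>s. 0 \<le> s \<Longrightarrow> u s \<le> 1" and q: "cm q"
  shows "cm u"
  unfolding cm_def
proof
  fix n show "\<exists>c. cmb n c c u"
  proof (induction n)
    case 0
    show ?case using u by (intro exI[of _ 1]) simp
  next
    case (Suc n)
    then obtain c where c: "cmb n c c u" by blast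
    obtain b where b: "cmb n b b q" using q unfolding cm_def by blast
    let ?d = "2^n * (b * c)"
    have "cmb n ?d ?d (\<lambda>s. q s * u s)"
      by (rule cmb_mult[OF b c]) (use b c cmb_bound_nonneg in auto)
    then have "cmb n (max 1 ?d) (max 1 ?d) (\<lambda>s. q s * u s)"
      by (rule cmb_weaken) auto
    moreover have "u s \<le> max 1 ?d" if "0 \<le> s" for s
      using u(3)[OF that] by (simp add: le_max_iff_disj)
    ultimately have "cmb (Suc n) (max 1 ?d) (max 1 ?d) u"
      using u(1,2) by (intro cmb_SucI)
    then show ?case by blast
  qed
qed

lemma cm_continuous: "cm u \<Longrightarrow> continuous_on {0..} u"
  using cm_deriv deriv_nonneg_continuous by blast

lemma tower_unique:
  assumes "tower H" "tower K" "\<And>s. 0 \<le> s \<Longrightarrow> H 0 s = K 0 s" "0 \<le> s"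
  shows "H n s = K n s"
  using assms(4)
proof (induction n arbitrary: s)
  case (Suc n)
  have "deriv_nonneg (K n) (\<lambda>s. - H (Suc n) s)"
    by (rule deriv_nonneg_cong[OF tower_deriv[OF assms(1)]]) (use Suc.IH in auto)
  from deriv_nonneg_unique[OF this tower_deriv[OF assms(2)] Suc.prems] show ?case by simp
qed (use assms in auto)

section \<open>The normalised class and its invariance\<close>

context riesz
begin

text \<open>The condition \<open>H 1 0 = 1 / 2\<close> removes the dilation freedom, and the lower
  bound is the solution of u' = - u / (2 (1 + s)) with u(0) = 1. For the origin of 3 see
  \<open>Z1_le\<close>.\<close>

definition base :: "(nat \<Rightarrow> real \<Rightarrow> real) \<Rightarrow> bool" where
  "base H \<longleftrightarrow> tower H \<and> H 0 0 = 1 \<and> H 1 0 = 1 / 2 \<and> H 2 0 \<le> 3 \<and> (\<forall>s\<ge>0. 1 / sqrt (1 + s) \<le> H 0 s)"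

lemma base_tower: "base H \<Longrightarrow> tower H"
  by (simp add: base_def)

lemma base_kap: "base H \<Longrightarrow> kmin \<le> kap H"
  using kap_lower by (simp add: base_def)

lemma base_kap_pos: "base H \<Longrightarrow> 0 < kap H"
  using base_kap kmin_pos by force

lemma kapW_pos: "base H \<Longrightarrow> 0 \<le> s \<Longrightarrow> 0 < kap H + W H s"
  using base_kap_pos W_nonneg[OF base_tower] by (simp add: add_pos_nonneg)

lemma P_le_kap: "tower H \<Longrightarrow> 0 \<le> s \<Longrightarrow> P H 0 s \<le> kap H"
  using tower_le0[OF tower_P, of H s 0] P_0[of H 0] by simp

lemma E_pos: "base H \<Longrightarrow> 0 \<le> s \<Longrightarrow> 0 < E H s"
  unfolding E_def by (intro divide_pos_pos mult_pos_pos kapW_pos) auto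

lemma E_deriv: assumes "base H" shows "deriv_nonneg (E H) (\<lambda>s. - (2 * Z H 0 s * (E H s)\<^sup>2))"
  unfolding deriv_nonneg_def
proof safe
  fix s :: real assume s: "0 \<le> s"
  show "(E H has_real_derivative - (2 * Z H 0 s * (E H s)\<^sup>2)) (at s within {0..})"
    unfolding E_def[abs_def] using kapW_pos[OF assms s] deriv_nonnegD[OF W_deriv[OF base_tower[OF assms]] s]
    by (auto intro!: derivative_eq_intros simp: power2_eq_square field_simps)
qed

lemma cm_E: assumes "base H" shows "cm (E H)"
  unfolding cm_def
proof
  fix n
  obtain z where z: "cmb n z z (Z H 0)"
    using tower_imp_cm[OF tower_Z[OF base_tower[OF assms]]] unfolding cm_def by blast
  from cmb_reciprocal[OF kmin_pos cmb_bound_nonneg[OF z], of n] obtain e where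
    "cmb (Suc n) e e (\<lambda>s. 1 / (2 * (kap H + W H s)))"
    using base_kap[OF assms] W_nonneg[OF base_tower[OF assms]] W_deriv[OF base_tower[OF assms]] z by blast
  then show "\<exists>c. cmb n c c (E H)" using cmb_drop unfolding E_def[abs_def] by blast
qed

lemma cm_Q: "base H \<Longrightarrow> cm (Q H)"
  unfolding Q_def[abs_def] by (intro cm_mult tower_imp_cm tower_P base_tower cm_E)

lemma Q_nonneg: "base H \<Longrightarrow> 0 \<le> s \<Longrightarrow> 0 \<le> Q H s"
  using tower_nonneg[OF tower_P[OF base_tower]] E_pos by (simp add: Q_def less_imp_le)

text \<open>From P \<le> kappa one gets P (1 + s) \<le> kappa + s P, and s P is W.\<close>

lemma Q_upper:
  assumes "base H" "0 \<le> s" shows "Q H s \<le> 1 / (2 * (1 + s))"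
proof -
  have "P H 0 s * (1 + s) \<le> kap H + W H s"
    using P_le_kap[OF base_tower[OF assms(1)] assms(2)] by (simp add: W_def algebra_simps)
  then show ?thesis
    using kapW_pos[OF assms] assms(2) by (simp add: Q_def E_def field_simps)
qed

lemma R_deriv:
  assumes H: "base H" shows "deriv_nonneg (R H) (\<lambda>s. - (Q H s * R H s))"
  unfolding deriv_nonneg_def
proof safe
  fix s :: real assume s: "0 \<le> s"
  have "((\<lambda>x. integral {0..x} (Q H)) has_real_derivative Q H s) (at s within {0..s + 1})"
    by (rule integral_has_real_derivative) (use s continuous_on_subset[OF cm_continuous[OF cm_Q[OF H]]] in auto)
  moreover have "at s within {0..s + 1} = at s within {0..}"
    by (rule at_within_nhd[of s "{..<s + 1}"]) auto
  ultimately have "((\<lambda>x. integral {0..x} (Q H)) has_real_derivative Q H s) (at s within {0..})" by simp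
  then show "(R H has_real_derivative - (Q H s * R H s)) (at s within {0..})"
    unfolding R_def[abs_def] by (auto intro!: derivative_eq_intros)
qed

lemma R_0: "R H 0 = 1" by (simp add: R_def)

lemma R_pos: "0 < R H s" by (simp add: R_def)

lemma R_le_1: assumes "base H" "0 \<le> s" shows "R H s \<le> 1"
  using deriv_nonneg_antimono[OF R_deriv[OF assms(1)] _ order_refl assms(2)] Q_nonneg[OF assms(1)] less_imp_le[OF R_pos] R_0
  by simp

text \<open>By \<open>Q_upper\<close> the product R sqrt(1 + s) is nondecreasing.\<close>

lemma R_lower:
  assumes H: "base H" and s: "0 \<le> s" shows "1 / sqrt (1 + s) \<le> R H s"
proof -
  have "- (R H s * sqrt (1 + s)) \<le> - (R H 0 * sqrt (1 + 0))"
  proof (rule deriv_nonneg_antimono[OF _ _ order_refl s])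
    show "deriv_nonneg (\<lambda>s. - (R H s * sqrt (1 + s))) (\<lambda>s. - (- (Q H s * R H s) * sqrt (1 + s) + R H s * (1 / (2 * sqrt (1 + s)))))"
      unfolding deriv_nonneg_def using deriv_nonnegD[OF R_deriv[OF H]]
      by (auto intro!: derivative_eq_intros simp: field_simps)
    fix s :: real assume s: "0 \<le> s"
    have "Q H s * sqrt (1 + s) \<le> 1 / (2 * (1 + s)) * sqrt (1 + s)"
      using Q_upper[OF H s] s by (intro mult_right_mono) auto
    also have "\<dots> = 1 / (2 * sqrt (1 + s))"
      using s real_sqrt_mult_self[of "1 + s"] by (simp add: field_simps)
    finally have "R H s * (Q H s * sqrt (1 + s)) \<le> R H s * (1 / (2 * sqrt (1 + s)))"
      using R_pos[of H s] by (intro mult_left_mono) auto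
    then show "- (- (Q H s * R H s) * sqrt (1 + s) + R H s * (1 / (2 * sqrt (1 + s)))) \<le> 0"
      by (simp add: algebra_simps)
  qed
  then show ?thesis using s by (simp add: R_0 divide_le_eq)
qed

lemma cm_R: "base H \<Longrightarrow> cm (R H)"
  by (rule cm_of_ode[OF R_deriv _ _ cm_Q]) (auto simp: R_le_1 less_imp_le[OF R_pos])

lemma R_tower_1:
  assumes H: "base H" and K: "tower K" "K 0 = R H" and s: "0 \<le> s"
  shows "K 1 s = Q H s * R H s"
  using deriv_nonneg_unique[OF tower_deriv[OF K(1), of 0, unfolded K(2)] R_deriv[OF H] s] by simp

text \<open>Both estimates of J compare with the same extremal second derivative, 3 on (0, 1 / 6),
  and their quotient is 6 (sg + 1), at most 9 because sg < 1 / 2. With a bound B in place of 3 the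
  quotient is at most 3 B, and the computation in \<open>R_base\<close> returns 3 B / 4 + 3 / 4,
  which is at most B exactly for B \<ge> 3.\<close>

lemma Z1_le: assumes H: "base H" shows "Z H 1 0 \<le> 9 * kap H"
proof -
  have T: "tower H" "H 1 0 = 1 / 2" "H 2 0 \<le> 3" using H by (auto simp: base_def)
  let ?e = "(1 / 6 :: real) powr sg"
  have "J (H 2) 0 \<le> (1 / 6) powr (sg - 1) * (1 / 2) + 3 * (?e / sg - ?e)"
    using J_bound[OF T(1), of "1 / 6" 1 "1 / 2" 3] T(2,3) by (simp add: numeral_2_eq_2)
  also have "(1 / 6 :: real) powr (sg - 1) = 6 * ?e" by (simp add: powr_diff)
  also have "6 * ?e * (1 / 2) + 3 * (?e / sg - ?e) = 6 * (sg + 1) * (?e / (2 * sg * (sg + 1)))"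
  proof -
    have "sg \<noteq> 0" "sg + 1 \<noteq> 0" using sg by auto
    then show ?thesis by (simp add: divide_simps)
  qed
  also have "\<dots> \<le> 9 * (?e / (2 * sg * (sg + 1)))"
    using sg by (intro mult_right_mono) auto
  also have "\<dots> \<le> 9 * J (H 1) 0" using J_lower[OF T] by simp
  finally have le: "J (H 2) 0 \<le> 9 * J (H 1) 0" .
  have "Z H 1 0 = mu 2 * J (H 2) 0" using Z_0[of H 1] by (simp add: numeral_2_eq_2)
  also have "\<dots> \<le> mu 1 * (9 * J (H 1) 0)"
    using le mu_le[of 1 2] mu_pos[of 1] tower_nonneg[OF tower_J_Suc[OF T(1)], of 0 1]
    by (intro mult_mono) (auto simp: numeral_2_eq_2)
  also have "\<dots> = 9 * kap H" using Z_0[of H 0] by simp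
  finally show ?thesis .
qed

lemma R_base:
  assumes H: "base H" and K: "tower K" "K 0 = R H"
  shows "base K"
proof -
  have T: "tower H" using H by (simp add: base_def)
  have k: "0 < kap H" using base_kap_pos[OF H] .
  have E0: "E H 0 = 1 / (2 * kap H)" by (simp add: E_def W_def)
  have Q0: "Q H 0 = 1 / 2" using P_0[of H 0] k by (simp add: Q_def E0)
  have 1: "K 1 0 = 1 / 2" using R_tower_1[OF H K, of 0] by (simp add: Q0 R_0)
  let ?q = "\<lambda>s. - P H 1 s * E H s + P H 0 s * - (2 * Z H 0 s * (E H s)\<^sup>2)"
  have dQ: "deriv_nonneg (Q H) ?q"
    unfolding deriv_nonneg_def Q_def[abs_def]
  proof safe
    fix s :: real assume "0 \<le> s"
    then show "((\<lambda>s. P H 0 s * E H s) has_real_derivative ?q s) (at s within {0..})"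
      using DERIV_mult[OF deriv_nonnegD[OF tower_deriv[OF tower_P[OF T], of 0], of s] deriv_nonnegD[OF E_deriv[OF H], of s]]
      by (simp add: algebra_simps)
  qed
  have "deriv_nonneg (\<lambda>s. Q H s * R H s) (\<lambda>s. ?q s * R H s + Q H s * - (Q H s * R H s))"
    unfolding deriv_nonneg_def
  proof safe
    fix s :: real assume "0 \<le> s"
    then show "((\<lambda>s. Q H s * R H s) has_real_derivative ?q s * R H s + Q H s * - (Q H s * R H s)) (at s within {0..})"
      using DERIV_mult[OF deriv_nonnegD[OF dQ, of s] deriv_nonnegD[OF R_deriv[OF H], of s]]
      by (simp add: algebra_simps)
  qed
  then have "deriv_nonneg (K 1) (\<lambda>s. ?q s * R H s + Q H s * - (Q H s * R H s))"
    by (rule deriv_nonneg_cong) (use R_tower_1[OF H K] in auto)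
  from deriv_nonneg_unique[OF this tower_deriv[OF K(1)], of 0]
  have "K 2 0 = - (?q 0 * R H 0 + Q H 0 * - (Q H 0 * R H 0))" by (simp add: numeral_2_eq_2)
  \<comment> \<open>At 0, K 2 = Q^2 - Q' with Q^2 = 1 / 4. In - Q' the derivative of E contributes 1
    / 2, and that of P, which is half of \<open>Z H 1 0\<close> up to sign, contributes the first
    summand.\<close>
  also have "\<dots> = Z H 1 0 / (4 * kap H) + 3 / 4"
    using k P_0[of H 0] P_0[of H 1] by (simp add: Q0 R_0 E0 power2_eq_square field_simps)
  also have "\<dots> \<le> 3" using Z1_le[OF H] k by (simp add: field_simps)
  finally have "K 2 0 \<le> 3" .
  with 1 K R_0 R_lower[OF H] show ?thesis by (simp add: base_def)
qed

text \<open>The top derivative enters the estimate for \<open>J\<close> with the small factor \<open>\<eta>\<^sup>\<sigma>\<close>, so a sufficiently large bound on it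
  reproduces itself.\<close>

lemma level_step:
  assumes c: "0 \<le> c" and n: "0 < n"
  shows "\<exists>c'\<ge>lo. \<forall>H K. base H \<longrightarrow> (\<forall>k\<le>n. H k 0 \<le> c) \<longrightarrow> H (Suc n) 0 \<le> c' \<longrightarrow> tower K \<longrightarrow> K 0 = R H \<longrightarrow>
     (\<forall>k\<le>n. K k 0 \<le> c) \<longrightarrow> K (Suc n) 0 \<le> c'"
proof -
  \<comment> \<open>The value of \<open>J_bound\<close> with cut 1 when both bounds are
    \<open>c\<close>; it serves all orders of Z below \<open>n\<close>.\<close>
  define z where "z = mu 0 * (c + c * (1 / sg - 1))"
  have z: "0 \<le> z" using mu_pos[of 0] c sg by (simp add: z_def)
  obtain n' where n': "n = Suc n'" using n gr0_implies_Suc by blast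
  from cmb_reciprocal[OF kmin_pos z, of n'] obtain e where e: "0 \<le> e"
    "\<And>\<kappa> W Z. kmin \<le> \<kappa> \<Longrightarrow> (\<forall>s\<ge>0. 0 \<le> W s) \<Longrightarrow> deriv_nonneg W Z \<Longrightarrow> cmb n' z z Z \<Longrightarrow>
     cmb n e e (\<lambda>s. 1 / (2 * (\<kappa> + W s)))" unfolding n' by blast
  define L where "L = 2^n * (2^n * (e * c))"
  have L: "0 \<le> L" using e c by (simp add: L_def)
  \<comment> \<open>The cut is so small that the top bound enters with total coefficient at most 1 /
    2; \<open>c'\<close> is then twice the remaining terms.\<close>
  define \<eta> where "\<eta> = (sg / (2 * (L * mu 0 + 1))) powr (1 / sg)"
  have pos: "0 < L * mu 0 + 1" using L mu_pos[of 0] by (simp add: add_nonneg_pos)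
  have \<eta>: "0 < \<eta>" "\<eta> powr sg / sg = 1 / (2 * (L * mu 0 + 1))"
    using pos sg by (auto simp: \<eta>_def powr_powr)
  have half: "L * (mu 0 * (\<eta> powr sg / sg)) \<le> 1 / 2"
    unfolding \<eta>(2) using pos by (simp add: field_simps)
  define c' where "c' = max (max lo 0) (2 * (L * (z + mu 0 * (\<eta> powr (sg - 1) * c))))"
  have "K (Suc n) 0 \<le> c'"
    if H: "base H" and Hc: "\<forall>k\<le>n. H k 0 \<le> c" "H (Suc n) 0 \<le> c'" and K: "tower K" "K 0 = R H" and Kc: "\<forall>k\<le>n. K k 0 \<le> c" for H K
  proof -
    have T: "tower H" using H by (simp add: base_def)
    have Zle: "Z H k 0 \<le> mu 0 * (\<epsilon> powr (sg - 1) * c + d * (\<epsilon> powr sg / sg - \<epsilon> powr sg))"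
      if "k \<le> n" "H (Suc k) 0 \<le> d" "0 < \<epsilon>" for k d \<epsilon>
      unfolding Z_0 using that Hc(1) mu_pos[of 0] mu_le[of 0 "Suc k"] tower_nonneg[OF tower_J_Suc[OF T], of 0 k]
      by (intro mult_mono J_bound[OF T]) auto
    have Zz: "Z H k 0 \<le> z" if "k < n" for k
      using Zle[of k c 1] that Hc(1) by (simp add: z_def algebra_simps)
    have Z0: "0 \<le> Z H k 0" for k using tower_nonneg[OF tower_Z[OF T]] by simp
    have PZ: "P H k 0 \<le> Z H k 0" for k
      unfolding P_0 using Z0[of k] by (simp add: field_simps)
    define w where "w = max z (Z H n 0)"
    \<comment> \<open>Order \<open>n\<close> of E needs Z only up to \<open>n' = n - 1\<close>, so
      \<open>H (Suc n) 0\<close> acts through the top order of P alone, hence linearly.\<close>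
    have "cmb n' z z (Z H 0)"
      by (rule tower_imp_cmb[OF tower_Z[OF T]]) (use Zz n' in auto)
    then have cE: "cmb n e e (E H)"
      unfolding E_def[abs_def] using e(2) base_kap[OF H] W_nonneg[OF T] W_deriv[OF T] by blast
    have cP: "cmb n z w (P H 0)"
      by (rule tower_imp_cmb[OF tower_P[OF T]]) (use PZ order_trans[OF PZ Zz] in \<open>auto simp: w_def le_max_iff_disj\<close>)
    have cQ: "cmb n (2^n * (z * e)) (2^n * (w * e)) (Q H)"
      unfolding Q_def[abs_def] by (rule cmb_mult[OF cP cE]) (use z e in \<open>auto simp: w_def\<close>)
    have cR: "cmb n c c (R H)"
      using tower_imp_cmb[OF K(1), of n c c] Kc K(2) by simp
    have "cmb n (2^n * (2^n * (z * e) * c)) (2^n * (2^n * (w * e) * c)) (\<lambda>s. Q H s * R H s)"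
      by (rule cmb_mult[OF cQ cR]) (use z e c in \<open>auto simp: w_def intro!: mult_right_mono\<close>)
    then have "cmb n (2^n * (2^n * (z * e) * c)) (2^n * (2^n * (w * e) * c)) (K 1)"
      by (rule cmb_cong) (use R_tower_1[OF H K] in simp)
    then have "K (Suc n) 0 \<le> 2^n * (2^n * (w * e) * c)"
      using cmb_tower_bound[OF tower_shift[OF K(1)], of n _ _ 0] by simp
    also have "\<dots> = L * w" by (simp add: L_def)
    also have "\<dots> \<le> L * (z + mu 0 * (\<eta> powr (sg - 1) * c + c' * (\<eta> powr sg / sg)))"
    proof (rule mult_left_mono[OF _ L])
      have "0 \<le> c'" by (simp add: c'_def)
      have "Z H n 0 \<le> mu 0 * (\<eta> powr (sg - 1) * c + c' * (\<eta> powr sg / sg - \<eta> powr sg))"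
        by (rule Zle) (use Hc \<eta> in auto)
      also have "\<dots> \<le> mu 0 * (\<eta> powr (sg - 1) * c + c' * (\<eta> powr sg / sg))"
        using \<open>0 \<le> c'\<close> mu_pos[of 0] by (intro mult_left_mono add_left_mono) auto
      finally have "w \<le> z + Z H n 0" "Z H n 0 \<le> \<dots>"
        using z Z0[of n] by (auto simp: w_def)
      then show "w \<le> z + mu 0 * (\<eta> powr (sg - 1) * c + c' * (\<eta> powr sg / sg))" by linarith
    qed
    also have "\<dots> = L * (z + mu 0 * (\<eta> powr (sg - 1) * c)) + c' * (L * (mu 0 * (\<eta> powr sg / sg)))"
      by (simp add: algebra_simps)
    also have "\<dots> \<le> c' / 2 + c' * (1 / 2)"
      using half by (intro add_mono mult_left_mono) (auto simp: c'_def)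
    finally show ?thesis by simp
  qed
  moreover have "lo \<le> c'" by (simp add: c'_def)
  ultimately show ?thesis by blast
qed

text \<open>Orders up to 2 are settled by \<open>base\<close>, and every later bound is produced by
  \<open>level_step\<close> from the earlier ones. The sequence \<open>lo\<close> prescribes room
  for a known member of the class.\<close>

lemma invariant_bounds:
  fixes lo :: "nat \<Rightarrow> real"
  assumes lo3: "\<And>n. n \<le> 2 \<Longrightarrow> lo n \<le> 3"
  shows "\<exists>C. (\<forall>n. lo n \<le> C n) \<and> (\<forall>H K. base H \<longrightarrow> (\<forall>n. H n 0 \<le> C n) \<longrightarrow> tower K \<longrightarrow> K 0 = R H \<longrightarrow> (\<forall>n. K n 0 \<le> C n))"
proof -
  define step where "step i c c' \<longleftrightarrow> (\<forall>H K. base H \<longrightarrow> (\<forall>k\<le>i + 2. H k 0 \<le> c) \<longrightarrow> H (Suc (i + 2)) 0 \<le> c' \<longrightarrow>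
     tower K \<longrightarrow> K 0 = R H \<longrightarrow> (\<forall>k\<le>i + 2. K k 0 \<le> c) \<longrightarrow> K (Suc (i + 2)) 0 \<le> c')" for i c c'
  have "\<exists>cs :: nat \<Rightarrow> real. \<forall>i. (3 \<le> cs i \<and> (i = 0 \<longrightarrow> cs i = 3)) \<and> (cs i \<le> cs (Suc i) \<and> lo (i + 3) \<le> cs (Suc i) \<and> step i (cs i) (cs (Suc i)))"
  proof (rule dependent_nat_choice)
    fix c :: real and i :: nat assume "3 \<le> c \<and> (i = 0 \<longrightarrow> c = (3::real))"
    then have c: "0 \<le> c" "3 \<le> c" by auto
    from level_step[OF c(1), of "i + 2" "max c (lo (i + 3))"] obtain c' where "max c (lo (i + 3)) \<le> c'" "step i c c'"
      unfolding step_def by auto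
    then show "\<exists>c'. (3 \<le> c' \<and> (Suc i = 0 \<longrightarrow> c' = 3)) \<and> (c \<le> c' \<and> lo (i + 3) \<le> c' \<and> step i c c')"
      using c by (intro exI[of _ c']) simp
  qed auto
  then obtain cs where cs: "cs 0 = (3::real)" "\<And>i. cs i \<le> cs (Suc i)" "\<And>i. lo (i + 3) \<le> cs (Suc i)"
    and step: "\<And>i. step i (cs i) (cs (Suc i))"
    by auto
  have mono: "i \<le> j \<Longrightarrow> cs i \<le> cs j" for i j by (rule lift_Suc_mono_le[of cs, OF cs(2)])
  \<comment> \<open>Truncated subtraction gives orders 0, 1 and 2 the common bound 3.\<close>
  define C where "C n = cs (n - 2)" for n
  have low: "K k 0 \<le> 3" if K: "base K" "k \<le> 2" for K k
  proof -
    have "K k 0 \<in> {1, 1 / 2} \<or> K k 0 \<le> 3"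
      using K by (auto simp: base_def le_Suc_eq numeral_2_eq_2)
    then show ?thesis by auto
  qed
  have "lo n \<le> C n" for n
  proof (cases "n \<le> 2")
    case True
    then show ?thesis using lo3 cs(1) by (simp add: C_def)
  next
    case False
    then obtain i where "n = i + 3" using le_Suc_ex[of 3 n] by (auto simp: add.commute)
    then show ?thesis using cs(3) by (simp add: C_def numeral_3_eq_3)
  qed
  moreover have "K n 0 \<le> C n" if H: "base H" "\<And>n. H n 0 \<le> C n" and K: "tower K" "K 0 = R H" for H K n
  proof (induction n rule: less_induct)
    case (less n)
    show ?case
    proof (cases "n \<le> 2")
      case True
      then show ?thesis using low[OF R_base[OF H(1) K] True] cs(1) by (simp add: C_def)
    next
      case False
      then obtain i where n: "n = i + 3" using le_Suc_ex[of 3 n] by (auto simp: add.commute)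
      have Ck: "C k \<le> cs i" if "k \<le> i + 2" for k
        unfolding C_def by (rule mono) (use that in auto)
      have C3: "C (i + 3) = cs (Suc i)" by (simp add: C_def numeral_3_eq_3)
      have "H k 0 \<le> cs i" "K k 0 \<le> cs i" if "k \<le> i + 2" for k
        using order_trans[OF H(2) Ck] order_trans[OF less Ck] that n by auto
      moreover have "H (Suc (i + 2)) 0 \<le> cs (Suc i)"
        using H(2)[of "i + 3"] C3 by (simp add: numeral_3_eq_3)
      ultimately have "K (Suc (i + 2)) 0 \<le> cs (Suc i)"
        using step[of i, unfolded step_def] H(1) K by blast
      then have "K (i + 3) 0 \<le> cs (Suc i)" by (simp add: numeral_3_eq_3)
      then show ?thesis by (simp add: n C3)
    qed
  qed
  ultimately show ?thesis by blast
qed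

end

section \<open>Existence of a fixed point\<close>

text \<open>Absolute values turn an enumeration of the rationals into one of the nonnegative
  rationals; the rest is density.\<close>

lemma eq_on_nonneg_of_rats:
  fixes f g :: "real \<Rightarrow> real"
  assumes "continuous_on {0..} f" "continuous_on {0..} g" "\<And>i. f \<bar>from_nat_into \<rat> i\<bar> = g \<bar>from_nat_into \<rat> i\<bar>" "0 \<le> s"
  shows "f s = g s"
proof -
  have rat: "f r = g r" if "r \<in> \<rat>" "0 \<le> r" for r
    using assms(3)[of "to_nat_on \<rat> r"] that(2) from_nat_into_to_nat_on[OF countable_rat that(1)] by simp
  have "\<exists>r\<in>\<rat>. s < r \<and> r < s + 1 / Suc n" for n
    by (rule Rats_dense_in_real) simp
  then obtain r where r: "\<And>n. r n \<in> \<rat>" "\<And>n. s < r n" "\<And>n. r n < s + 1 / Suc n" by metis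
  have rs: "r \<longlonglongrightarrow> s"
  proof (rule tendsto_sandwich[OF _ _ tendsto_const])
    show "(\<lambda>n. s + 1 / real (Suc n)) \<longlonglongrightarrow> s"
      using tendsto_add[OF tendsto_const LIMSEQ_inverse_real_of_nat, of s] by (simp add: inverse_eq_divide)
  qed (use r in \<open>auto intro!: always_eventually less_imp_le simp del: of_nat_Suc\<close>)
  have lim: "(\<lambda>n. h (r n)) \<longlonglongrightarrow> h s" if "continuous_on {0..} h" for h :: "real \<Rightarrow> real"
  proof -
    have "0 \<le> r n" for n using r(2)[of n] assms(4) by simp
    then show ?thesis using that rs assms(4) unfolding continuous_on_sequentially by (auto simp: o_def)
  qed
  have "f (r n) = g (r n)" for n using rat[OF r(1)[of n]] r(2)[of n] assms(4) by simp
  then show ?thesis using LIMSEQ_unique[OF lim[OF assms(1)]] lim[OF assms(2)] by simp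
qed

text \<open>The derivatives of (1 + s)^(-1/2): the lower bound in \<open>base\<close> itself belongs
  to the class and witnesses that it is nonempty.\<close>

lemma tower_powr_half: "tower (\<lambda>n s. pochhammer (1 / 2) n * (1 + s) powr (- 1 / 2 - real n))"
  unfolding tower_def deriv_nonneg_def
proof (intro allI conjI impI)
  fix n and s :: real assume s: "0 \<le> s"
  have "((\<lambda>s. pochhammer (1 / 2) n * (1 + s) powr (- 1 / 2 - real n)) has_real_derivative
      pochhammer (1 / 2) n * ((- 1 / 2 - real n) * (1 + s) powr (- 1 / 2 - real n - 1))) (at s within {0..})"
    using s by (auto intro!: derivative_eq_intros)
  also have "pochhammer (1 / 2) n * ((- 1 / 2 - real n) * (1 + s) powr (- 1 / 2 - real n - 1)) =
     - (pochhammer (1 / 2) (Suc n) * (1 + s) powr (- 1 / 2 - real (Suc n)))"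
    by (simp add: pochhammer_Suc algebra_simps)
  finally show "((\<lambda>s. pochhammer (1 / 2) n * (1 + s) powr (- 1 / 2 - real n)) has_real_derivative
     - (pochhammer (1 / 2) (Suc n) * (1 + s) powr (- 1 / 2 - real (Suc n)))) (at s within {0..})" .
next
  fix n s show "0 \<le> pochhammer (1 / 2 :: real) n * (1 + s) powr (- 1 / 2 - real n)"
    using pochhammer_nonneg[of "1 / 2 :: real" n] by simp
qed

context riesz
begin

text \<open>An integrable majorant of the J integrand for functions bounded by min(1, l^(-b));
  convergence at infinity needs b > \<open>sg\<close>. The value b = 1 serves first derivatives, b =
  1 / 2 the lower bound for g, and a third value the decay of the fixed point.\<close>

definition env :: "real \<Rightarrow> real \<Rightarrow> real" where
  "env b l = l powr (sg - 1) * (if l < 1 then 1 else l powr (- b))"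

lemma env_integrable:
  assumes "sg < b" shows "set_integrable lborel {0<..} (env b)"
proof -
  have "((\<lambda>l. l powr (sg - 1 - b)) has_integral - (1 powr (sg - 1 - b + 1)) / (sg - 1 - b + 1)) {1..}"
    using assms by (intro has_integral_powr_to_inf) auto
  then have "set_integrable lborel {1..} (\<lambda>l. l powr (sg - 1 - b))"
    by (intro set_integrable_of_has_integral) (auto intro!: continuous_intros)
  then have "set_integrable lborel {1..} (env b)"
    by (rule set_integrable_cong[THEN iffD1, rotated 3]) (auto simp: env_def simp flip: powr_add)
  moreover have "set_integrable lborel {0<..<1} (env b)"
    using powr_integral_0(1)[OF sg(1), of 1]
    by (rule set_integrable_cong[THEN iffD1, rotated 3]) (auto simp: env_def)
  ultimately have "set_integrable lborel ({0<..<1} \<union> {1..}) (env b)"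
    by (intro set_integrable_Un) auto
  also have "{0<..<1} \<union> {1..} = {0::real<..}" by auto
  finally show ?thesis .
qed

lemma base_1_env:
  assumes "base H" "0 < l" shows "l powr (sg - 1) * H 1 l \<le> env 1 l"
proof -
  have T: "tower H" "H 0 0 = 1" "H 1 0 = 1 / 2" using assms by (auto simp: base_def)
  have "H 1 l \<le> (if l < 1 then 1 else l powr - 1)"
    using tower_le0[OF T(1), of l 1] tower_decay[OF T(1) assms(2), of 0] T assms(2)
    by (auto simp: powr_minus field_simps)
  then show ?thesis unfolding env_def by (rule mult_left_mono) simp
qed

definition jb :: real where "jb = (LINT l:{0<..}|lborel. env 1 l)"

lemma J1_integrable:
  assumes "tower H" "0 \<le> s" shows "set_integrable lborel {0<..} (\<lambda>l. l powr (sg - 1) * H (Suc n) (s + l))"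
  using J_integrable[OF tower_shift[OF assms(1)] tower_powr_integral(1)[OF assms(1) sg(1,3) zero_less_one order_refl order_refl] assms(2)] .

lemma base_J1_le:
  assumes "base H" "0 \<le> s" shows "J (H 1) s \<le> jb"
proof -
  have T: "tower H" using assms by (simp add: base_def)
  have "J (H 1) s \<le> J (H 1) 0" using tower_le0[OF tower_J_Suc[OF T] assms(2), of 0] by simp
  also have "J (H 1) 0 \<le> jb"
    unfolding J_def jb_def
    by (rule set_integral_mono) (use J1_integrable[OF T, of 0 0] env_integrable[of 1] sg base_1_env[OF assms(1)] in auto)
  finally show ?thesis .
qed

lemma base_Z_le:
  assumes "base H" "0 \<le> s" shows "Z H 0 s \<le> mu 1 * jb"
proof -
  have T: "tower H" using assms by (simp add: base_def)
  have "Z H 0 s \<le> Z H 0 0" by (rule tower_le0[OF tower_Z[OF T] assms(2)])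
  also have "\<dots> \<le> mu 1 * jb" unfolding Z_0 using base_J1_le[OF assms(1), of 0] mu_pos[of 1] by simp
  finally show ?thesis .
qed

text \<open>Convergence of first derivatives suffices, because \<open>W\<close> is built from
  \<open>H 1\<close>. The class has the common majorant \<open>env 1\<close>, so dominated
  convergence passes through J, Z, P and finally the integral of Q.\<close>

lemma R_continuous:
  assumes H: "\<And>k. base (H k)" and L: "base L" and lim: "\<And>s. 0 \<le> s \<Longrightarrow> (\<lambda>k. H k 1 s) \<longlonglongrightarrow> L 1 s" and s: "0 \<le> s"
  shows "(\<lambda>k. R (H k) s) \<longlonglongrightarrow> R L s"
proof -
  note TH = base_tower[OF H] and TL = base_tower[OF L]
  have limJ: "(\<lambda>k. J (H k 1) s) \<longlonglongrightarrow> J (L 1) s" if s: "0 \<le> s" for s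
    unfolding J_def
  proof (rule set_integral_tendsto)
    have "continuous_on {0<..} (\<lambda>l. l powr (sg - 1) * h (s + l))" if "continuous_on {0..} h" for h
      using s by (intro continuous_intros continuous_on_compose2[OF that]) auto
    then show "continuous_on {0<..} (\<lambda>l. l powr (sg - 1) * H k 1 (s + l))" "continuous_on {0<..} (\<lambda>l. l powr (sg - 1) * L 1 (s + l))" for k
      using tower_continuous TH TL by auto
    show "set_integrable lborel {0<..} (env 1)" using env_integrable[of 1] sg by simp
    fix l :: real assume "l \<in> {0<..}"
    then have l: "0 < l" by simp
    show "(\<lambda>k. l powr (sg - 1) * H k 1 (s + l)) \<longlonglongrightarrow> l powr (sg - 1) * L 1 (s + l)"
      using s l by (intro tendsto_intros lim) auto
    show "\<bar>l powr (sg - 1) * H k 1 (s + l)\<bar> \<le> env 1 l" for k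
    proof -
      have "l powr (sg - 1) * H k 1 (s + l) \<le> l powr (sg - 1) * H k 1 l"
        using l s by (intro mult_left_mono tower_antimono[OF TH]) auto
      also have "\<dots> \<le> env 1 l" by (rule base_1_env[OF H l])
      finally show ?thesis using l s tower_nonneg[OF TH, of "s + l" k 1] by simp
    qed
  qed simp
  have jb: "0 \<le> jb" using base_J1_le[OF L, of 0] tower_nonneg[OF tower_J_Suc[OF TL], of 0 0] by simp
  have limS: "(\<lambda>k. scal w (u k) s) \<longlonglongrightarrow> scal w v s"
    if "0 \<le> s" and u: "\<And>s. 0 \<le> s \<Longrightarrow> (\<lambda>k. u k s) \<longlonglongrightarrow> v s" "\<And>k s. 0 \<le> s \<Longrightarrow> 0 \<le> u k s" "\<And>k s. 0 \<le> s \<Longrightarrow> u k s \<le> c"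
      and cont: "\<And>k. continuous_on {0..} (u k)" "continuous_on {0..} v" 
      and w: "continuous_on {0<..<1} w" "\<And>t. t \<in> {0<..<1} \<Longrightarrow> 0 \<le> w t" "set_integrable lborel {0<..<1} w"
    for s c w and u :: "nat \<Rightarrow> real \<Rightarrow> real" and v
    unfolding scal_def
  proof (rule set_integral_tendsto)
    have "continuous_on {0<..<1} (\<lambda>t. w t * f (t * s))" if "continuous_on {0..} f" for f :: "real \<Rightarrow> real"
      using \<open>0 \<le> s\<close> by (intro continuous_intros w continuous_on_compose2[OF that]) auto
    then show "continuous_on {0<..<1} (\<lambda>t. w t * u k (t * s))" "continuous_on {0<..<1} (\<lambda>t. w t * v (t * s))" for k
      using cont by auto
    show "set_integrable lborel {0<..<1} (\<lambda>t. w t * c)" using w(3) by simp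
    fix t :: real assume t: "t \<in> {0<..<1}"
    show "(\<lambda>k. w t * u k (t * s)) \<longlonglongrightarrow> w t * v (t * s)"
      using t \<open>0 \<le> s\<close> by (intro tendsto_intros u(1)) auto
    show "\<bar>w t * u k (t * s)\<bar> \<le> w t * c" for k
      using u(2,3)[of "t * s" k] w(2)[OF t] t \<open>0 \<le> s\<close> by (auto intro!: mult_left_mono)
  qed simp
  have limZ: "(\<lambda>k. Z (H k) 0 s) \<longlonglongrightarrow> Z L 0 s" if "0 \<le> s" for s
    unfolding Z_def
  proof (rule limS[OF that, where c=jb])
    show "(\<lambda>k. J (H k (Suc 0)) s) \<longlonglongrightarrow> J (L (Suc 0)) s" if "0 \<le> s" for s using limJ[OF that] by simp
    show "0 \<le> J (H k (Suc 0)) s" if "0 \<le> s" for k s by (rule tower_nonneg[OF tower_J_Suc[OF TH] that])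
    show "J (H k (Suc 0)) s \<le> jb" if "0 \<le> s" for k s using base_J1_le[OF H that] by simp
    show "continuous_on {0..} (J (H k (Suc 0)))" for k by (rule tower_continuous[OF tower_J_Suc[OF TH]])
    show "continuous_on {0..} (J (L (Suc 0)))" by (rule tower_continuous[OF tower_J_Suc[OF TL]])
  qed (use m_nonneg m_power_integral(1)[of 1] in \<open>auto intro!: continuous_intros m_cont\<close>)
  have limP: "(\<lambda>k. P (H k) 0 s) \<longlonglongrightarrow> P L 0 s" if "0 \<le> s" for s
    unfolding P_def
    by (rule limS[OF that, where c="mu 1 * jb"])
      (use limZ tower_nonneg[OF tower_Z[OF TH]] base_Z_le[OF H] tower_continuous[OF tower_Z[OF TH]]
        tower_continuous[OF tower_Z[OF TL]] one_integrable in auto)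
  have limQ: "(\<lambda>k. Q (H k) s) \<longlonglongrightarrow> Q L s" if "0 \<le> s" for s
    unfolding Q_def E_def W_def
    by (intro tendsto_intros limP limZ that) (use kapW_pos[OF L that] in \<open>auto simp: W_def\<close>)
  have "(\<lambda>k. integral {0..s} (Q (H k))) \<longlonglongrightarrow> integral {0..s} (Q L)"
  proof (rule dominated_convergence(2)[where h="\<lambda>_. 1"])
    show "Q (H k) integrable_on {0..s}" for k
      by (intro integrable_continuous_interval continuous_on_subset[OF cm_continuous[OF cm_Q[OF H]]]) auto
    fix k x assume x: "x \<in> {0..s}"
    have "1 / (2 * (1 + x)) \<le> 1" using x by (simp add: field_simps)
    moreover have "0 \<le> Q (H k) x" "Q (H k) x \<le> 1 / (2 * (1 + x))"
      using Q_nonneg[OF H, of x k] Q_upper[OF H, of x k] x by simp_all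
    ultimately show "norm (Q (H k) x) \<le> 1" unfolding real_norm_def by linarith
  qed (auto intro: limQ)
  then show ?thesis unfolding R_def by (intro tendsto_intros)
qed

theorem fixed_point_exists: "\<exists>H. base H \<and> (\<forall>s\<ge>0. H 1 s = Q H s * H 0 s)"
proof -
  \<comment> \<open>The sign-adjusted derivatives at 0 of (1 + s)^(-1/2), which the bounds have to
    admit.\<close>
  define lo :: "nat \<Rightarrow> real" where "lo n = pochhammer (1 / 2) n" for n
  have lo3: "lo n \<le> 3" if "n \<le> 2" for n
  proof -
    have "n = 0 \<or> n = 1 \<or> n = 2" using that by auto
    then show ?thesis by (auto simp: lo_def numeral_2_eq_2 pochhammer_Suc)
  qed
  from invariant_bounds[of lo, OF lo3] obtain C where loC: "\<And>n. lo n \<le> C n"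
    and inv: "\<And>H K n. base H \<Longrightarrow> (\<And>n. H n 0 \<le> C n) \<Longrightarrow> tower K \<Longrightarrow> K 0 = R H \<Longrightarrow> K n 0 \<le> C n" by blast
  define good where "good H \<longleftrightarrow> base H \<and> (\<forall>n. H n 0 \<le> C n)" for H
  define D where "D = {H 0 | H. good H}"
  have inD: "H 0 \<in> D" if "good H" for H using that unfolding D_def by blast
  \<comment> \<open>Members of \<open>D\<close> are bare functions. A derivative sequence is chosen
    for each; on the half-line it is determined by \<open>g\<close>.\<close>
  define tow where "tow g = (SOME H. good H \<and> H 0 = g)" for g
  have tow: "good (tow g)" "tow g 0 = g" if "g \<in> D" for g
    using someI_ex[of "\<lambda>H. good H \<and> H 0 = g"] that unfolding tow_def D_def by blast+
  have tb: "base (tow g)" "tower (tow g)" "tow g n 0 \<le> C n" if "g \<in> D" for g n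
    using tow(1)[OF that] base_tower unfolding good_def by auto
  have D01: "0 \<le> g s \<and> g s \<le> 1" if "g \<in> D" "0 \<le> s" for g s
    using tower_nonneg[OF tb(2)[OF that(1)] that(2), of 0] tower_le0[OF tb(2)[OF that(1)] that(2), of 0] tow(2)[OF that(1)] tb(1)[OF that(1)]
    by (simp add: base_def)
  have lip: "\<bar>g x - g y\<bar> \<le> \<bar>x - y\<bar>" if "g \<in> D" "0 \<le> x" "0 \<le> y" for g x y
  proof -
    have "tow g (Suc 0) 0 = 1 / 2" using tb(1)[OF that(1)] by (simp add: base_def)
    with tower_lipschitz[OF tb(2)[OF that(1)] that(2,3), of 0] have "\<bar>g x - g y\<bar> \<le> 1 / 2 * \<bar>x - y\<bar>"
      unfolding tow(2)[OF that(1)] by simp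
    also have "\<dots> \<le> \<bar>x - y\<bar>" by simp
    finally show ?thesis .
  qed
  have limit_good: "\<exists>L. good L \<and> L 0 = l \<and> (\<forall>n s. 0 \<le> s \<longrightarrow> (\<lambda>k. H k n s) \<longlonglongrightarrow> L n s)"
    if H: "\<And>k. good (H k)" and lim: "\<And>s. 0 \<le> s \<Longrightarrow> (\<lambda>k. H k 0 s) \<longlonglongrightarrow> l s" for H l
  proof -
    have bH: "\<And>k. base (H k)" "\<And>k n. H k n 0 \<le> C n" using H by (auto simp: good_def)
    from tower_limit[of H C l] obtain L where L: "tower L" "L 0 = l" "\<And>n s. 0 \<le> s \<Longrightarrow> (\<lambda>k. H k n s) \<longlonglongrightarrow> L n s"
      using bH lim base_tower by blast
    have b: "H k 0 0 = 1" "H k 1 0 = 1 / 2" for k using bH(1)[of k] by (simp_all only: base_def)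
    have "L 0 0 = 1" "L 1 0 = 1 / 2"
      using L(3)[OF order_refl, of 0] L(3)[OF order_refl, of 1] unfolding b LIMSEQ_const_iff by simp_all
    moreover have "L 2 0 \<le> 3"
      by (rule LIMSEQ_le_const2[OF L(3)[of 0 2]]) (use bH in \<open>auto simp: base_def\<close>)
    moreover have "1 / sqrt (1 + s) \<le> L 0 s" if "0 \<le> s" for s
      by (rule LIMSEQ_le_const[OF L(3)[OF that, of 0]]) (use bH that in \<open>auto simp: base_def\<close>)
    moreover have "L n 0 \<le> C n" for n
      by (rule LIMSEQ_le_const2[OF L(3)[of 0 n]]) (use bH in auto)
    ultimately have "good L" using L(1) unfolding good_def base_def by blast
    with L show ?thesis by blast
  qed
  define q where "q i = \<bar>from_nat_into (\<rat> :: real set) i\<bar>" for i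
  have "\<exists>g\<in>D. \<forall>i. R (tow g) (q i) = g (q i)"
  proof (rule pointwise_fixed_point[where S="{0..}"])
    let ?T = "\<lambda>n s. pochhammer (1 / 2) n * (1 + s) powr (- 1 / 2 - real n)"
    have sq: "(1 + s) powr (- 1 / 2) = 1 / sqrt (1 + s)" if "0 \<le> s" for s :: real
      using that powr_minus_divide[of "1 + s" "1 / 2"] by (simp add: powr_half_sqrt)
    have "base ?T"
      using tower_powr_half sq lo3[of 2] by (simp add: base_def lo_def)
    then have "good ?T" using loC by (simp add: good_def lo_def)
    from inD[OF this] show "D \<noteq> {}" by blast
  next
    fix f g t assume fg: "f \<in> D" "g \<in> D" and t: "0 \<le> t" "t \<le> (1::real)"
    let ?F = "tow f" and ?G = "tow g"
    let ?H = "\<lambda>n s. t * ?F n s + (1 - t) * ?G n s"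
    have conv: "t * x + (1 - t) * y \<le> b" if "x \<le> b" "y \<le> b" for x y b :: real
      using convex_bound_le[OF that, of t "1 - t"] t by simp
    have conv': "b \<le> t * x + (1 - t) * y" if "b \<le> x" "b \<le> y" for x y b :: real
      using conv[of "- x" "- b" "- y"] that by simp
    have "tower ?H"
      unfolding tower_def deriv_nonneg_def
    proof (intro allI conjI impI)
      fix n and s :: real assume s: "0 \<le> s"
      show "(?H n has_real_derivative - ?H (Suc n) s) (at s within {0..})"
        using DERIV_add[OF DERIV_cmult[OF deriv_nonnegD[OF tower_deriv[OF tb(2)[OF fg(1)], of n] s], of t]
           DERIV_cmult[OF deriv_nonnegD[OF tower_deriv[OF tb(2)[OF fg(2)], of n] s], of "1 - t"]]
        by simp
      show "0 \<le> ?H n s" using t tower_nonneg[OF tb(2)[OF fg(1)] s] tower_nonneg[OF tb(2)[OF fg(2)] s] by simp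
    qed
    moreover have "1 / sqrt (1 + s) \<le> ?H 0 s" if "0 \<le> s" for s
      by (rule conv') (use tb(1)[OF fg(1)] tb(1)[OF fg(2)] that in \<open>auto simp: base_def\<close>)
    moreover have "?H 2 0 \<le> 3" "?H n 0 \<le> C n" for n
      by (rule conv; use tb[OF fg(1)] tb[OF fg(2)] in \<open>simp add: base_def\<close>)+
    moreover have b: "tow g 0 0 = 1" "tow g 1 0 = 1 / 2" if "g \<in> D" for g
      using tb(1)[OF that] by (simp_all only: base_def)
    have "?H 0 0 = 1" "?H 1 0 = 1 / 2"
      unfolding b[OF fg(1)] b[OF fg(2)] by (simp_all add: field_simps)
    with calculation have "good ?H" unfolding good_def base_def by blast
    from inD[OF this] show "(\<lambda>x. t * f x + (1 - t) * g x) \<in> D" by (simp add: tow(2) fg)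
  next
    fix g i assume "g \<in> D"
    then show "g (q i) \<in> {0..1}" using D01[of g "q i"] by (simp add: q_def)
  next
    fix g assume g: "g \<in> D"
    obtain K where K: "tower K" "K 0 = R (tow g)" using cm_imp_tower[OF cm_R[OF tb(1)[OF g]]] by blast
    have "good K"
      unfolding good_def using R_base[OF tb(1)[OF g] K] inv[OF tb(1)[OF g] tb(3)[OF g] K] by blast
    from inD[OF this] show "R (tow g) \<in> D" by (simp add: K(2))
  next
    show "q i \<in> {0..}" for i by (simp add: q_def)
  next
    fix X :: "nat \<Rightarrow> real \<Rightarrow> real" assume X: "\<And>k. X k \<in> D"
    have X01: "X k (q i) \<in> {0..1}" for k i using D01[OF X, of "q i" k] by (simp add: q_def)
    obtain r l0 where r: "strict_mono r" and "\<And>i. l0 i \<in> {0..1}" and l0: "\<And>i. (\<lambda>k. X (r k) (q i)) \<longlonglongrightarrow> l0 i"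
      by (rule unit_cube_subseq[of "\<lambda>k i. X k (q i)", OF X01]) (rule that)
    \<comment> \<open>The Lipschitz bound is common to all members, so convergence spreads from the
      nonnegative rationals to the half-line.\<close>
    have conv: "convergent (\<lambda>k. X (r k) s)" if s: "0 \<le> s" for s
      unfolding Cauchy_convergent_iff[symmetric]
    proof (rule CauchyI)
      fix e :: real assume e: "0 < e"
      obtain p where p: "p \<in> \<rat>" "s < p" "p < s + e / 4" using Rats_dense_in_real[of s "s + e / 4"] e by auto
      define i where "i = to_nat_on \<rat> p"
      have qi: "q i = p" using p s from_nat_into_to_nat_on[OF countable_rat p(1)] by (simp add: q_def i_def)
      have "Cauchy (\<lambda>k. X (r k) p)" using LIMSEQ_imp_Cauchy[OF l0[of i]] qi by simp
      then obtain M where M: "\<And>m n. m \<ge> M \<Longrightarrow> n \<ge> M \<Longrightarrow> norm (X (r m) p - X (r n) p) < e / 2"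
        using CauchyD[of "\<lambda>k. X (r k) p" "e / 2"] e by auto
      have near: "\<bar>X (r k) s - X (r k) p\<bar> \<le> e / 4" for k
        using lip[OF X, of s p "r k"] s p by simp
      show "\<exists>M. \<forall>m\<ge>M. \<forall>n\<ge>M. norm (X (r m) s - X (r n) s) < e"
      proof (intro exI[of _ M] allI impI)
        fix j k assume "M \<le> j" "M \<le> k"
        then show "norm (X (r j) s - X (r k) s) < e"
          using M[of j k] near[of j] near[of k] unfolding real_norm_def by linarith
      qed
    qed
    define l where "l s = lim (\<lambda>k. X (r k) s)" for s
    have lim: "(\<lambda>k. X (r k) s) \<longlonglongrightarrow> l s" if "0 \<le> s" for s
      using conv[OF that] by (simp add: l_def convergent_LIMSEQ_iff)
    from limit_good[of "\<lambda>k. tow (X (r k))" l] obtain L where "good L" "L 0 = l"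
      using tow X lim by auto
    with inD have "l \<in> D" by blast
    with r lim show "\<exists>l\<in>D. \<exists>r::nat \<Rightarrow> nat. strict_mono r \<and> (\<forall>x\<in>{0..}. (\<lambda>k. X (r k) x) \<longlonglongrightarrow> l x)" by auto
  next
    fix X l and s :: real assume X: "\<And>k. X k \<in> D" and l: "l \<in> D" and lim: "\<And>s. s \<in> {0..} \<Longrightarrow> (\<lambda>k::nat. X k s) \<longlonglongrightarrow> l s"
      and s: "s \<in> {0..}"
    from limit_good[of "\<lambda>k. tow (X k)" l] obtain L where L: "good L" "L 0 = l" "\<And>n s. 0 \<le> s \<Longrightarrow> (\<lambda>k. tow (X k) n s) \<longlonglongrightarrow> L n s"
      using tow X lim by auto
    have "L 1 s = tow l 1 s" if "0 \<le> s" for s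
      by (rule tower_unique[OF _ tb(2)[OF l] _ that]) (use L tow(2)[OF l] base_tower in \<open>auto simp: good_def\<close>)
    then show "(\<lambda>k. R (tow (X k)) s) \<longlonglongrightarrow> R (tow l) s"
      using R_continuous[OF tb(1)[OF X] tb(1)[OF l]] L(3)[of _ 1] s by auto
  qed
  then obtain g where g: "g \<in> D" "\<And>i. R (tow g) (q i) = g (q i)" by blast
  let ?H = "tow g"
  \<comment> \<open>Equality at the nonnegative rationals extends by continuity; differentiating it
    then gives the equation for \<open>H 1\<close>.\<close>
  have eq: "R ?H s = ?H 0 s" if "0 \<le> s" for s
    by (rule eq_on_nonneg_of_rats[OF _ _ _ that])
      (use g(2) tow(2)[OF g(1)] deriv_nonneg_continuous[OF R_deriv[OF tb(1)[OF g(1)]]] tower_continuous[OF tb(2)[OF g(1)], of 0] in \<open>auto simp: q_def\<close>)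
  have "deriv_nonneg (?H 0) (\<lambda>s. - (Q ?H s * R ?H s))"
    by (rule deriv_nonneg_cong[OF R_deriv[OF tb(1)[OF g(1)]]]) (use eq in auto)
  from deriv_nonneg_unique[OF tower_deriv[OF tb(2)[OF g(1)], of 0] this]
  have "?H 1 s = Q ?H s * ?H 0 s" if "0 \<le> s" for s using eq that by simp
  with tb(1)[OF g(1)] show ?thesis by blast
qed

end

section \<open>Decay of the fixed point\<close>

context riesz
begin

definition ode :: "(nat \<Rightarrow> real \<Rightarrow> real) \<Rightarrow> bool" where
  "ode H \<longleftrightarrow> base H \<and> (\<forall>s\<ge>0. H 1 s = Q H s * H 0 s)"

lemma ode_base: "ode H \<Longrightarrow> base H" and ode_tower: "ode H \<Longrightarrow> tower H" and ode_eq: "ode H \<Longrightarrow> 0 \<le> s \<Longrightarrow> H 1 s = Q H s * H 0 s"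
  by (auto simp: ode_def base_def)

text \<open>Since W is nondecreasing, W \<ge> r kappa holds from \<open>S\<close> on. There Q \<ge>
  b / x with b = r / (2 (1 + r)), so \<open>H 0 x * x powr b\<close> is nonincreasing.\<close>

lemma ode_decay:
  assumes H: "ode H" and S: "0 < S" and r: "0 < r" "r * kap H \<le> W H S" and s: "S \<le> s"
  shows "H 0 s \<le> (S / s) powr (r / (2 * (1 + r)))"
proof -
  define b where "b = r / (2 * (1 + r))"
  note T = ode_tower[OF H]
  have k: "0 < kap H" using base_kap_pos[OF ode_base[OF H]] .
  have Q: "b / x \<le> Q H x" if "S \<le> x" for x
  proof -
    have x: "0 < x" using that S by simp
    have w: "r * kap H \<le> W H x" using r(2) W_mono[OF T, of S x] S that by simp
    have pos: "0 < kap H + W H x" using w k mult_pos_pos[OF r(1) k] by linarith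
    have "r * (kap H + W H x) \<le> W H x * (1 + r)" using w by (simp add: algebra_simps)
    then have "r / (1 + r) \<le> W H x / (kap H + W H x)" using pos r by (simp add: field_simps)
    then have "r / (1 + r) / (2 * x) \<le> W H x / (kap H + W H x) / (2 * x)" using x by (intro divide_right_mono) auto
    also have "\<dots> = Q H x"
    proof -
      have "x * p / d / (2 * x) = p * (1 / (2 * d))" for p d using x by simp
      from this[of "P H 0 x" "kap H + W H x"] show ?thesis by (simp only: Q_def E_def flip: W_def)
    qed
    finally show ?thesis by (simp add: b_def field_simps)
  qed
  have "H 0 s * s powr b \<le> H 0 S * S powr b"
  proof (rule DERIV_nonpos_imp_nonincreasing[OF s])
    fix x assume x: "S \<le> x" "x \<le> s"
    then have x0: "0 < x" using S by simp
    have "((\<lambda>x. H 0 x * x powr b) has_real_derivative - H 1 x * x powr b + H 0 x * (b * x powr (b - 1))) (at x)"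
      using deriv_nonneg_at[OF tower_deriv[OF T, of 0] x0] x0 by (auto intro!: derivative_eq_intros)
    moreover have "- H 1 x * x powr b + H 0 x * (b * x powr (b - 1)) = (H 0 x * x powr b) * (b / x - Q H x)"
      using x0 ode_eq[OF H, of x] by (simp add: powr_diff algebra_simps)
    moreover have "\<dots> \<le> 0"
      using Q[OF x(1)] tower_nonneg[OF T, of x 0] x0 by (intro mult_nonneg_nonpos) auto
    ultimately show "\<exists>y. ((\<lambda>x. H 0 x * x powr b) has_real_derivative y) (at x) \<and> y \<le> 0" by auto
  qed
  also have "\<dots> \<le> 1 * S powr b"
    using tower_le0[OF T, of S 0] ode_base[OF H] S by (intro mult_right_mono) (auto simp: base_def)
  finally show ?thesis using S s unfolding b_def[symmetric] by (simp add: powr_divide field_simps)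
qed

text \<open>Near 0, P is at least kappa - s p \<ge> kappa / 2, and monotonicity of W carries
  positivity on to 1. This starts the first, weak decay estimate.\<close>

lemma ode_W_pos:
  assumes H: "ode H" shows "0 < W H 1"
proof -
  note T = ode_tower[OF H]
  have k: "0 < kap H" using base_kap_pos[OF ode_base[OF H]] .
  define p where "p = P H 1 0"
  have p: "0 \<le> p" using tower_nonneg[OF tower_P[OF T]] by (simp add: p_def)
  define s where "s = min 1 (kap H / (2 * (p + 1)))"
  have s: "0 < s" "s \<le> 1" using k p by (auto simp: s_def)
  have "s * p \<le> kap H / (2 * (p + 1)) * p" using p by (intro mult_right_mono) (auto simp: s_def)
  also have "\<dots> \<le> kap H / 2" using k p by (simp add: field_simps)
  finally have "s * p \<le> kap H / 2" .
  then have "0 < P H 0 s"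
    using tower_diff_bounds(2)[OF tower_P[OF T] order_refl, of s 0] s P_0[of H 0] k by (simp add: p_def)
  then have "0 < W H s" using s by (simp add: W_def)
  also have "\<dots> \<le> W H 1" by (rule W_mono[OF T]) (use s in auto)
  finally show ?thesis .
qed

lemma ode_tendsto_0: assumes H: "ode H" shows "(H 0 \<longlongrightarrow> 0) at_top"
proof -
  have k: "0 < kap H" using base_kap_pos[OF ode_base[OF H]] .
  define r where "r = W H 1 / kap H"
  have r: "0 < r" "r * kap H \<le> W H 1" using k ode_W_pos[OF H] by (auto simp: r_def)
  have "((\<lambda>s. (1 / s) powr (r / (2 * (1 + r)))) \<longlongrightarrow> 0) at_top"
  proof -
    have "((\<lambda>s::real. s powr - (r / (2 * (1 + r)))) \<longlongrightarrow> 0) at_top"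
      using r by (intro tendsto_neg_powr filterlim_ident) auto
    then show ?thesis
      by (rule Lim_transform_eventually) (auto intro!: eventually_mono[OF eventually_gt_at_top[of 0]] simp: powr_divide powr_minus_divide)
  qed
  then show ?thesis
  proof (rule Lim_null_comparison[rotated])
    show "\<forall>\<^sub>F s in at_top. norm (H 0 s) \<le> (1 / s) powr (r / (2 * (1 + r)))"
      using eventually_ge_at_top[of 1]
    proof eventually_elim
      case (elim s)
      then show ?case using ode_decay[OF H zero_less_one r elim] tower_nonneg[OF ode_tower[OF H], of s 0] by simp
    qed
  qed
qed

lemma env_half_integral: "(LINT l:{0<..}|lborel. env (1 / 2) l) = 1 / (sg * a)"
proof -
  have i: "set_integrable lborel {0<..} (env (1 / 2))" by (rule env_integrable) (use sg in auto)
  have s1: "set_integrable lborel {1..} (env (1 / 2))" by (rule set_integrable_subset[OF i]) auto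
  have s0: "set_integrable lborel {0<..<1} (env (1 / 2))" by (rule set_integrable_subset[OF i]) auto
  have "((\<lambda>l. l powr (sg - 3 / 2)) has_integral - (1 powr (sg - 3 / 2 + 1)) / (sg - 3 / 2 + 1)) {1..}"
    using sg by (intro has_integral_powr_to_inf) auto
  also have "- (1 powr (sg - 3 / 2 + 1)) / (sg - 3 / 2 + 1) = 1 / (1 / 2 - sg)"
    using sg by (simp add: field_simps)
  finally have "(env (1 / 2) has_integral 1 / (1 / 2 - sg)) {1..}"
    by (rule has_integral_eq[rotated]) (auto simp: env_def simp flip: powr_add)
  then have i1: "(LINT l:{1..}|lborel. env (1 / 2) l) = 1 / (1 / 2 - sg)"
    unfolding set_borel_integral_eq_integral(2)[OF s1] by (rule integral_unique)
  have "((\<lambda>l. l powr (sg - 1)) has_integral 1 powr (sg - 1 + 1) / (sg - 1 + 1)) {0<..<1}"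
    using has_integral_powr_from_0[of "sg - 1" 1] sg by (simp add: has_integral_Icc_iff_Ioo)
  then have "(env (1 / 2) has_integral 1 / sg) {0<..<1}"
    by (rule has_integral_eq[rotated, THEN has_integral_eq_rhs]) (auto simp: env_def)
  then have i0: "(LINT l:{0<..<1}|lborel. env (1 / 2) l) = 1 / sg"
    unfolding set_borel_integral_eq_integral(2)[OF s0] by (rule integral_unique)
  have U: "{0<..} = {0<..<1} \<union> {1::real..}" by auto
  have "(LINT l:{0<..}|lborel. env (1 / 2) l) = (LINT l:{0<..<1}|lborel. env (1 / 2) l) + (LINT l:{1..}|lborel. env (1 / 2) l)"
    unfolding U by (rule set_integral_Un[OF _ s0 s1]) auto
  also have "\<dots> = 1 / (sg * a)"
  proof -
    have "sg \<noteq> 0" "1 / 2 - sg \<noteq> 0" and aeq: "a = 2 * (1 / 2 - sg)" using sg by auto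
    moreover have "1 / x + 1 / y = (x + y) / (x * y)" if "x \<noteq> 0" "y \<noteq> 0" for x y :: real
      using that by (simp add: add_divide_distrib)
    ultimately have "1 / sg + 1 / (1 / 2 - sg) = (sg + (1 / 2 - sg)) / (sg * (1 / 2 - sg))" by blast
    also have "\<dots> = 1 / (sg * (2 * (1 / 2 - sg)))" by simp
    finally have "1 / sg + 1 / (1 / 2 - sg) = 1 / (sg * a)" unfolding aeq[symmetric] .
    then show ?thesis unfolding i0 i1 .
  qed
  finally show ?thesis .
qed

definition JN :: "real \<Rightarrow> (real \<Rightarrow> real) \<Rightarrow> real \<Rightarrow> real" where
  "JN N u s = (LINT l:{0<..<N}|lborel. l powr (sg - 1) * u (s + l))"

lemma JN_integrable:
  assumes "tower H" "0 \<le> s" "0 \<le> N"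
  shows "set_integrable lborel {0<..<N} (\<lambda>l. l powr (sg - 1) * H n (s + l))"
proof (rule set_integrable_dominated)
  show "set_integrable lborel {0<..<N} (\<lambda>l. l powr (sg - 1) * H n 0)"
    using powr_integral_0(1)[OF sg(1) assms(3)] by simp
  show "continuous_on {0<..<N} (\<lambda>l. l powr (sg - 1) * H n (s + l))"
    using assms(2) by (intro continuous_intros continuous_on_compose2[OF tower_continuous[OF assms(1)]]) auto
  show "\<bar>l powr (sg - 1) * H n (s + l)\<bar> \<le> l powr (sg - 1) * H n 0" if "l \<in> {0<..<N}" for l
    using that tower_le0[OF assms(1), of "s + l" n] tower_nonneg[OF assms(1), of "s + l" n] assms(2)
    by (auto simp: abs_mult intro!: mult_left_mono)
qed auto

lemma tower_JN:
  assumes "tower H" "0 \<le> N" shows "tower (\<lambda>n. JN N (H n))"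
proof -
  interpret averaging "{0<..<N}" "\<lambda>l. l powr (sg - 1)" "\<lambda>_. 1" "\<lambda>l. l"
    by unfold_locales (auto intro!: continuous_intros)
  have "JN N u = avg {0<..<N} (\<lambda>l. l powr (sg - 1)) (\<lambda>_. 1) (\<lambda>l. l) u" for u
    by (simp add: JN_def avg_def fun_eq_iff)
  then show ?thesis
    using tower_avg[OF assms(1)] JN_integrable[OF assms(1) order_refl assms(2)] by simp
qed

definition VN :: "real \<Rightarrow> (nat \<Rightarrow> real \<Rightarrow> real) \<Rightarrow> nat \<Rightarrow> real \<Rightarrow> real" where
  "VN N H n = scal (\<lambda>t. m t * t ^ n) (JN N (H n))"

lemma tower_VN: "tower H \<Longrightarrow> 0 \<le> N \<Longrightarrow> tower (VN N H)"
  unfolding VN_def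
  by (rule tower_scal[OF tower_JN]) (use m_nonneg m_cont m_power_integral(1)[of 0] in auto)

lemma JN_le_J:
  assumes H: "tower H" and "0 \<le> s" "0 \<le> N" shows "JN N (H (Suc n)) s \<le> J (H (Suc n)) s"
proof -
  let ?f = "\<lambda>A l. indicator A l *\<^sub>R (l powr (sg - 1) * H (Suc n) (s + l))"
  show ?thesis
    unfolding JN_def J_def set_lebesgue_integral_def
  proof (rule integral_mono)
  show "integrable lborel (?f {0<..<N})"
    using JN_integrable[OF assms] by (simp add: set_integrable_def)
  show "integrable lborel (?f {0<..})"
    using J1_integrable[OF assms(1,2)] by (simp add: set_integrable_def)
  fix l show "?f {0<..<N} l \<le> ?f {0<..} l"
    using tower_nonneg[OF H, of "s + l" "Suc n"] assms(2) by (auto simp: indicator_def)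
  qed
qed

text \<open>\<open>V(0)\<close> is not yet known to be finite, hence the cut-off \<open>\<lambda> < N\<close>.\<close>

lemma VN_diff_le_W:
  assumes H: "tower H" and s: "0 \<le> s" and N: "0 \<le> N"
  shows "VN N H 0 0 - VN N H 0 s \<le> W H s"
proof -
  have le: "VN N H 1 s \<le> Z H 0 s" if "0 \<le> s" for s
    unfolding VN_def Z_def scal_def
  proof (rule set_integral_mono)
    have w: "continuous_on {0<..<1} (\<lambda>t. m t * t ^ 1)" "\<And>t. 0 < t \<Longrightarrow> t < 1 \<Longrightarrow> 0 \<le> m t * t ^ 1"
      using m_nonneg by (auto intro!: continuous_intros m_cont)
    show "set_integrable lborel {0<..<1} (\<lambda>t. m t * t ^ 1 * JN N (H 1) (t * s))"
      by (rule scal_integrable[OF tower_JN[OF H N] w m_power_integral(1) that])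
    show "set_integrable lborel {0<..<1} (\<lambda>t. m t * t * t ^ 0 * J (H (Suc 0)) (t * s))"
      using scal_integrable[OF tower_J_Suc[OF H] w m_power_integral(1) that, of 0] by simp
    fix t :: real assume "t \<in> {0<..<1}"
    then show "m t * t ^ 1 * JN N (H 1) (t * s) \<le> m t * t * t ^ 0 * J (H (Suc 0)) (t * s)"
      using JN_le_J[OF H _ N, of "t * s" 0] that m_nonneg[of t] by (simp add: mult_left_mono)
  qed
  have "- (W H s + VN N H 0 s) \<le> - (W H 0 + VN N H 0 0)"
  proof (rule deriv_nonneg_antimono[OF _ _ order_refl s])
    show "deriv_nonneg (\<lambda>s. - (W H s + VN N H 0 s)) (\<lambda>s. - (Z H 0 s + - VN N H (Suc 0) s))"
      unfolding deriv_nonneg_def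
      using DERIV_minus[OF DERIV_add[OF deriv_nonnegD[OF W_deriv[OF H]] deriv_nonnegD[OF tower_deriv[OF tower_VN[OF H N], of 0]]]]
      by blast
  qed (use le in simp)
  then show ?thesis by (simp add: W_def)
qed

text \<open>With the cut-off, J is at most g(s) N^sg / sg, so decay of g at any rate suffices;
  dominated convergence handles the average over \<open>t\<close>.\<close>

lemma VN_tendsto_0:
  assumes H: "ode H" and N: "0 \<le> N"
  shows "(\<lambda>k. VN N H 0 (real k)) \<longlonglongrightarrow> 0"
proof -
  note T = ode_tower[OF H]
  have JNle: "JN N (H 0) y \<le> H 0 y * (N powr sg / sg)" if "0 \<le> y" for y
  proof -
    have "JN N (H 0) y \<le> (LINT l:{0<..<N}|lborel. H 0 y * l powr (sg - 1))"
      unfolding JN_def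
    proof (rule set_integral_mono[OF JN_integrable[OF T that N]])
      show "set_integrable lborel {0<..<N} (\<lambda>l. H 0 y * l powr (sg - 1))"
        using powr_integral_0(1)[OF sg(1) N] by simp
      fix l assume "l \<in> {0<..<N}"
      then show "l powr (sg - 1) * H 0 (y + l) \<le> H 0 y * l powr (sg - 1)"
        using tower_antimono[OF T that, of "y + l" 0] by (simp add: mult.commute mult_left_mono)
    qed
    then show ?thesis using powr_integral_0(2)[OF sg(1) N] by simp
  qed
  have JN0: "0 \<le> JN N (H 0) y" "JN N (H 0) y \<le> JN N (H 0) 0" if "0 \<le> y" for y
    using tower_nonneg[OF tower_JN[OF T N] that, of 0] tower_le0[OF tower_JN[OF T N] that, of 0] by auto
  have lim: "(\<lambda>k. JN N (H 0) (t * real k)) \<longlonglongrightarrow> 0" if "0 < t" for t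
  proof (rule tendsto_sandwich[OF _ _ tendsto_const])
    have "filterlim (\<lambda>k. t * real k) at_top sequentially"
      using that by (intro filterlim_tendsto_pos_mult_at_top[OF tendsto_const] filterlim_real_sequentially)
    from tendsto_mult_right[OF filterlim_compose[OF ode_tendsto_0[OF H] this], of "N powr sg / sg"]
    show "(\<lambda>k. H 0 (t * real k) * (N powr sg / sg)) \<longlonglongrightarrow> 0" by simp
  qed (use that JN0(1) JNle in \<open>auto intro!: always_eventually\<close>)
  have "(\<lambda>k. LINT t:{0<..<1}|lborel. m t * t ^ 0 * JN N (H 0) (t * real k)) \<longlonglongrightarrow> set_lebesgue_integral lborel {0<..<1::real} (\<lambda>_. 0 :: real)"
  proof (rule set_integral_tendsto[where g="\<lambda>_. 0"])
    show "continuous_on {0<..<1} (\<lambda>t. m t * t ^ 0 * JN N (H 0) (t * real k))" for k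
      by (intro continuous_intros m_cont continuous_on_compose2[OF tower_continuous[OF tower_JN[OF T N]]]) auto
    show "set_integrable lborel {0<..<1} (\<lambda>t. m t * t ^ 0 * JN N (H 0) 0)"
      using m_power_integral(1)[of 0] by simp
    fix t :: real assume t: "t \<in> {0<..<1}"
    show "(\<lambda>k. m t * t ^ 0 * JN N (H 0) (t * real k)) \<longlonglongrightarrow> 0"
      using tendsto_mult_right_zero[OF lim] t by simp
    show "\<bar>m t * t ^ 0 * JN N (H 0) (t * real k)\<bar> \<le> m t * t ^ 0 * JN N (H 0) 0" for k
      using JN0[of "t * real k"] m_nonneg[of t] t by (auto simp: abs_mult intro!: mult_left_mono)
  qed auto
  then show ?thesis by (simp add: VN_def scal_def)
qed

text \<open>If \<open>W\<close> stayed below \<open>\<kappa> / a\<close>, then \<open>V(0)\<close> would too, but \<open>g(s) \<ge> (1 + s)\<^sup>-\<^sup>1\<^sup>/\<^sup>2\<close> makes \<open>V(0)\<close> larger.\<close>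

lemma ode_W_large:
  assumes H: "ode H" shows "\<exists>S>0. kap H / a < W H S"
proof (rule ccontr)
  assume "\<not> ?thesis"
  then have Wle: "W H S \<le> kap H / a" if "0 < S" for S using that by force
  note T = ode_tower[OF H]
  let ?I = "\<lambda>k::nat. LINT l:{0<..<real k}|lborel. env (1 / 2) l" and ?w = "\<lambda>l. indicator {0<..} l *\<^sub>R env (1 / 2) l"
    and ?G = "\<lambda>(k::nat) l. indicator {0<..<real k} l *\<^sub>R env (1 / 2) l"
  have bH: "H 0 0 = 1" "H 1 0 = 1 / 2" "\<And>s. 0 \<le> s \<Longrightarrow> 1 / sqrt (1 + s) \<le> H 0 s"
    using ode_base[OF H] unfolding base_def by auto
  have VNle: "VN N H 0 0 \<le> kap H / a" if N: "0 \<le> N" for N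
  proof (rule LIMSEQ_le_const2)
    show "(\<lambda>k. VN N H 0 0 - VN N H 0 (real k)) \<longlonglongrightarrow> VN N H 0 0"
      using tendsto_diff[OF tendsto_const VN_tendsto_0[OF H N]] by simp
    have "VN N H 0 0 - VN N H 0 (real k) \<le> kap H / a" if "1 \<le> k" for k
      using VN_diff_le_W[OF T, of "real k" N] Wle[of "real k"] N that by simp
    then show "\<exists>n0. \<forall>n\<ge>n0. VN N H 0 0 - VN N H 0 (real n) \<le> kap H / a" by blast
  qed
  \<comment> \<open>From 1 + l \<le> 2 max(1, l).\<close>
  have domle: "(1 / sqrt 2) * env (1 / 2) l \<le> l powr (sg - 1) * H 0 l" if l: "0 < l" for l
  proof -
    have "(1 / sqrt 2) * (if l < 1 then 1 else l powr (- (1 / 2))) \<le> 1 / sqrt (1 + l)"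
    proof (cases "l < 1")
      case True
      then show ?thesis using l by (simp add: divide_le_cancel frac_le)
    next
      case False
      then have "sqrt (1 + l) \<le> sqrt 2 * sqrt l" by (simp flip: real_sqrt_mult)
      then have "1 / (sqrt 2 * sqrt l) \<le> 1 / sqrt (1 + l)" using l by (intro divide_left_mono) auto
      then show ?thesis using False l by (simp add: powr_minus_divide powr_half_sqrt)
    qed
    also have "\<dots> \<le> H 0 l" using bH(3)[of l] l by simp
    finally have "l powr (sg - 1) * ((1 / sqrt 2) * (if l < 1 then 1 else l powr (- (1 / 2)))) \<le> l powr (sg - 1) * H 0 l"
      by (rule mult_left_mono) simp
    then show ?thesis by (simp only: env_def mult_ac)
  qed
  have dom0: "0 \<le> env b l" for b l by (simp add: env_def)
  have "mu 0 * ((1 / sqrt 2) * ?I k) \<le> kap H / a" for k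
  proof -
    have "(1 / sqrt 2) * ?I k = (LINT l:{0<..<real k}|lborel. (1 / sqrt 2) * env (1 / 2) l)"
      by simp
    also have "\<dots> \<le> JN (real k) (H 0) 0"
      unfolding JN_def
    proof (rule set_integral_mono)
      show "set_integrable lborel {0<..<real k} (\<lambda>l. (1 / sqrt 2) * env (1 / 2) l)"
        by (intro set_integrable_mult_right impI set_integrable_subset[OF env_integrable]) (use sg in auto)
      show "set_integrable lborel {0<..<real k} (\<lambda>l. l powr (sg - 1) * H 0 (0 + l))"
        by (rule JN_integrable[OF T]) auto
    qed (use domle in auto)
    finally have "mu 0 * ((1 / sqrt 2) * ?I k) \<le> mu 0 * JN (real k) (H 0) 0"
      using mu_pos[of 0] by (intro mult_left_mono) auto
    also have "\<dots> = VN (real k) H 0 0" unfolding VN_def scal_0 mu_def ..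
    also have "\<dots> \<le> kap H / a" by (rule VNle) simp
    finally show ?thesis .
  qed
  moreover have "?I \<longlonglongrightarrow> (LINT l:{0<..}|lborel. env (1 / 2) l)"
    unfolding set_lebesgue_integral_def
  proof (rule integral_dominated_convergence[where w="?w"])
    have i: "set_integrable lborel {0<..} (env (1 / 2))" by (rule env_integrable) (use sg in auto)
    then show "integrable lborel ?w" by (simp add: set_integrable_def)
    then show "?w \<in> borel_measurable lborel" by simp
    have "set_integrable lborel {0<..<real k} (env (1 / 2))" for k
      by (rule set_integrable_subset[OF i]) auto
    then show "(\<lambda>l. ?G k l) \<in> borel_measurable lborel" for k
      unfolding set_integrable_def by (rule borel_measurable_integrable)
    show "AE l in lborel. (\<lambda>k. ?G k l) \<longlonglongrightarrow> ?w l"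
    proof (rule always_eventually, rule allI, rule tendsto_eventually)
      fix l :: real
      obtain K where "l < real K" using reals_Archimedean2 by blast
      then show "\<forall>\<^sub>F k in sequentially. ?G k l = ?w l"
        by (intro eventually_sequentiallyI[of K]) (auto simp: indicator_def)
    qed
    show "AE l in lborel. norm (?G k l) \<le> ?w l" for k
      using dom0 by (auto simp: indicator_def)
  qed
  then have "(\<lambda>k. mu 0 * ((1 / sqrt 2) * ?I k)) \<longlonglongrightarrow> mu 0 * ((1 / sqrt 2) * (1 / (sg * a)))"
    unfolding env_half_integral by (intro tendsto_intros)
  ultimately have "mu 0 * ((1 / sqrt 2) * (1 / (sg * a))) \<le> kap H / a"
    by (intro LIMSEQ_le_const2[of "\<lambda>k. mu 0 * ((1 / sqrt 2) * ?I k)"]) blast+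
  \<comment> \<open>The bathtub estimate for \<open>H 1\<close>, of integral at most 1 and height 1
    / 2; the extremal function is 1 / 2 on (0, 2), hence the cut 2.\<close>
  also have "kap H \<le> mu 0 * (2 powr (sg - 1) / sg)"
  proof -
    have "J (H 1) 0 \<le> 2 powr (sg - 1) * 1 + 1 / 2 * (2 powr sg / sg - 2 powr sg)"
      using J_bound[OF T, of 2 0 1 "1 / 2"] bH by simp
    also have "\<dots> = 2 powr (sg - 1) / sg" by (simp add: powr_diff field_simps)
    finally have "mu 1 * J (H 1) 0 \<le> mu 0 * (2 powr (sg - 1) / sg)"
      using mu_le[of 0 1] mu_pos[of 1] mu_pos[of 0] tower_nonneg[OF tower_J_Suc[OF T], of 0 0] by (intro mult_mono) auto
    then show ?thesis using Z_0[of H 0] by simp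
  qed
  then have "kap H / a \<le> mu 0 * (2 powr (sg - 1) / sg) / a" using a by (intro divide_right_mono) auto
  \<comment> \<open>After cancelling mu 0 / (sg a) only powers of 2 remain, and they contradict sg <
    1 / 2.\<close>
  finally have "1 / sqrt 2 \<le> 2 powr (sg - 1)" using mu_pos[of 0] sg a by (simp add: field_simps)
  moreover have "2 powr (sg - 1) < 2 powr (- (1 / 2))" using sg by (intro powr_less_mono) auto
  moreover have "2 powr (- (1 / 2)) = 1 / sqrt (2::real)" by (simp add: powr_minus_divide powr_half_sqrt)
  ultimately show False by simp
qed

section \<open>The fixed point as a profile with finite potential\<close>

definition V :: "(real \<Rightarrow> real) \<Rightarrow> real \<Rightarrow> real" where
  "V u = scal m (J u)"

theorem profile_exists:
  "\<exists>H \<kappa>. tower H \<and> (\<forall>s\<ge>0. 1 / sqrt (1 + s) \<le> H 0 s) \<and> 0 < \<kappa> \<and> \<kappa> < a * V (H 0) 0 \<and> 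
     J_able (H 0) \<and>
     (\<forall>s\<ge>0. V (H 0) s \<le> V (H 0) 0 \<and> 
        s * H 1 s * (2 * (\<kappa> + V (H 0) 0 - V (H 0) s)) = (V (H 0) 0 - V (H 0) s) * H 0 s)"
proof -
  obtain H where H: "ode H" using fixed_point_exists unfolding ode_def by blast
  note T = ode_tower[OF H]
  have k: "0 < kap H" using base_kap_pos[OF ode_base[OF H]] .
  obtain S where S: "0 < S" "kap H / a < W H S" using ode_W_large[OF H] by blast
  \<comment> \<open>The decay rate for r = 1 / a. It exceeds \<open>sg\<close> because (1 - a) (1 +
    a) < 1, which makes the J integrand of \<open>H 0\<close> integrable.\<close>
  define b where "b = (1 / a) / (2 * (1 + 1 / a))"
  have b: "b = 1 / (2 * (1 + a))" using a by (simp add: b_def field_simps)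
  have "(1 - a) * (1 + a) < 1" using a by (simp add: algebra_simps)
  then have sgb: "sg < b" using a unfolding b sg_def by (simp add: field_simps)
  have b0: "0 < b" using sg sgb by simp
  have dec: "H 0 s \<le> (S / s) powr b" if "S \<le> s" for s
    using ode_decay[OF H S(1), of "1 / a" s] S(2) a that unfolding b_def by simp
  have H01: "H 0 l \<le> 1" if "0 \<le> l" for l
    using tower_le0[OF T that, of 0] ode_base[OF H] by (simp add: base_def)
  define c where "c = max 1 (S powr b)"
  have domb: "l powr (sg - 1) * H 0 l \<le> c * env b l" if l: "0 < l" for l
  proof -
    have "H 0 l \<le> c * (if l < 1 then 1 else l powr (- b))"
    proof (cases "l < 1")
      case True
      then show ?thesis using H01[of l] l by (simp add: c_def le_max_iff_disj)
    next
      case False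
      have "H 0 l \<le> (S / l) powr b"
      proof (cases "S \<le> l")
        case True
        then show ?thesis by (rule dec)
      next
        case False
        then have "1 \<le> (S / l) powr b" using l b0 by (intro ge_one_powr_ge_zero) auto
        then show ?thesis using H01[of l] l by simp
      qed
      also have "\<dots> = S powr b * l powr (- b)" using S l by (simp add: powr_divide powr_minus_divide)
      also have "\<dots> \<le> c * l powr (- b)" by (intro mult_right_mono) (auto simp: c_def)
      finally show ?thesis using False by simp
    qed
    then have "l powr (sg - 1) * H 0 l \<le> l powr (sg - 1) * (c * (if l < 1 then 1 else l powr (- b)))"
      by (intro mult_left_mono) auto
    then show ?thesis by (simp add: env_def mult_ac)
  qed
  have int0: "J_able (H 0)"
  proof (rule set_integrable_dominated)
    show "set_integrable lborel {0<..} (\<lambda>l. c * env b l)" using env_integrable[OF sgb] by simp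
    show "continuous_on {0<..} (\<lambda>l. l powr (sg - 1) * H 0 l)"
      by (intro continuous_intros continuous_on_subset[OF tower_continuous[OF T]]) auto
    show "\<bar>l powr (sg - 1) * H 0 l\<bar> \<le> c * env b l" if "l \<in> {0<..}" for l
      using domb[of l] tower_nonneg[OF T, of l 0] that by simp
  qed simp
  have intn: "J_able (H n)" for n
  proof (cases n)
    case 0
    then show ?thesis using int0 by simp
  next
    case (Suc n')
    then show ?thesis using J1_integrable[OF T order_refl, of n'] by simp
  qed
  have TV: "tower (\<lambda>n. scal (\<lambda>t. m t * t ^ n) (J (H n)))"
    by (rule tower_scal[OF tower_J[OF T intn]]) (use m_nonneg m_cont m_power_integral(1)[of 0] in auto)
  have V0: "V (H 0) = scal (\<lambda>t. m t * t ^ 0) (J (H 0))" by (simp add: V_def)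
  have dV: "deriv_nonneg (V (H 0)) (\<lambda>s. - Z H 0 s)"
    using tower_deriv[OF TV, of 0] unfolding V0 Z_def by simp
  have Vpos: "0 \<le> V (H 0) s" if "0 \<le> s" for s using tower_nonneg[OF TV that, of 0] unfolding V0 .
  have WV: "W H s = V (H 0) 0 - V (H 0) s" if "0 \<le> s" for s
  proof -
    have d: "deriv_nonneg (\<lambda>s. W H s + V (H 0) s) (\<lambda>s. 0)"
      unfolding deriv_nonneg_def using DERIV_add[OF deriv_nonnegD[OF W_deriv[OF T]] deriv_nonnegD[OF dV]] by simp
    then have d': "deriv_nonneg (\<lambda>s. - (W H s + V (H 0) s)) (\<lambda>s. 0)"
      unfolding deriv_nonneg_def using DERIV_minus by fastforce
    from deriv_nonneg_antimono[OF d _ order_refl that] deriv_nonneg_antimono[OF d' _ order_refl that]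
    show ?thesis by (simp add: W_def)
  qed
  \<comment> \<open>V is nonnegative, so W(S) = V(0) - V(S) \<le> V(0); the bound that gave the
    decay also gives the sign needed later.\<close>
  have "kap H / a < V (H 0) 0" using S WV[of S] Vpos[of S] by simp
  then have "kap H < a * V (H 0) 0" using a by (simp add: field_simps)
  moreover have "s * H 1 s * (2 * (kap H + V (H 0) 0 - V (H 0) s)) = (V (H 0) 0 - V (H 0) s) * H 0 s" if s: "0 \<le> s" for s
  proof -
    have pos: "0 < kap H + W H s" by (rule kapW_pos[OF ode_base[OF H] s])
    have "s * H 1 s * (2 * (kap H + W H s)) = (s * P H 0 s) * H 0 s * ((2 * (kap H + W H s)) * E H s)"
      unfolding ode_eq[OF H s] Q_def by (simp only: mult_ac)
    also have "(2 * (kap H + W H s)) * E H s = 1" using pos by (simp add: E_def)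
    finally have "s * H 1 s * (2 * (kap H + W H s)) = W H s * H 0 s" by (simp add: W_def)
    then show ?thesis unfolding WV[OF s] by (simp add: algebra_simps)
  qed
  moreover have "V (H 0) s \<le> V (H 0) 0" if "0 \<le> s" for s using WV[OF that] W_nonneg[OF T that] by simp
  ultimately show ?thesis
    using T k int0 ode_base[OF H] unfolding base_def by (intro exI[of _ H] exI[of _ "kap H"]) blast
qed

end

section \<open>The velocity kernel\<close>

context riesz
begin

lemma m_measurable [measurable]: "m \<in> borel_measurable borel"
  unfolding m_def[abs_def] by measurable

lemma nn_m_power: "(\<integral>\<^sup>+t. ennreal (indicator {0<..<1} t * (m t * t ^ n)) \<partial>lborel) = ennreal (mu n)"
proof -
  have "(\<integral>\<^sup>+t. ennreal (indicator {0<..<1} t * (m t * t ^ n)) \<partial>lborel) = ennreal (LINT t|lborel. indicator {0<..<1} t * (m t * t ^ n))"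
  proof (rule nn_integral_eq_integral)
    show "integrable lborel (\<lambda>t. indicator {0<..<1} t * (m t * t ^ n))"
      using m_power_integral(1)[of n] by (simp add: set_integrable_def)
    show "AE t in lborel. 0 \<le> indicator {0<..<1} t * (m t * t ^ n)"
      using m_nonneg by (auto simp: indicator_def)
  qed
  then show ?thesis by (simp add: mu_def set_lebesgue_integral_def)
qed

text \<open>The Beta recursion with a / 2 + 1 + sg = 3 / 2 gives mu n = mu 0 (a/2 + 1)_n / (3/2)_n.
  Duplication of Pochhammer symbols merges (a/2 + 1)_n with ((a + 1)/2)_n, where (a + 1) / 2 = 1 -
  sg, and (3/2)_n with n!.\<close>

lemma mu_coefficient:
  "mu n * (pochhammer (1 - sg) n / fact n) = mu 0 * (pochhammer a (2 * n + 1) / (a * fact (2 * n + 1)))"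
proof (induction n)
  case 0
  then show ?case using a by simp
next
  case (Suc n)
  let ?r = "(a / 2 + 1 + real n) / (3 / 2 + real n) * ((1 - sg + real n) / (real n + 1))" and ?C = "mu 0 * (pochhammer a (2 * n + 1) / (a * fact (2 * n + 1)))"
  have nz: "3 / 2 + real n \<noteq> 0" "real n + 1 \<noteq> 0" by (auto simp: add_eq_0_iff)
  have "a / 2 + 1 + real n \<notin> \<int>\<^sub>\<le>\<^sub>0" using a by (auto elim!: nonpos_Ints_cases)
  then have "(a / 2 + 1 + real n + sg) * mu (Suc n) = (a / 2 + 1 + real n) * mu n"
    unfolding m_power_integral(2) using Beta_plus1_left[of "a / 2 + 1 + real n" sg] by (simp add: add_ac)
  then have muS: "mu (Suc n) = (a / 2 + 1 + real n) / (3 / 2 + real n) * mu n"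
    using nz by (simp add: sg_def field_simps)
  have "mu (Suc n) * (pochhammer (1 - sg) (Suc n) / fact (Suc n))
      = ?r * (mu n * (pochhammer (1 - sg) n / fact n))"
    unfolding muS pochhammer_Suc fact_Suc by (simp add: field_simps)
  also have "\<dots> = ?r * ?C"
    unfolding Suc ..
  also have "?r =
      (a + real (2 * n + 2)) * (a + real (2 * n + 1)) / (real (2 * n + 3) * real (2 * n + 2))"
  proof -
    have "a / 2 + 1 + real n = (a + real (2 * n + 2)) / 2" "3 / 2 + real n = real (2 * n + 3) / 2"
      "1 - sg + real n = (a + real (2 * n + 1)) / 2" "real n + 1 = real (2 * n + 2) / 2"
      by (simp_all add: sg_def field_simps)
    moreover have "(p / 2) / (r / 2) * ((q / 2) / (t / 2)) = p * q / (r * t)" for p q r t :: real by simp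
    ultimately show ?thesis by presburger
  qed
  also have "\<dots> * ?C = 
     mu 0 * ((pochhammer a (2 * n + 1) * (a + real (2 * n + 1)) * (a + real (2 * n + 2))) / (a * (real (2 * n + 3) * (real (2 * n + 2) * fact (2 * n + 1)))))"
    by (simp add: mult_ac)
  also have "pochhammer a (2 * n + 1) * (a + real (2 * n + 1)) * (a + real (2 * n + 2)) = pochhammer a (2 * Suc n + 1)"
    using pochhammer_Suc[of a "2 * n + 2"] pochhammer_Suc[of a "2 * n + 1"] by simp
  also have "real (2 * n + 3) * (real (2 * n + 2) * fact (2 * n + 1)) = fact (2 * Suc n + 1)"
    using fact_Suc[of "2 * n + 2", where 'a=real] fact_Suc[of "2 * n + 1", where 'a=real] by (simp add: add_ac)
  finally show ?case .
qed

text \<open>The elementary form of mu 0 times the Gauss function 2F1((a + 1)/2, a/2 + 1; 3/2;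
  z^2).\<close>

definition hyp :: "real \<Rightarrow> real" where
  "hyp z = mu 0 * ((1 - z) powr (- a) - (1 + z) powr (- a)) / (2 * a * z)"

text \<open>The difference of the two binomial series keeps only the odd terms, doubled.\<close>

lemma hyp_series:
  assumes z: "0 < z" "z < 1"
  shows "(\<lambda>n. mu n * (pochhammer (1 - sg) n / fact n * (z\<^sup>2) ^ n)) sums hyp z"
proof -
  define c where "c n = pochhammer a n / fact n" for n
  let ?d = "\<lambda>n. c n * z ^ n - (- 1) ^ n * (c n * z ^ n)"
  have "(\<lambda>n. ((- a) gchoose n) * (- z) ^ n) sums (1 + - z) powr (- a)"
    by (rule gen_binomial_real) (use z in auto)
  moreover have "((- a) gchoose n) * (- z) ^ n = c n * z ^ n" for n
    unfolding gbinomial_pochhammer c_def power_minus[of z] by (simp flip: power_mult_distrib)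
  ultimately have 1: "(\<lambda>n. c n * z ^ n) sums (1 - z) powr (- a)" by simp
  have "(\<lambda>n. ((- a) gchoose n) * z ^ n) sums (1 + z) powr (- a)"
    by (rule gen_binomial_real) (use z in auto)
  moreover have "((- a) gchoose n) * z ^ n = (- 1) ^ n * (c n * z ^ n)" for n
    unfolding gbinomial_pochhammer c_def by simp
  ultimately have 2: "(\<lambda>n. (- 1) ^ n * (c n * z ^ n)) sums (1 + z) powr (- a)" by simp
  have d: "?d sums ((1 - z) powr (- a) - (1 + z) powr (- a))"
    by (rule sums_diff[OF 1 2])
  have "(\<lambda>n. ?d (2 * n + 1)) sums ((1 - z) powr (- a) - (1 + z) powr (- a))"
  proof (subst sums_mono_reindex)
    show "strict_mono (\<lambda>n::nat. 2 * n + 1)" by (auto intro!: strict_monoI)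
    fix n :: nat assume "n \<notin> range (\<lambda>n. 2 * n + 1)"
    then have "even n" by (metis oddE rangeI)
    then show "?d n = 0" by simp
  qed (rule d)
  from sums_mult[OF this, of "mu 0 / (2 * a * z)"]
  have "(\<lambda>n. mu 0 / (2 * a * z) * (?d (2 * n + 1))) sums hyp z"
    unfolding hyp_def times_divide_eq_left .
  moreover have "mu 0 / (2 * a * z) * (?d (2 * n + 1)) = mu n * (pochhammer (1 - sg) n / fact n * (z\<^sup>2) ^ n)" for n
  proof -
    have "mu 0 / (2 * a * z) * (?d (2 * n + 1)) = mu 0 * (pochhammer a (2 * n + 1) / (a * fact (2 * n + 1))) * (z\<^sup>2) ^ n"
    proof -
      have "(- 1 :: real) ^ (2 * n + 1) = - 1" "z ^ (2 * n + 1) = z * (z\<^sup>2) ^ n" by (simp_all add: power_mult)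
      then show ?thesis using z a by (simp only: c_def) (simp add: field_simps del: fact_Suc)
    qed
    also have "\<dots> = mu n * (pochhammer (1 - sg) n / fact n) * (z\<^sup>2) ^ n" unfolding mu_coefficient ..
    finally show ?thesis by (simp add: mult_ac)
  qed
  ultimately show ?thesis by simp
qed

text \<open>Euler's integral: the coefficients (1 - sg)_n / n! of (1 - t z^2)^(sg - 1) are
  nonnegative, so it may be integrated term by term.\<close>

lemma hyp_integral:
  assumes z: "0 < z" "z < 1"
  shows "(\<integral>\<^sup>+t. ennreal (indicator {0<..<1} t * (m t * (1 - t * z\<^sup>2) powr (sg - 1))) \<partial>lborel) = ennreal (hyp z)"
proof -
  let ?h = "\<lambda>t. indicator {0<..<1} t * (m t * (1 - t * z\<^sup>2) powr (sg - 1))" and ?g = "\<lambda>n t. indicator {0<..<1} t * (m t * t ^ n)"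
  define b where "b n = pochhammer (1 - sg) n / fact n * (z\<^sup>2) ^ n" for n
  have b0: "0 \<le> b n" for n unfolding b_def using sg pochhammer_nonneg[of "1 - sg" n] by simp
  have "(\<integral>\<^sup>+t. ennreal (?h t) \<partial>lborel)
      = (\<integral>\<^sup>+t. (\<Sum>n. ennreal (b n) * ennreal (?g n t)) \<partial>lborel)"
  proof (rule nn_integral_cong)
    fix t :: real
    show "ennreal (?h t) = (\<Sum>n. ennreal (b n) * ennreal (?g n t))"
    proof (cases "t \<in> {0<..<1}")
      case True
      have "t * z\<^sup>2 < 1 * 1" using True z by (intro mult_strict_mono power_less_one_iff[THEN iffD2]) auto
      then have "(\<lambda>n. ((sg - 1) gchoose n) * (- (t * z\<^sup>2)) ^ n) sums (1 + - (t * z\<^sup>2)) powr (sg - 1)"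
        using True z by (intro gen_binomial_real) (auto simp: abs_mult)
      moreover have "((sg - 1) gchoose n) * (- (t * z\<^sup>2)) ^ n = b n * t ^ n" for n
      proof -
        have "((sg - 1) gchoose n) * (- (t * z\<^sup>2)) ^ n = ((- 1) ^ n * (- 1) ^ n) * (pochhammer (1 - sg) n / fact n * (t * z\<^sup>2) ^ n)"
          unfolding gbinomial_pochhammer power_minus[of "t * z\<^sup>2"] by (simp only: minus_diff_eq) simp
        also have "(- 1) ^ n * (- 1) ^ n = (1 :: real)" by (simp flip: power_mult_distrib)
        finally show ?thesis by (simp only: b_def power_mult_distrib) (simp only: mult_ac mult_1_right)
      qed
      ultimately have "(\<lambda>n. b n * t ^ n) sums (1 - t * z\<^sup>2) powr (sg - 1)" by simp
      from sums_mult[OF this, of "m t"] have s: "(\<lambda>n. b n * (m t * t ^ n)) sums (m t * (1 - t * z\<^sup>2) powr (sg - 1))"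
        by (simp add: mult_ac)
      have "(\<Sum>n. ennreal (b n * (m t * t ^ n))) = ennreal (m t * (1 - t * z\<^sup>2) powr (sg - 1))"
        by (rule suminf_ennreal_eq[OF _ s]) (use b0 m_nonneg True in auto)
      then show ?thesis using True b0 m_nonneg by (simp add: ennreal_mult)
    qed simp
  qed
  also have "\<dots> = (\<Sum>n. \<integral>\<^sup>+t. ennreal (b n) * ennreal (?g n t) \<partial>lborel)"
    by (rule nn_integral_suminf) measurable
  also have "\<dots> = (\<Sum>n. ennreal (mu n * b n))"
  proof -
    have "ennreal (b n) * ennreal (mu n) = ennreal (mu n * b n)" for n
      using b0[of n] mu_pos[of n] by (simp add: ennreal_mult mult.commute)
    then show ?thesis by (subst nn_integral_cmult) (auto simp only: nn_m_power, measurable)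
  qed
  also have "\<dots> = ennreal (hyp z)"
  proof (rule suminf_ennreal_eq)
    show "0 \<le> mu n * b n" for n using b0[of n] mu_pos[of n] by simp
    show "(\<lambda>n. mu n * b n) sums hyp z" using hyp_series[OF z] unfolding b_def .
  qed
  finally show ?thesis .
qed

text \<open>The velocity kernel divided by \<open>x\<close>, normalised so that V(x^2) is the
  integral of H 0(v) Nr(x, sqrt v) over v > 0.\<close>

definition Nr :: "real \<Rightarrow> real \<Rightarrow> real" where
  "Nr x y = mu 0 / (2 * a * x) * (\<bar>x - y\<bar> powr (- a) - \<bar>x + y\<bar> powr (- a))"

text \<open>For y > x, y^2 factors out and z = x / y. For y < x the indicator cuts t off at z^2 with
  z = y / x, and the substitution t = z^2 t' exchanges the roles of the factors 1 - t and y^2 - t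
  x^2, so the same integral appears. At y = x the kernel is singular.\<close>

lemma kernel_identity:
  assumes x: "0 < x" "0 < y" "y \<noteq> x"
  shows "(\<integral>\<^sup>+t. ennreal (indicator {0<..<1} t * (indicator {0<..} (y\<^sup>2 - t * x\<^sup>2) * (m t * (y\<^sup>2 - t * x\<^sup>2) powr (sg - 1)))) \<partial>lborel) = ennreal (Nr x y)"
    (is "?L = _")
proof -
  let ?f = "\<lambda>t. indicator {0<..<1} t * (indicator {0<..} (y\<^sup>2 - t * x\<^sup>2) * (m t * (y\<^sup>2 - t * x\<^sup>2) powr (sg - 1)))"
  let ?h = "\<lambda>z t. indicator {0<..<1} t * (m t * (1 - t * z\<^sup>2) powr (sg - 1))"
  have sq: "(y\<^sup>2) powr (sg - 1) = 1 / (y * y powr a)"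
  proof -
    have "(y\<^sup>2) powr (sg - 1) = y powr (2 * (sg - 1))" using x by (simp add: powr_powr flip: powr_numeral)
    also have "2 * (sg - 1) = - (1 + a)" by (simp add: sg_def field_simps)
    finally show ?thesis unfolding powr_minus_divide powr_add using x by simp
  qed
  show ?thesis
  proof (cases "x < y")
    case True
    define z where "z = x / y"
    have z: "0 < z" "z < 1" using True x by (auto simp: z_def)
    have "?L = (\<integral>\<^sup>+t. ennreal ((y\<^sup>2) powr (sg - 1)) * ennreal (?h z t) \<partial>lborel)"
    proof (rule nn_integral_cong)
      fix t :: real
      show "ennreal (?f t) =
         ennreal ((y\<^sup>2) powr (sg - 1)) * ennreal (?h z t)"
      proof (cases "t \<in> {0<..<1}")
        case t: True
        have "t * z\<^sup>2 < 1 * 1" using t z by (intro mult_strict_mono power_less_one_iff[THEN iffD2]) auto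
        then have p: "0 < 1 - t * z\<^sup>2" by simp
        have e: "y\<^sup>2 - t * x\<^sup>2 = y\<^sup>2 * (1 - t * z\<^sup>2)" using x by (simp add: z_def power_divide field_simps)
        have "0 < y\<^sup>2 - t * x\<^sup>2" unfolding e using p x by simp
        moreover have "(y\<^sup>2 - t * x\<^sup>2) powr (sg - 1) = (y\<^sup>2) powr (sg - 1) * (1 - t * z\<^sup>2) powr (sg - 1)"
          unfolding e using p x by (simp add: powr_mult)
        ultimately show ?thesis using t m_nonneg by (simp add: mult_ac flip: ennreal_mult)
      qed simp
    qed
    also have "\<dots> = ennreal ((y\<^sup>2) powr (sg - 1)) * ennreal (hyp z)"
      by (subst nn_integral_cmult) (auto simp: hyp_integral[OF z])
    also have "\<dots> = ennreal ((y\<^sup>2) powr (sg - 1) * hyp z)" by (simp add: ennreal_mult')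
    also have "(y\<^sup>2) powr (sg - 1) * hyp z = Nr x y"
    proof -
      have "1 - z = (y - x) / y" "1 + z = (y + x) / y" using x by (auto simp: z_def field_simps)
      then have "(1 - z) powr (- a) = (y - x) powr (- a) * y powr a" "(1 + z) powr (- a) = (y + x) powr (- a) * y powr a"
        using x True by (simp_all add: powr_divide powr_minus_divide)
      moreover have "\<bar>x - y\<bar> = y - x" "\<bar>x + y\<bar> = y + x" using x True by auto
      ultimately show ?thesis
        unfolding sq hyp_def Nr_def using x a by (simp add: z_def field_simps)
    qed
    finally show ?thesis .
  next
    case False
    then have lt: "y < x" using x by simp
    define z where "z = y / x"
    have z: "0 < z" "z < 1" using lt x by (auto simp: z_def)
    have za: "(z\<^sup>2) powr (a / 2) = z powr a"
      using z by (simp add: powr_powr flip: powr_numeral)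
    have "?L = ennreal \<bar>z\<^sup>2\<bar> * (\<integral>\<^sup>+t. ennreal (?f (0 + z\<^sup>2 * t)) \<partial>lborel)"
      by (rule nn_integral_real_affine) (use z in auto)
    also have "(\<integral>\<^sup>+t. ennreal (?f (0 + z\<^sup>2 * t)) \<partial>lborel) =
      (\<integral>\<^sup>+t. ennreal (z powr a * (y\<^sup>2) powr (sg - 1)) * ennreal (?h z t) \<partial>lborel)"
    proof (rule nn_integral_cong)
      fix t :: real
      have e: "y\<^sup>2 - (0 + z\<^sup>2 * t) * x\<^sup>2 = y\<^sup>2 * (1 - t)" using x by (simp add: z_def power_divide field_simps)
      have i: "z\<^sup>2 * t < 1" if "0 < t" "t < 1"
      proof -
        have "z\<^sup>2 * t < 1 * 1" using that z by (intro mult_strict_mono power_less_one_iff[THEN iffD2]) auto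
        then show ?thesis by simp
      qed
      show "ennreal (?f (0 + z\<^sup>2 * t)) =
        ennreal (z powr a * (y\<^sup>2) powr (sg - 1)) * ennreal (?h z t)"
      proof (cases "t \<in> {0<..<1}")
        case t: True
        have "m (z\<^sup>2 * t) * (y\<^sup>2 * (1 - t)) powr (sg - 1) = (z powr a * (y\<^sup>2) powr (sg - 1)) * (m t * (1 - t * z\<^sup>2) powr (sg - 1))"
          unfolding m_def using t z x by (simp add: powr_mult za mult_ac)
        moreover have "indicator {0<..<1} (0 + z\<^sup>2 * t) = (1::real)" "indicator {0<..} (y\<^sup>2 * (1 - t)) = (1::real)"
          using t z x i by auto
        ultimately show ?thesis unfolding e using t m_nonneg z by (simp add: ennreal_mult'')
      next
        case f: False
        have "indicator {0<..<1} (0 + z\<^sup>2 * t) * indicator {0<..} (y\<^sup>2 * (1 - t)) = (0::real)"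
          using f z x by (auto simp: indicator_def zero_less_mult_iff)
        then show ?thesis unfolding e using f by auto
      qed
    qed
    also have "ennreal \<bar>z\<^sup>2\<bar> * \<dots> = ennreal (z\<^sup>2) * (ennreal (z powr a * (y\<^sup>2) powr (sg - 1)) * ennreal (hyp z))"
      by (subst nn_integral_cmult) (auto simp: hyp_integral[OF z])
    also have "\<dots> = ennreal (z\<^sup>2 * (z powr a * (y\<^sup>2) powr (sg - 1) * hyp z))"
      by (simp add: ennreal_mult')
    also have "z\<^sup>2 * (z powr a * (y\<^sup>2) powr (sg - 1) * hyp z) = Nr x y"
    proof -
      have "1 - z = (x - y) / x" "1 + z = (x + y) / x" using x by (auto simp: z_def field_simps)
      then have p: "(1 - z) powr (- a) = (x - y) powr (- a) * x powr a" "(1 + z) powr (- a) = (x + y) powr (- a) * x powr a"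
        using x lt by (simp_all add: powr_divide powr_minus_divide)
      have abs: "\<bar>x - y\<bar> = x - y" "\<bar>x + y\<bar> = x + y" using x lt by auto
      have pz: "z powr a = y powr a / x powr a" using x by (simp add: z_def powr_divide)
      show ?thesis
        unfolding sq hyp_def Nr_def p abs pz using x a by (simp add: z_def power2_eq_square field_simps)
    qed
    finally show ?thesis .
  qed
qed

end

section \<open>From the kernel identity to the velocity\<close>

context riesz
begin

lemma nn_set_integral:
  assumes "set_integrable lborel S f" "\<And>x. x \<in> S \<Longrightarrow> 0 \<le> (f x :: real)"
  shows "(\<integral>\<^sup>+x. ennreal (indicator S x * f x) \<partial>lborel) = ennreal (LINT x:S|lborel. f x)"
  unfolding set_lebesgue_integral_def real_scaleR_def
  by (rule nn_integral_eq_integral) (use assms in \<open>auto simp: set_integrable_def indicator_def\<close>)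

text \<open>Shift to v = t x^2 + l in J and apply Tonelli; the inner integral over t is the kernel
  identity except at the null point v = x^2. Working with nonnegative integrals transfers finiteness
  from V to the kernel integral.\<close>

lemma V_kernel:
  assumes H: "tower H" and I: "J_able (H 0)" and x: "0 < x"
  shows "(\<integral>\<^sup>+v. ennreal (indicator {0<..} v * (H 0 v * Nr x (sqrt v))) \<partial>lborel) = ennreal (V (H 0) (x\<^sup>2))" "0 \<le> V (H 0) (x\<^sup>2)"
proof -
  let ?s = "x\<^sup>2"
  let ?K = "\<lambda>v. ennreal (indicator {0<..} v * (H 0 v * Nr x (sqrt v)))"
  have In: "J_able (H n)" for n
    using I J1_integrable[OF H order_refl] by (cases n) auto
  note TJ = tower_J[OF H In]
  have s: "0 < ?s" using x by simp
  have im: "set_integrable lborel {0<..<1} m" using m_power_integral(1)[of 0] by simp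
  define u where "u v = indicator {0<..} v * H 0 v" for v
  have u_meas [measurable]: "u \<in> borel_measurable borel"
  proof -
    have "continuous_on {0<..} (H 0)" by (rule continuous_on_subset[OF tower_continuous[OF H]]) auto
    then show ?thesis
      using borel_measurable_continuous_on_indicator[of "{0<..}" "H 0"] by (simp add: u_def[abs_def])
  qed
  have u0: "0 \<le> u v" for v using tower_nonneg[OF H] by (simp add: u_def indicator_def)
  have i1: "set_integrable lborel {0<..<1} (\<lambda>t. m t * J (H 0) (t * ?s))"
    by (rule scal_integrable[OF TJ m_cont _ im]) (use m_nonneg in auto)
  show "0 \<le> V (H 0) (x\<^sup>2)"
    unfolding V_def scal_def set_lebesgue_integral_def
    using m_nonneg tower_nonneg[OF TJ] by (intro integral_nonneg_AE) (auto simp: indicator_def)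
  let ?F = "\<lambda>t v. indicator {0<..} (v - t * ?s) * ((v - t * ?s) powr (sg - 1) * u v)"
  have J: "ennreal (J (H 0) (t * ?s)) = (\<integral>\<^sup>+v. ennreal (?F t v) \<partial>lborel)" if t: "0 < t" for t
  proof -
    have ts: "0 < t * ?s" using t s by simp
    have "(\<integral>\<^sup>+v. ennreal (?F t v) \<partial>lborel) = ennreal \<bar>1\<bar> * (\<integral>\<^sup>+l. ennreal (?F t (t * ?s + 1 * l)) \<partial>lborel)"
      by (rule nn_integral_real_affine) auto
    also have "\<dots> = (\<integral>\<^sup>+l. ennreal (indicator {0<..} l * (l powr (sg - 1) * H 0 (t * ?s + l))) \<partial>lborel)"
      using ts by (auto intro!: nn_integral_cong simp: u_def indicator_def)
    also have "\<dots> = ennreal (J (H 0) (t * ?s))"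
      unfolding J_def by (rule nn_set_integral) (use J_integrable[OF H I] tower_nonneg[OF H] ts in auto)
    finally show ?thesis ..
  qed
  let ?G = "\<lambda>t v. indicator {0<..<1} t * (indicator {0<..} (v - t * ?s) * (m t * (v - t * ?s) powr (sg - 1)))"
  have "ennreal (V (H 0) ?s) = (\<integral>\<^sup>+t. ennreal (indicator {0<..<1} t * (m t * J (H 0) (t * ?s))) \<partial>lborel)"
    unfolding V_def scal_def using nn_set_integral[OF i1] m_nonneg tower_nonneg[OF TJ, of _ 0] by simp
  also have "\<dots> = (\<integral>\<^sup>+t. (\<integral>\<^sup>+v. ennreal (u v) * ennreal (?G t v) \<partial>lborel) \<partial>lborel)"
  proof (rule nn_integral_cong)
    fix t :: real
    show "ennreal (indicator {0<..<1} t * (m t * J (H 0) (t * ?s))) = (\<integral>\<^sup>+v. ennreal (u v) * ennreal (?G t v) \<partial>lborel)"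
    proof (cases "t \<in> {0<..<1}")
      case True
      have "ennreal (indicator {0<..<1} t * (m t * J (H 0) (t * ?s))) = ennreal (m t) * ennreal (J (H 0) (t * ?s))"
        using True m_nonneg[of t] by (simp add: ennreal_mult')
      also have "\<dots> = (\<integral>\<^sup>+v. ennreal (m t) * ennreal (?F t v) \<partial>lborel)"
        using True by (subst nn_integral_cmult) (auto simp: J)
      also have "\<dots> = (\<integral>\<^sup>+v. ennreal (u v) * ennreal (?G t v) \<partial>lborel)"
      proof (rule nn_integral_cong)
        fix v
        have "m t * ?F t v = u v * ?G t v" using True by (simp add: mult_ac)
        then show "ennreal (m t) * ennreal (?F t v) = ennreal (u v) * ennreal (?G t v)"
          using m_nonneg[of t] u0[of v] by (simp only: ennreal_mult'[symmetric])
      qed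
      finally show ?thesis .
    qed simp
  qed
  also have "\<dots> = (\<integral>\<^sup>+v. (\<integral>\<^sup>+t. ennreal (u v) * ennreal (?G t v) \<partial>lborel) \<partial>lborel)"
  proof (rule lborel_pair.Fubini')
    have "(\<lambda>p. ennreal (u (fst p)) * ennreal (?G (snd p) (fst p))) \<in> borel_measurable (lborel \<Otimes>\<^sub>M lborel)"
      by measurable
    then show "(\<lambda>(v, t). ennreal (u v) * ennreal (?G t v)) \<in> borel_measurable (lborel \<Otimes>\<^sub>M lborel)"
      by (simp add: case_prod_beta')
  qed
  also have "\<dots> = (\<integral>\<^sup>+v. ?K v \<partial>lborel)"
  proof (rule nn_integral_cong_AE)
    have "AE v in lborel. v \<noteq> ?s" by (rule AE_lborel_singleton)
    then show "AE v in lborel. (\<integral>\<^sup>+t. ennreal (u v) * ennreal (?G t v) \<partial>lborel) = ?K v"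
    proof eventually_elim
      case (elim v)
      show ?case
      proof (cases "0 < v")
        case True
        have "sqrt v \<noteq> x" using elim True by auto
        then have "(\<integral>\<^sup>+t. ennreal (?G t v) \<partial>lborel) = ennreal (Nr x (sqrt v))"
          using kernel_identity[of x "sqrt v"] x True by simp
        then have "(\<integral>\<^sup>+t. ennreal (u v) * ennreal (?G t v) \<partial>lborel) = ennreal (u v) * ennreal (Nr x (sqrt v))"
          by (subst nn_integral_cmult) auto
        then show ?thesis using True tower_nonneg[OF H, of v 0] by (simp add: u_def ennreal_mult')
      qed (simp add: u_def)
    qed
  qed
  finally show "(\<integral>\<^sup>+v. ?K v \<partial>lborel) = ennreal (V (H 0) (x\<^sup>2))" by simp
qed

lemma Nr_nonneg:
  assumes "0 < x" "0 < y" "y \<noteq> x" shows "0 \<le> Nr x y"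
proof -
  have "\<bar>x + y\<bar> powr (- a) \<le> \<bar>x - y\<bar> powr (- a)"
    using assms a by (intro powr_mono2') auto
  then show ?thesis using assms a mu_pos[of 0] by (simp add: Nr_def)
qed

abbreviation vker :: "real \<Rightarrow> real \<Rightarrow> real" where
  "vker x y \<equiv> \<bar>x - y\<bar> powr (- a) - \<bar>x + y\<bar> powr (- a)"

text \<open>The substitution v = y^2, whose Jacobian 2 y supplies the factor of the odd function y H
  0(y^2).\<close>

lemma velocity_integral_pos:
  assumes H: "tower H" and I: "J_able (H 0)" and x: "0 < x"
  shows "(\<lambda>y. y * H 0 (y\<^sup>2) * vker x y) absolutely_integrable_on {0<..} \<and>
    integral {0<..} (\<lambda>y. y * H 0 (y\<^sup>2) * vker x y) = a / mu 0 * x * V (H 0) (x\<^sup>2)"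
proof -
  let ?F = "\<lambda>y. y * H 0 (y\<^sup>2) * vker x y" and ?G = "\<lambda>f y. \<bar>2 * y\<bar> * f (y\<^sup>2)"
  let ?f = "\<lambda>v. H 0 v * Nr x (sqrt v)"
  have meas: "(\<lambda>v. indicator {0<..} v * ?f v) \<in> borel_measurable borel"
  proof -
    have [measurable]: "(\<lambda>v. indicator {0<..} v *\<^sub>R H 0 v) \<in> borel_measurable borel"
      by (rule borel_measurable_continuous_on_indicator) (auto intro: continuous_on_subset[OF tower_continuous[OF H, of 0]])
    have "(\<lambda>v. (indicator {0<..} v *\<^sub>R H 0 v) * Nr x (sqrt v)) \<in> borel_measurable borel"
      unfolding Nr_def by measurable
    then show ?thesis by (simp add: mult.assoc)
  qed
  have AE0: "AE v in lborel. 0 \<le> indicator {0<..} v * ?f v"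
    using AE_lborel_singleton[of "x\<^sup>2"]
  proof eventually_elim
    case (elim v)
    show ?case
    proof (cases "0 < v")
      case True
      then have "sqrt v \<noteq> x" using elim by auto
      then show ?thesis using Nr_nonneg[of x "sqrt v"] x True tower_nonneg[OF H, of v 0] by simp
    qed simp
  qed
  note K = V_kernel[OF H I x]
  have int: "integrable lborel (\<lambda>v. indicator {0<..} v * ?f v)"
    by (rule integrableI_nn_integral_finite[OF _ AE0 K(1)]) (use meas in simp)
  then have si: "set_integrable lborel {0<..} ?f" by (simp add: set_integrable_def)
  have "(LINT v:{0<..}|lborel. ?f v) = V (H 0) (x\<^sup>2)"
    unfolding set_lebesgue_integral_def real_scaleR_def
    by (subst integral_eq_nn_integral[OF _ AE0]) (use meas K in auto)
  then have val: "integral {0<..} ?f = V (H 0) (x\<^sup>2)" using set_borel_integral_eq_integral(2)[OF si] by simp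
  have ai: "?f absolutely_integrable_on {0<..}"
    unfolding set_integrable_def using int meas by (subst integrable_completion) auto
  have img: "(\<lambda>y::real. y\<^sup>2) ` {0<..} = {0<..}"
  proof safe
    fix y :: real assume "0 < y"
    then show "y \<in> (\<lambda>y. y\<^sup>2) ` {0<..}" by (intro image_eqI[of _ _ "sqrt y"]) auto
  qed auto
  have "(?G ?f) absolutely_integrable_on {0<..} \<and> integral {0<..} (?G ?f) = V (H 0) (x\<^sup>2)"
  proof (subst has_absolute_integral_change_of_variables_1'[where g="\<lambda>y. y\<^sup>2" and g'="\<lambda>y. 2 * y" and f="?f"])
    show "((\<lambda>y. y\<^sup>2) has_real_derivative 2 * y) (at y within {0<..})" for y
      by (auto intro!: derivative_eq_intros)
    show "inj_on (\<lambda>y::real. y\<^sup>2) {0<..}" by (auto intro!: inj_onI simp: power2_eq_iff)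
    show "?f absolutely_integrable_on (\<lambda>y. y\<^sup>2) ` {0<..} \<and> integral ((\<lambda>y. y\<^sup>2) ` {0<..}) ?f = V (H 0) (x\<^sup>2)"
      unfolding img using ai val by blast
  qed simp
  moreover have eq: "?F y = (a / mu 0 * x) * (?G ?f y)" if "y \<in> {0<..}" for y
    using that x a mu_pos[of 0] by (simp add: Nr_def)
  ultimately have 1: "(\<lambda>y. (a / mu 0 * x) * (?G ?f y)) absolutely_integrable_on {0<..}"
    and 2: "integral {0<..} (\<lambda>y. (a / mu 0 * x) * (?G ?f y)) = a / mu 0 * x * V (H 0) (x\<^sup>2)"
    by (auto simp only: integral_mult_right intro: set_integrable_mult_right)
  show ?thesis
  proof
    show "?F absolutely_integrable_on {0<..}"
      using 1 by (rule set_integrable_cong[THEN iffD1, rotated 3]) (auto simp: eq)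
    show "integral {0<..} ?F = a / mu 0 * x * V (H 0) (x\<^sup>2)"
      unfolding 2[symmetric] by (rule integral_cong) (rule eq)
  qed
qed

text \<open>Both sides are odd in \<open>x\<close>, and zero at 0.\<close>

lemma velocity_integral:
  assumes H: "tower H" and I: "J_able (H 0)"
  shows "(\<lambda>y. y * H 0 (y\<^sup>2) * vker x y) absolutely_integrable_on {0<..} \<and>
    integral {0<..} (\<lambda>y. y * H 0 (y\<^sup>2) * vker x y) = a / mu 0 * x * V (H 0) (x\<^sup>2)"
proof -
  let ?F = "\<lambda>x y. y * H 0 (y\<^sup>2) * vker x y"
  consider "x = 0" | "0 < x" | "0 < - x" by linarith
  then show ?thesis
  proof cases
    case 1
    then show ?thesis by simp
  next
    case 2
    then show ?thesis by (rule velocity_integral_pos[OF H I])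
  next
    case 3
    have eq: "?F x y = (- 1) * (?F (- x) y)" for y
    proof -
      have "\<bar>- x - y\<bar> = \<bar>x + y\<bar>" "\<bar>- x + y\<bar> = \<bar>x - y\<bar>" by (auto simp: abs_if)
      then show ?thesis by (simp add: algebra_simps)
    qed
    show ?thesis
      unfolding eq integral_mult_right
    proof
      note pos = velocity_integral_pos[OF H I 3]
      show "(\<lambda>y. (- 1) * (?F (- x) y)) absolutely_integrable_on {0<..}"
        by (rule set_integrable_mult_right[OF pos[THEN conjunct1]])
      show "(- 1) * integral {0<..} (\<lambda>y. ?F (- x) y) = a / mu 0 * x * V (H 0) (x\<^sup>2)"
        unfolding pos[THEN conjunct2] by simp
    qed
  qed
qed

text \<open>Under y = b y' the measure and the factor y contribute \<open>b\<close> each, and the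
  kernel b^(-a).\<close>

lemma velocity_integral_scaled:
  assumes H: "tower H" and I: "J_able (H 0)" and b: "0 < b"
  shows "((\<lambda>y. y * H 0 ((y / b)\<^sup>2) * vker x y) has_integral (b powr (2 - a) * (a / mu 0 * (x / b) * V (H 0) ((x / b)\<^sup>2)))) {0<..}"
proof -
  let ?F = "\<lambda>y. y * H 0 (y\<^sup>2) * vker (x / b) y"
  let ?I = "a / mu 0 * (x / b) * V (H 0) ((x / b)\<^sup>2)"
  have img: "(\<lambda>y. y / b) ` {0<..} = {0<..}"
  proof safe
    fix y :: real assume "0 < y"
    then show "y \<in> (\<lambda>y. y / b) ` {0<..}" using b by (intro image_eqI[of _ _ "y * b"]) auto
  qed (use b in auto)
  have "(\<lambda>y. \<bar>1 / b\<bar> * ?F (y / b)) absolutely_integrable_on {0<..} \<and> integral {0<..} (\<lambda>y. \<bar>1 / b\<bar> * ?F (y / b)) = ?I"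
  proof (subst has_absolute_integral_change_of_variables_1'[where g="\<lambda>y. y / b" and g'="\<lambda>_. 1 / b" and f="?F"])
    show "((\<lambda>y. y / b) has_real_derivative 1 / b) (at y within {0<..})" for y
      using b by (auto intro!: derivative_eq_intros)
    show "inj_on (\<lambda>y. y / b) {0<..}" using b by (auto intro: inj_onI)
    show "?F absolutely_integrable_on (\<lambda>y. y / b) ` {0<..} \<and> integral ((\<lambda>y. y / b) ` {0<..}) ?F = ?I"
      unfolding img by (rule velocity_integral[OF H I])
  qed simp
  then have "((\<lambda>y. \<bar>1 / b\<bar> * ?F (y / b)) has_integral ?I) {0<..}"
    unfolding has_integral_iff using set_lebesgue_integral_eq_integral(1) by blast
  from has_integral_mult_right[OF this, of "b powr (2 - a)"]
  have "((\<lambda>y. b powr (2 - a) * (\<bar>1 / b\<bar> * ?F (y / b))) has_integral b powr (2 - a) * ?I) {0<..}" .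
  moreover have "b powr (2 - a) * (\<bar>1 / b\<bar> * ?F (y / b)) = y * H 0 ((y / b)\<^sup>2) * vker x y" for y
  proof -
    have sc: "\<bar>y / b\<bar> powr (- a) = \<bar>y\<bar> powr (- a) * b powr a" for y
      using b by (simp add: abs_divide powr_divide powr_minus_divide)
    have e1: "vker (x / b) (y / b) = vker x y * b powr a"
      using sc[of "x - y"] sc[of "x + y"] by (simp add: diff_divide_distrib add_divide_distrib left_diff_distrib)
    have e2: "b powr (2 - a) = b * b / b powr a" using b by (simp add: powr_diff power2_eq_square)
    have "(b * b / M) * (\<bar>1 / b\<bar> * (y / b * h * (K * M))) = y * h * K" if "0 < M" for M h K
      using b that by (simp add: field_simps)
    then show ?thesis unfolding e1 e2 using b by simp
  qed
  ultimately show ?thesis by simp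
qed

end

section \<open>Smoothness and convexity of the profile\<close>

lemma tower_square_deriv:
  assumes "tower H" shows "((\<lambda>x. H 0 (x\<^sup>2)) has_real_derivative - 2 * x * H 1 (x\<^sup>2)) (at x)"
proof -
  have "((H 0 \<circ> (\<lambda>x. x\<^sup>2)) has_real_derivative - H 1 (x\<^sup>2) * (2 * x)) (at x within UNIV)"
  proof (rule DERIV_image_chain)
    show "(H 0 has_real_derivative - H 1 (x\<^sup>2)) (at (x\<^sup>2) within (\<lambda>x. x\<^sup>2) ` UNIV)"
    proof (rule DERIV_subset)
      show "(H 0 has_real_derivative - H 1 (x\<^sup>2)) (at (x\<^sup>2) within {0..})"
        using deriv_nonnegD[OF tower_deriv[OF assms, of 0], of "x\<^sup>2"] by simp
    qed auto
  qed (auto intro!: derivative_eq_intros)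
  then show ?thesis by (simp add: o_def mult_ac)
qed

text \<open>Made to be closed under differentiation: a derivative lowers \<open>j\<close>, or raises
  it and shifts the tower, so odd members occur too. Since x^2 maps the line into the half-line,
  one-sided derivatives at 0 give two-sided ones here.\<close>

inductive even_smooth :: "(real \<Rightarrow> real) \<Rightarrow> bool" where
  monomial: "tower H \<Longrightarrow> even_smooth (\<lambda>x. c * x ^ j * H 0 (x\<^sup>2))"
| add: "even_smooth f \<Longrightarrow> even_smooth g \<Longrightarrow> even_smooth (\<lambda>x. f x + g x)"

lemma even_smooth_deriv: "even_smooth f \<Longrightarrow> \<exists>g. even_smooth g \<and> (\<forall>x. (f has_real_derivative g x) (at x))"
proof (induction rule: even_smooth.induct)
  case (monomial H c j)
  let ?g = "\<lambda>x. (c * real j) * x ^ (j - 1) * H 0 (x\<^sup>2) + (- 2 * c) * x ^ Suc j * H 1 (x\<^sup>2)"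
  have "even_smooth ?g"
    using even_smooth.monomial[OF tower_shift[OF monomial], of "- 2 * c" "Suc j"]
    by (intro even_smooth.add even_smooth.monomial[OF monomial]) simp
  moreover have "((\<lambda>x. c * x ^ j * H 0 (x\<^sup>2)) has_real_derivative ?g x) (at x)" for x
    using tower_square_deriv[OF monomial, of x] by (auto intro!: derivative_eq_intros simp: algebra_simps)
  ultimately show ?case by blast
next
  case (add f g)
  then obtain f' g' where "even_smooth f'" "\<forall>x. (f has_real_derivative f' x) (at x)" "even_smooth g'" "\<forall>x. (g has_real_derivative g' x) (at x)"
    by blast
  then show ?case by (intro exI[of _ "\<lambda>x. f' x + g' x"]) (auto intro: even_smooth.add DERIV_add)
qed

lemma even_smooth_imp_smooth: assumes "even_smooth f" shows "smooth_real f"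
proof -
  have "\<exists>D. \<forall>n. (even_smooth (D n) \<and> (n = 0 \<longrightarrow> D n = f)) \<and> (\<forall>x. (D n has_real_derivative D (Suc n) x) (at x))"
    by (rule dependent_nat_choice) (use assms even_smooth_deriv in auto)
  then show ?thesis unfolding smooth_real_def by blast
qed

text \<open>The graph lies above its tangents; weighting the tangent inequality at the intermediate
  point over both ends cancels the slope.\<close>

lemma tower_convex:
  assumes "tower H" shows "convex_on {0..} (H 0)"
proof (rule convex_onI)
  fix t x y :: real assume t: "0 < t" "t < 1" and xy: "x \<in> {0..}" "y \<in> {0..}"
  let ?z = "(1 - t) * x + t * y"
  have z: "0 \<le> ?z" using t xy by simp
  have tangent: "H 0 ?z - (w - ?z) * H 1 ?z \<le> H 0 w" if "0 \<le> w" for w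
    using tower_diff_bounds[OF assms z, of w 0] tower_diff_bounds[OF assms that, of ?z 0]
    by (cases "?z \<le> w") (auto simp: algebra_simps)
  have "(1 - t) * (H 0 ?z - (x - ?z) * H 1 ?z) + t * (H 0 ?z - (y - ?z) * H 1 ?z) \<le> (1 - t) * H 0 x + t * H 0 y"
    using tangent[of x] tangent[of y] t xy by (intro add_mono mult_left_mono) auto
  then show "H 0 ((1 - t) *\<^sub>R x + t *\<^sub>R y) \<le> (1 - t) * H 0 x + t * H 0 y" by (simp add: algebra_simps)
qed simp

section \<open>Self-similar solutions\<close>

theorem mainTheorem2:
  fixes \<alpha> T :: real
  assumes "0 < \<alpha>" and "\<alpha> < 1/2"
  shows "\<exists>cth cl :: real. \<exists>f :: real \<Rightarrow> real.
    cth > 0 \<and> cl > 0 \<and> cth - 2*\<alpha>*cl = -1 \<and>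
    (\<forall>x. f x > 0) \<and> (\<forall>x. f (-x) = f x) \<and>
    (\<forall>x y. 0 \<le> x \<longrightarrow> x \<le> y \<longrightarrow> f y \<le> f x) \<and>
    convex_on {0..} (\<lambda>x. f (sqrt x)) \<and>
    smooth_real f \<and>
    (let \<theta> = (\<lambda>x t. (T - t) powr (cth - cl) * x * f (x / (T - t) powr cl)) in
      \<forall>x t. t < T \<longrightarrow>
        vel_integrand \<alpha> \<theta> x t integrable_on {0<..} \<and>
        (\<exists>\<theta>t \<theta>x. ((\<lambda>s. \<theta> x s) has_real_derivative \<theta>t) (at t) \<and>
                 ((\<lambda>y. \<theta> y t) has_real_derivative \<theta>x) (at x) \<and>
                 \<theta>t + vel \<alpha> \<theta> x t * \<theta>x = 0))"
proof -
  define a where "a = 2 * \<alpha>"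
  have a: "0 < a" "a < 1" using assms by (auto simp: a_def)
  interpret riesz a by unfold_locales (fact a)+
  obtain H \<kappa> where H: "tower H" and low: "\<And>s. 0 \<le> s \<Longrightarrow> 1 / sqrt (1 + s) \<le> H 0 s" and \<kappa>: "0 < \<kappa>" "\<kappa> < a * V (H 0) 0"
    and I: "J_able (H 0)"
    and Vle: "\<And>s. 0 \<le> s \<Longrightarrow> V (H 0) s \<le> V (H 0) 0"
    and ode: "\<And>s. 0 \<le> s \<Longrightarrow> s * H 1 s * (2 * (\<kappa> + V (H 0) 0 - V (H 0) s)) = (V (H 0) 0 - V (H 0) s) * H 0 s"
    using profile_exists by blast
  define v where "v = V (H 0)"
  \<comment> \<open>The velocity of the odd function x g(x^2) is - k x V(x^2); \<open>k\<close>
    collects c0 / \<alpha> and the factor a / mu 0 of the kernel, with a / \<alpha> = 2.\<close>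
  define k where "k = 2 * c0 \<alpha> / mu 0"
  have k: "0 < k"
    unfolding k_def c0_def using assms mu_pos[of 0] by (intro divide_pos_pos mult_pos_pos Gamma_real_pos) auto
  \<comment> \<open>The amplitude for which cth - a cl = -1; the bound kappa < a V(0) makes the
    denominator positive.\<close>
  define A where "A = 1 / (k * (a * v 0 - (1 - a) * \<kappa>))"
  have d: "0 < a * v 0 - (1 - a) * \<kappa>"
  proof -
    have "(1 - a) * \<kappa> < 1 * \<kappa>" using a \<kappa>(1) by (intro mult_strict_right_mono) auto
    then show ?thesis using \<kappa>(2) by (simp add: v_def)
  qed
  have A: "0 < A" using k d by (simp add: A_def)
  have v0: "0 < v 0"
  proof (rule zero_less_mult_pos[OF _ a(1)])
    show "0 < a * v 0" using \<kappa> by (simp add: v_def)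
  qed
  \<comment> \<open>These values make cl - A k V equal to A k (kappa + W), so that the factor A k
    cancels and the self-similar equation becomes that of the profile.\<close>
  define cth where "cth = A * k * \<kappa>"
  define cl where "cl = A * k * (\<kappa> + v 0)"
  have c: "0 < cth" "0 < cl" using A k \<kappa> v0 by (auto simp: cth_def cl_def)
  have c1: "cth - a * cl = - 1"
  proof -
    have "cth - a * cl = - (A * (k * (a * v 0 - (1 - a) * \<kappa>)))" by (simp add: cth_def cl_def algebra_simps)
    then show ?thesis using k d by (simp add: A_def)
  qed
  define f where "f x = A * H 0 (x\<^sup>2)" for x
  define f' where "f' x = A * (- 2 * x * H 1 (x\<^sup>2))" for x
  have f': "(f has_real_derivative f' x) (at x)" for x
    unfolding f_def[abs_def] f'_def by (rule DERIV_cmult[OF tower_square_deriv[OF H]])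
  have Hpos: "0 < H 0 s" if "0 \<le> s" for s
  proof -
    have "0 < 1 / sqrt (1 + s)" using that by simp
    then show ?thesis using low[OF that] by linarith
  qed
  have "convex_on {0..} (\<lambda>x. A * H 0 x)" using A tower_convex[OF H] by (intro convex_on_cmul) auto
  then have conv: "convex_on {0..} (\<lambda>x. f (sqrt x))"
    unfolding convex_on_def by (simp add: f_def)
  have smooth: "smooth_real f"
    using even_smooth_imp_smooth[OF even_smooth.monomial[OF H, of A 0]] by (simp add: f_def[abs_def])
  have mono: "f y \<le> f x" if "0 \<le> x" "x \<le> y" for x y
    unfolding f_def using A that by (intro mult_left_mono tower_antimono[OF H] power_mono) auto
  define \<theta> where "\<theta> = (\<lambda>x t. (T - t) powr (cth - cl) * x * f (x / (T - t) powr cl))"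
  \<comment> \<open>With s = X^2 one has X f'(X) = - 2 A s H 1(s), so the equation for
    \<open>H 1\<close> says (kappa + W) X f' = - W f; adding (kappa + W) f leaves kappa f on the
    right.\<close>
  have profile: "(cl - A * k * v (X\<^sup>2)) * (f X + X * f' X) = cth * f X" for X
  proof -
    define D where "D = \<kappa> + v 0 - v (X\<^sup>2)"
    have D: "0 < D" using \<kappa> Vle[of "X\<^sup>2"] by (simp add: D_def v_def)
    have "X * f' X * D = - A * (X\<^sup>2 * H 1 (X\<^sup>2) * (2 * D))" by (simp add: f'_def power2_eq_square)
    also have "X\<^sup>2 * H 1 (X\<^sup>2) * (2 * D) = (v 0 - v (X\<^sup>2)) * H 0 (X\<^sup>2)"
      using ode[of "X\<^sup>2"] by (simp add: D_def v_def)
    finally have "D * (f X + X * f' X) = \<kappa> * f X" by (simp add: D_def f_def algebra_simps)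
    moreover have "cl - A * k * v (X\<^sup>2) = A * k * D" by (simp add: cl_def D_def algebra_simps)
    ultimately show ?thesis by (simp add: cth_def mult.assoc)
  qed
  have sol: "vel_integrand \<alpha> \<theta> x t integrable_on {0<..} \<and>
        (\<exists>\<theta>t \<theta>x. ((\<lambda>s. \<theta> x s) has_real_derivative \<theta>t) (at t) \<and>
                 ((\<lambda>y. \<theta> y t) has_real_derivative \<theta>x) (at x) \<and>
                 \<theta>t + vel \<alpha> \<theta> x t * \<theta>x = 0)" if t: "t < T" for x t
  proof -
    define e where "e = T - t"
    have e: "0 < e" using t by (simp add: e_def)
    define p where "p = cth - cl"
    define b where "b = e powr cl"
    have b: "0 < b" using e by (simp add: b_def)
    define X where "X = x / b"
    have x: "x = b * X" using b by (simp add: X_def)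
    have "((\<lambda>\<xi>. (e powr p * A) * (\<xi> * H 0 ((\<xi> / b)\<^sup>2) * vker x \<xi>)) has_integral
        (e powr p * A) * (b powr (2 - a) * (a / mu 0 * (x / b) * V (H 0) ((x / b)\<^sup>2)))) {0<..}"
      by (rule has_integral_mult_right[OF velocity_integral_scaled[OF H I b]])
    moreover have "(\<lambda>\<xi>. (e powr p * A) * (\<xi> * H 0 ((\<xi> / b)\<^sup>2) * vker x \<xi>)) = vel_integrand \<alpha> \<theta> x t"
      by (simp add: fun_eq_iff vel_integrand_def \<theta>_def f_def a_def p_def b_def e_def)
    ultimately have int: "(vel_integrand \<alpha> \<theta> x t has_integral (e powr p * A) * (b powr (2 - a) * (a / mu 0 * X * v (X\<^sup>2)))) {0<..}"
      by (simp add: X_def v_def)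
    have ka: "c0 \<alpha> / \<alpha> * (a / mu 0) = k" using assms by (simp add: k_def a_def)
    have "vel \<alpha> \<theta> x t = - (c0 \<alpha> / \<alpha>) * ((e powr p * A) * (b powr (2 - a) * (a / mu 0 * X * v (X\<^sup>2))))"
      unfolding vel_def integral_unique[OF int] ..
    also have "\<dots> = - (c0 \<alpha> / \<alpha> * (a / mu 0)) * (A * (e powr p * b powr (2 - a)) * X * v (X\<^sup>2))"
    proof -
      have "- q * ((P * B) * (M * (r * Y * w))) = - (q * r) * (B * (P * M) * Y * w)" for q P B M r Y w :: real
        by (simp add: mult_ac)
      then show ?thesis .
    qed
    \<comment> \<open>Here cth - a cl = -1 enters the dynamics: it makes the transport term carry
      the same power of T - t as the time derivative.\<close>
    also have "e powr p * b powr (2 - a) = b / e"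
    proof -
      have "e powr p * b powr (2 - a) = e powr (p + cl * (2 - a))" by (simp add: b_def powr_powr powr_add)
      also have "p + cl * (2 - a) = cl - 1" using c1 by (simp add: p_def algebra_simps)
      finally show ?thesis using e by (simp add: b_def powr_diff)
    qed
    finally have vel: "vel \<alpha> \<theta> x t = - (A * k * (b / e) * X * v (X\<^sup>2))" unfolding ka by (simp add: mult_ac)
    have Xt: "x * (T - t) powr (- cl) = X" by (simp add: X_def b_def e_def powr_minus_divide)
    have dp: "((\<lambda>s. (T - s) powr r) has_real_derivative - (r * e powr r / e)) (at t)" for r
      using e unfolding e_def by (auto intro!: derivative_eq_intros simp: powr_diff)
    have "((\<lambda>s. f (x * (T - s) powr (- cl))) has_real_derivative f' X * (x * (cl * e powr (- cl) / e))) (at t)"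
    proof (rule DERIV_chain2[where f=f and g="\<lambda>s. x * (T - s) powr (- cl)"])
      show "(f has_real_derivative f' X) (at (x * (T - t) powr (- cl)))" unfolding Xt by (rule f')
      show "((\<lambda>s. x * (T - s) powr (- cl)) has_real_derivative x * (cl * e powr (- cl) / e)) (at t)"
        using DERIV_cmult[OF dp[of "- cl"], of x] by simp
    qed
    also have "x * (cl * e powr (- cl) / e) = cl * (x * e powr (- cl)) / e" by simp
    also have "x * e powr (- cl) = X" using Xt by (simp only: e_def)
    finally have df: "((\<lambda>s. f (x * (T - s) powr (- cl))) has_real_derivative f' X * (cl * X / e)) (at t)" .
    have \<theta>eq: "\<theta> y s = (T - s) powr p * y * f (y * (T - s) powr (- cl))" for y s
      by (simp add: \<theta>_def p_def powr_minus_divide)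
    define \<theta>t where "\<theta>t = e powr p * x / e * (cl * X * f' X - p * f X)"
    define \<theta>x where "\<theta>x = e powr p * (f X + X * f' X)"
    have "((\<lambda>s. \<theta> x s) has_real_derivative \<theta>t) (at t)"
    proof -
      have "((\<lambda>s. (T - s) powr p * x * f (x * (T - s) powr (- cl))) has_real_derivative
          (- (p * e powr p / e) * x) * f (x * (T - t) powr (- cl)) + (f' X * (cl * X / e)) * ((T - t) powr p * x)) (at t)"
        by (rule DERIV_mult[OF DERIV_cmult_right[OF dp] df])
      then show ?thesis unfolding \<theta>eq Xt \<theta>t_def using e
        by (simp add: e_def[symmetric] field_simps)
    qed
    moreover have "((\<lambda>y. \<theta> y t) has_real_derivative \<theta>x) (at x)"
    proof -
      have "((\<lambda>y. f (y / b)) has_real_derivative f' X * (1 / b)) (at x)"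
        by (rule DERIV_chain2[where f=f and g="\<lambda>y. y / b"]) (use f' b in \<open>auto simp: X_def intro!: derivative_eq_intros\<close>)
      then have "((\<lambda>y. e powr p * y * f (y / b)) has_real_derivative e powr p * f (x / b) + f' X * (1 / b) * (e powr p * x)) (at x)"
        by (auto intro!: derivative_eq_intros)
      moreover have "e powr p * f (x / b) + f' X * (1 / b) * (e powr p * x) = \<theta>x"
        by (simp add: \<theta>x_def X_def algebra_simps)
      ultimately show ?thesis by (simp add: \<theta>_def p_def b_def e_def)
    qed
    moreover have "\<theta>t + vel \<alpha> \<theta> x t * \<theta>x = 0"
    proof -
      have "\<theta>t + vel \<alpha> \<theta> x t * \<theta>x = e powr p * b / e * X * ((cl - A * k * v (X\<^sup>2)) * (f X + X * f' X) - cth * f X)"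
        unfolding \<theta>t_def \<theta>x_def vel p_def unfolding x using e by (simp add: field_simps)
      then show ?thesis unfolding profile by simp
    qed
    ultimately show ?thesis using int by blast
  qed
  show ?thesis
  proof (rule exI[of _ cth], rule exI[of _ cl], rule exI[of _ f], intro conjI)
    show "let \<theta> = (\<lambda>x t. (T - t) powr (cth - cl) * x * f (x / (T - t) powr cl)) in
      \<forall>x t. t < T \<longrightarrow>
        vel_integrand \<alpha> \<theta> x t integrable_on {0<..} \<and>
        (\<exists>\<theta>t \<theta>x. ((\<lambda>s. \<theta> x s) has_real_derivative \<theta>t) (at t) \<and>
                 ((\<lambda>y. \<theta> y t) has_real_derivative \<theta>x) (at x) \<and>
                 \<theta>t + vel \<alpha> \<theta> x t * \<theta>x = 0)"
      unfolding \<theta>_def[symmetric] Let_def using sol by blast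
    show "cth - 2*\<alpha>*cl = -1" using c1 by (simp add: a_def)
    show "\<forall>x. f x > 0" using A Hpos by (simp add: f_def)
    show "\<forall>x. f (-x) = f x" by (simp add: f_def)
    show "\<forall>x y. 0 \<le> x \<longrightarrow> x \<le> y \<longrightarrow> f y \<le> f x" using mono by blast
  qed (use c conv smooth in auto)
qed

end
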